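(* Let $M\in\{-1,0,1\}$ and $N\ge-1$ be integers with $M+N\ge1$. Then the vectors $\{\tau^{(M,N)}(\mathbf a,\mathbf b):(\mathbf a,\mathbf b)\in\mathcal C^{M,N}\}$ (their images) form a basis of $W^{M,N}$, and $\dim W^{M,N}=2^{M+N-1}$.
   Context: Let $\mathcal H$ be the Lie algebra with basis $\bar e_i,\bar h_i,\bar f_i$ ($i\in\mathbb Z$) and brackets $[\bar e_i,\bar f_j]=\bar h_{i+j}$, all other brackets between basis elements zero. Let $\mathcal H^-$ be spanned by the basis elements with index $\le0$, and $M_{\mathcal H}=U(\mathcal H)\otimes_{U(\mathcal H^-)}\mathbb C\bar v$ the module induced from the trivial one-dimensional $\mathcal H^-$-module. With $\bar e(z)=\sum_i\bar e_iz^i$ etc., $W$ is the quotient of $M_{\mathcal H}$ by the span of all $z$-coefficients of $\bar e(z)^2u,\bar f(z)^2u,\bar e(z)\bar h(z)u,\bar f(z)\bar h(z)u,\bar h(z)^2u$, $u\in M_{\mathcal H}$. For integers $M,N\ge-1$ with $(M,N)\ne(-1,-1)$ let $\mathfrak g(M,N)\subset\mathcal H$ be the subalgebra generated by $\bar e_i$ ($i\ge M$) and $\bar f_j$ ($j\ge N$), and $\overline W^{M,N}=W/\mathfrak g(M,N)W$; set $W^{M,N}=\overline W^{M,N}$ if $M,N\ge0$ and $W^{M,N}=\overline W^{M,N}/\mathbb C\bar v$ if $M=-1$ or $N=-1$. Sets of $0/1$ sequences: in all conditions below, entries whose index is outside the given range are read as $0$. "Triangle relations": $b_{i+1}+a_{i+1}+a_i\le1$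 and $b_{i+1}+b_i+a_i\le1$ for all $i$. "Right neighbour condition": for each $i$ with $b_i\ne0$ there is $j>i$ with $a_j\ne0$ and $b_s=0$ for $i+1\le s\le j$. $\mathcal C^{0,N}$ is the set of $(a_{N-1},\dots,a_0;b_{N-1},\dots,b_1)\in\{0,1\}^{2N-1}$ satisfying the triangle relations, the right neighbour condition and $a_0=0$; $\tau^{(0,N)}(\mathbf a,\mathbf b)=\bar f_{N-1}^{a_{N-1}}\bar h_{N-1}^{b_{N-1}}\cdots\bar f_1^{a_1}\bar h_1^{b_1}\bar v$. $\mathcal C^{1,N}$ is the set of $(a_N,\dots,a_0;b_N,\dots,b_1)\in\{0,1\}^{2N+1}$ satisfying the triangle relations, the right neighbour condition, and: there is $j$ with $a_j\ne0$ and $b_s=0$ for all $s\le j$; $\tau^{(1,N)}(\mathbf a,\mathbf b)=\bar h_N^{b_N}\bar f_{N-1}^{a_N}\bar h_{N-1}^{b_{N-1}}\cdots\bar f_1^{a_2}\bar h_1^{b_1}\bar f_0^{a_1}\bar e_1^{1-a_0}\bar v$. $\mathcal C^{-1,N}=\mathcal C^{1,N-2}$, and for $(a_{N-2},\dots,a_0;b_{N-2},\dots,b_1)\in\mathcal C^{-1,N}$, $\tau^{(-1,N)}(\mathbf a,\mathbf b)=\bar f_{N-1}^{a_{N-2}}\bar f_{N-2}^{a_{N-3}}\bar h_{N-2}^{b_{N-2}}\cdots\bar f_2^{a_1}\bar h_2^{b_2}\bar f_1^{a_0}\bar h_1^{b_1}\bar v$. *)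

theory Defs
  imports Complex_Main "HOL-Library.Function_Algebras"
begin

datatype gen = Ee int | Hh int | Ff int

fun gidx :: "gen \<Rightarrow> int" where
  "gidx (Ee i) = i" | "gidx (Hh i) = i" | "gidx (Ff i) = i"

definition fins :: "('a \<Rightarrow> complex) \<Rightarrow> bool" where
  "fins p \<longleftrightarrow> finite {w. p w \<noteq> 0}"

definition bv :: "'a \<Rightarrow> 'a \<Rightarrow> complex" where
  "bv x = (\<lambda>y. if y = x then 1 else 0)"

definition sc :: "complex \<Rightarrow> ('a \<Rightarrow> complex) \<Rightarrow> 'a \<Rightarrow> complex" where
  "sc c p = (\<lambda>w. c * p w)"

inductive_set lspan :: "('a \<Rightarrow> complex) set \<Rightarrow> ('a \<Rightarrow> complex) set" for S where
  lspan_zero: "0 \<in> lspan S"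
| lspan_base: "x \<in> S \<Longrightarrow> x \<in> lspan S"
| lspan_add: "x \<in> lspan S \<Longrightarrow> y \<in> lspan S \<Longrightarrow> x + y \<in> lspan S"
| lspan_scale: "x \<in> lspan S \<Longrightarrow> sc c x \<in> lspan S"

fun bbr :: "gen \<Rightarrow> gen \<Rightarrow> gen \<Rightarrow> complex" where
  "bbr (Ee i) (Ff j) g = (if g = Hh (i + j) then 1 else 0)"
| "bbr (Ff j) (Ee i) g = (if g = Hh (i + j) then -1 else 0)"
| "bbr _ _ _ = 0"

text \<open>Elements of H are finitely supported functions gen => complex; bilinear bracket.\<close>
definition lbr :: "(gen \<Rightarrow> complex) \<Rightarrow> (gen \<Rightarrow> complex) \<Rightarrow> gen \<Rightarrow> complex" where
  "lbr x y = (\<lambda>g. \<Sum>a\<in>{a. x a \<noteq> 0}. \<Sum>b\<in>{b. y b \<noteq> 0}. x a * y b * bbr a b g)"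

definition Hminus :: "(gen \<Rightarrow> complex) set" where
  "Hminus = {x. fins x \<and> (\<forall>g. x g \<noteq> 0 \<longrightarrow> gidx g \<le> 0)}"

inductive_set gsub :: "int \<Rightarrow> int \<Rightarrow> (gen \<Rightarrow> complex) set" for M N where
  gsub_e: "M \<le> i \<Longrightarrow> bv (Ee i) \<in> gsub M N"
| gsub_f: "N \<le> j \<Longrightarrow> bv (Ff j) \<in> gsub M N"
| gsub_zero: "0 \<in> gsub M N"
| gsub_add: "x \<in> gsub M N \<Longrightarrow> y \<in> gsub M N \<Longrightarrow> x + y \<in> gsub M N"
| gsub_scale: "x \<in> gsub M N \<Longrightarrow> sc c x \<in> gsub M N"
| gsub_br: "x \<in> gsub M N \<Longrightarrow> y \<in> gsub M N \<Longrightarrow> lbr x y \<in> gsub M N"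

text \<open>Elements of T(H): finitely supported functions on words of basis labels;
  multiplication is concatenation.\<close>
definition tmul :: "(gen list \<Rightarrow> complex) \<Rightarrow> (gen list \<Rightarrow> complex) \<Rightarrow> gen list \<Rightarrow> complex" where
  "tmul p q = (\<lambda>w. \<Sum>k\<in>{0..length w}. p (take k w) * q (drop k w))"

definition iota :: "(gen \<Rightarrow> complex) \<Rightarrow> gen list \<Rightarrow> complex" where
  "iota x = (\<lambda>w. case w of [a] \<Rightarrow> x a | _ \<Rightarrow> 0)"

definition urel :: "(gen list \<Rightarrow> complex) set" where
  "urel = {tmul (iota x) (iota y) - tmul (iota y) (iota x) - iota (lbr x y) | x y. fins x \<and> fins y}"

text \<open>LM: kernel of T(H) -> M_H = U(H) (x)_{U(H^-)} C v, i.e. (two-sided ideal of U(H)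
  relations) + T(H) H^-.  The class of a word w is  w . v.\<close>
definition LM :: "(gen list \<Rightarrow> complex) set" where
  "LM = lspan ({tmul (tmul a r) b | a r b. fins a \<and> r \<in> urel \<and> fins b}
             \<union> {tmul a (iota x) | a x. fins a \<and> x \<in> Hminus})"

text \<open>Relations: pairs (X,Y) for e(z)^2, f(z)^2, e(z)h(z), f(z)h(z), h(z)^2.\<close>
definition rpairs :: "((int \<Rightarrow> gen) \<times> (int \<Rightarrow> gen)) set" where
  "rpairs = {(Ee, Ee), (Ff, Ff), (Ee, Hh), (Ff, Hh), (Hh, Hh)}"

definition psum :: "(int \<Rightarrow> gen) \<Rightarrow> (int \<Rightarrow> gen) \<Rightarrow> int \<Rightarrow> (gen list \<Rightarrow> complex) \<Rightarrow> nat
    \<Rightarrow> gen list \<Rightarrow> complex" where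
  "psum X Y n t K = (\<Sum>i\<in>{- int K..int K}. tmul (bv [X i, Y (n - i)]) t)"

text \<open>Representatives c of z^n-coefficients  sum_{i+j=n} X_i Y_j u  (u = class of t in M_H);
  the sum is finite in M_H, i.e. its symmetric partial sums are eventually constant mod LM.\<close>
definition Rco :: "(gen list \<Rightarrow> complex) set" where
  "Rco = {c. fins c \<and> (\<exists>(X, Y)\<in>rpairs. \<exists>n t. fins t \<and>
                 (\<exists>K0. \<forall>K\<ge>K0. psum X Y n t K - c \<in> LM))}"

text \<open>Kernel of T(H) -> W.\<close>
definition JW :: "(gen list \<Rightarrow> complex) set" where
  "JW = lspan (LM \<union> Rco)"

text \<open>Kernel of T(H) -> overline W^{M,N} = W / g(M,N) W.\<close>
definition Jbar :: "int \<Rightarrow> int \<Rightarrow> (gen list \<Rightarrow> complex) set" where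
  "Jbar M N = lspan (JW \<union> {tmul (iota x) t | x t. x \<in> gsub M N \<and> fins t})"

text \<open>Kernel of T(H) -> W^{M,N}.\<close>
definition JMN :: "int \<Rightarrow> int \<Rightarrow> (gen list \<Rightarrow> complex) set" where
  "JMN M N = (if M = -1 \<or> N = -1 then lspan (Jbar M N \<union> {bv []}) else Jbar M N)"

definition indep_mod :: "(gen list \<Rightarrow> complex) set \<Rightarrow> ('i \<Rightarrow> gen list \<Rightarrow> complex) \<Rightarrow> 'i set \<Rightarrow> bool" where
  "indep_mod J f S \<longleftrightarrow> (\<forall>c S'. S' \<subseteq> S \<and> finite S' \<and> (\<Sum>s\<in>S'. sc (c s) (f s)) \<in> J
                          \<longrightarrow> (\<forall>s\<in>S'. c s = 0))"

definition spans_mod :: "(gen list \<Rightarrow> complex) set \<Rightarrow> ('i \<Rightarrow> gen list \<Rightarrow> complex) \<Rightarrow> 'i set \<Rightarrow> bool" where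
  "spans_mod J f S \<longleftrightarrow> (\<forall>t. fins t \<longrightarrow>
       (\<exists>S' c. S' \<subseteq> S \<and> finite S' \<and> t - (\<Sum>s\<in>S'. sc (c s) (f s)) \<in> J))"

definition qdim :: "(gen list \<Rightarrow> complex) set \<Rightarrow> nat" where
  "qdim J = (LEAST n. \<exists>B. finite B \<and> card B = n \<and> (\<forall>b\<in>B. fins b)
                          \<and> (\<forall>t. fins t \<longrightarrow> t \<in> lspan (B \<union> J)))"

text \<open>Sequences are functions int => nat, zero outside the given index range.\<close>
definition triangle :: "(int \<Rightarrow> nat) \<Rightarrow> (int \<Rightarrow> nat) \<Rightarrow> bool" where
  "triangle a b \<longleftrightarrow> (\<forall>i. b (i+1) + a (i+1) + a i \<le> 1 \<and> b (i+1) + b i + a i \<le> 1)"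

definition rightnb :: "(int \<Rightarrow> nat) \<Rightarrow> (int \<Rightarrow> nat) \<Rightarrow> bool" where
  "rightnb a b \<longleftrightarrow> (\<forall>i. b i \<noteq> 0 \<longrightarrow>
      (\<exists>j>i. a j \<noteq> 0 \<and> (\<forall>s. i + 1 \<le> s \<and> s \<le> j \<longrightarrow> b s = 0)))"

definition C0 :: "int \<Rightarrow> ((int \<Rightarrow> nat) \<times> (int \<Rightarrow> nat)) set" where
  "C0 N = {(a, b). (\<forall>i. a i \<le> 1 \<and> b i \<le> 1)
     \<and> (\<forall>i. (i < 0 \<or> N - 1 < i) \<longrightarrow> a i = 0)
     \<and> (\<forall>i. (i < 1 \<or> N - 1 < i) \<longrightarrow> b i = 0)
     \<and> triangle a b \<and> rightnb a b \<and> a 0 = 0}"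

definition C1 :: "int \<Rightarrow> ((int \<Rightarrow> nat) \<times> (int \<Rightarrow> nat)) set" where
  "C1 N = {(a, b). (\<forall>i. a i \<le> 1 \<and> b i \<le> 1)
     \<and> (\<forall>i. (i < 0 \<or> N < i) \<longrightarrow> a i = 0)
     \<and> (\<forall>i. (i < 1 \<or> N < i) \<longrightarrow> b i = 0)
     \<and> triangle a b \<and> rightnb a b
     \<and> (\<exists>j. a j \<noteq> 0 \<and> (\<forall>s\<le>j. b s = 0))}"

definition Cset :: "int \<Rightarrow> int \<Rightarrow> ((int \<Rightarrow> nat) \<times> (int \<Rightarrow> nat)) set" where
  "Cset M N = (if M = 0 then C0 N else if M = 1 then C1 N else C1 (N - 2))"

text \<open>Words (read left to right, acting on v) of tau^{(0,N)}, tau^{(1,N)}, tau^{(-1,N)}.\<close>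
definition tw0 :: "int \<Rightarrow> (int \<Rightarrow> nat) \<Rightarrow> (int \<Rightarrow> nat) \<Rightarrow> gen list" where
  "tw0 N a b = concat (map (\<lambda>k. replicate (a k) (Ff k) @ replicate (b k) (Hh k)) (rev [1..N-1]))"

definition tw1 :: "int \<Rightarrow> (int \<Rightarrow> nat) \<Rightarrow> (int \<Rightarrow> nat) \<Rightarrow> gen list" where
  "tw1 N a b = concat (map (\<lambda>k. replicate (b k) (Hh k) @ replicate (a k) (Ff (k - 1))) (rev [1..N]))
               @ replicate (1 - a 0) (Ee 1)"

definition twm :: "int \<Rightarrow> (int \<Rightarrow> nat) \<Rightarrow> (int \<Rightarrow> nat) \<Rightarrow> gen list" where
  "twm N a b = concat (map (\<lambda>k. replicate (a (k - 1)) (Ff k) @ replicate (b k) (Hh k)) (rev [1..N-1]))"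

definition tau :: "int \<Rightarrow> int \<Rightarrow> (int \<Rightarrow> nat) \<times> (int \<Rightarrow> nat) \<Rightarrow> gen list \<Rightarrow> complex" where
  "tau M N ab = bv (case ab of (a, b) \<Rightarrow>
      (if M = 0 then tw0 N a b else if M = 1 then tw1 N a b else twm N a b))"

end

theory Submission
  imports Defs
begin

text \<open>
  Upper bound: multiplication by \<open>f\<^bsub>N-1\<^esub>\<close> maps the coinvariants for \<open>(M + 1, N - 2)\<close> onto the kernel
  of the projection from those for \<open>(M, N)\<close> to those for \<open>(M, N - 1)\<close>, because the relations
  \<open>f(z)\<^sup>2 = f(z)h(z) = 0\<close> express \<open>f\<^bsub>N-1\<^esub>\<close> times the additional generators through generators of
  \<open>g(M, N)\<close>; the same holds with \<open>e\<^bsub>M-1\<^esub>\<close>. Induction on \<open>M + N\<close> bounds the dimension by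
  \<open>2\<^bsup>M+N-1\<^esup>\<close>, and the configurations in \<open>C\<^bsup>M,N\<^esup>\<close> are at least that many.

  Independence: on the Fock space of three free fermions put \<open>e = \<psi>\<^sub>1\<psi>\<^sub>2\<^sup>*\<close>, \<open>f = \<psi>\<^sub>2\<psi>\<^sub>3\<^sup>*\<close>,
  \<open>h = \<psi>\<^sub>1\<psi>\<^sub>3\<^sup>*\<close>; all relations of \<open>W\<close> hold because fermions square to zero. Coefficients of suitable
  basis states vanish on \<open>g(M, N)W\<close>, and with respect to them the vectors \<open>\<tau>\<close> are triangular:
  such a coefficient peels off the first letter of a word, since only one hop of a fermion can lead
  to the state.
\<close>

section \<open>The tensor algebra and the relations of the induced module\<close>

text \<open>That the vectors \<open>tau\<close> span is never shown by rewriting words: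
  independence, the codimension bound and the number of configurations together force it. The
  recursion from \<open>(M, N)\<close> to \<open>(M, N - 1)\<close> and
  \<open>(M + 1, N - 2)\<close> leaves the range of \<open>M\<close> at \<open>M = 1\<close>; there
  the step with \<open>e_0\<close>, to \<open>(0, N)\<close> and \<open>(-1, N + 1)\<close>, takes
  over. It factors through the quotient by \<open>v\<close> because \<open>e_0 v = 0\<close>, and
  this is where the additional quotient for \<open>M = -1\<close> enters.

  All modules are represented by their kernels in the tensor algebra. The quadratic relations are
  imposed as a bare span, so this span must be shown stable under left multiplication before a
  letter can act on the quotient.

  Currents of free fermions may have a central term in their commutators. The pattern of colours
  here is strictly upper triangular, so at most one contraction occurs between two currents and no
  central term arises. Vectors of Fock space are arbitrary coefficient functions; the infinite sums
  in the operators become finite at each state that is full far below and empty far above.\<close>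

declare plus_fun_apply [simp del] zero_fun_apply [simp del] minus_apply [simp del]
lemmas pointwise = plus_fun_apply zero_fun_apply minus_apply

interpretation fv: vector_space "sc :: complex \<Rightarrow> ('a \<Rightarrow> complex) \<Rightarrow> 'a \<Rightarrow> complex"
  by unfold_locales (auto simp: sc_def fun_eq_iff algebra_simps pointwise)

lemma lspan_eq_span: "lspan S = fv.span S"
proof
  show "lspan S \<subseteq> fv.span S"
  proof
    fix x assume "x \<in> lspan S"
    then show "x \<in> fv.span S"
      by induction (auto intro: fv.span_zero fv.span_base fv.span_add fv.span_scale)
  qed
  show "fv.span S \<subseteq> lspan S"
    by (rule fv.span_minimal)
      (auto simp: fv.subspace_def intro: lspan_zero lspan_base lspan_add lspan_scale)
qed

lemma sum_fun_apply: "sum f I x = (\<Sum>i\<in>I. f i x)" for f :: "'i \<Rightarrow> 'a \<Rightarrow> complex"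
  by (induct I rule: infinite_finite_induct) (simp_all add: pointwise)

lemma fins_expand: "fins p \<Longrightarrow> p = (\<Sum>w | p w \<noteq> 0. sc (p w) (bv w))"
proof
  fix x assume f: "fins p"
  have "(\<Sum>w | p w \<noteq> 0. sc (p w) (bv w)) x = (\<Sum>w | p w \<noteq> 0. if w = x then p w else 0)"
    unfolding sum_fun_apply by (rule sum.cong) (auto simp: bv_def sc_def)
  also have "\<dots> = p x" using f by (auto simp: fins_def)
  finally show "p x = (\<Sum>w | p w \<noteq> 0. sc (p w) (bv w)) x" by simp
qed

lemma fins_iff_span: "fins p \<longleftrightarrow> p \<in> fv.span (range bv)"
proof
  assume f: "fins p"
  have "p = (\<Sum>w | p w \<noteq> 0. sc (p w) (bv w))" by (rule fins_expand[OF f])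
  also have "\<dots> \<in> fv.span (range bv)"
    by (intro fv.span_sum fv.span_scale fv.span_base) auto
  finally show "p \<in> fv.span (range bv)" .
next
  assume "p \<in> fv.span (range bv)"
  then have "p \<in> lspan (range bv)" by (simp add: lspan_eq_span)
  then show "fins p"
  proof induction
    case (lspan_add x y)
    then show ?case unfolding fins_def
      by (intro finite_subset[of "{w. (x + y) w \<noteq> 0}" "{w. x w \<noteq> 0} \<union> {w. y w \<noteq> 0}"])
        (auto simp: pointwise)
  next
    case (lspan_scale x c)
    then show ?case unfolding fins_def
      by (intro finite_subset[of "{w. sc c x w \<noteq> 0}" "{w. x w \<noteq> 0}"]) (auto simp: sc_def)
  qed (auto simp: fins_def bv_def pointwise)
qed

lemma fins_induct [consumes 1, case_names zero bv add scale]: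
  assumes "fins p" "P 0" "\<And>w. P (bv w)" "\<And>p q. fins p \<Longrightarrow> fins q \<Longrightarrow> P p \<Longrightarrow> P q \<Longrightarrow> P (p + q)"
    "\<And>c p. fins p \<Longrightarrow> P p \<Longrightarrow> P (sc c p)"
  shows "P p"
proof -
  have "p \<in> lspan (range bv)" using assms(1) by (simp add: fins_iff_span lspan_eq_span)
  then have "fins p \<and> P p"
    by induction (auto simp: assms fins_iff_span intro: fv.span_zero fv.span_base fv.span_add fv.span_scale)
  then show ?thesis ..
qed

lemma fins_zero [simp]: "fins 0"
  and fins_bv [simp]: "fins (bv w)"
  and fins_add [simp]: "fins p \<Longrightarrow> fins q \<Longrightarrow> fins (p + q)"
  and fins_diff [simp]: "fins p \<Longrightarrow> fins q \<Longrightarrow> fins (p - q)"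
  and fins_sc [simp]: "fins p \<Longrightarrow> fins (sc c p)"
  by (auto simp: fins_iff_span intro: fv.span_zero fv.span_base fv.span_add fv.span_scale fv.span_diff)

lemma fins_sum: "(\<And>i. i \<in> I \<Longrightarrow> fins (p i)) \<Longrightarrow> fins (sum p I)"
  by (auto simp: fins_iff_span intro: fv.span_sum)

lemma tmul_zero [simp]: "tmul 0 q = 0" "tmul p 0 = 0"
  and tmul_add: "tmul (p + p') q = tmul p q + tmul p' q" "tmul p (q + q') = tmul p q + tmul p q'"
  and tmul_sc: "tmul (sc c p) q = sc c (tmul p q)" "tmul p (sc c q) = sc c (tmul p q)"
  by (auto simp: tmul_def sc_def fun_eq_iff pointwise sum.distrib algebra_simps sum_distrib_left)

lemma tmul_diff: "tmul (p - p') q = tmul p q - tmul p' q" "tmul p (q - q') = tmul p q - tmul p q'"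
  by (auto simp: tmul_def fun_eq_iff pointwise sum_subtractf algebra_simps)

lemma tmul_sum: "tmul (sum p I) r = (\<Sum>i\<in>I. tmul (p i) r)" "tmul r (sum q I) = (\<Sum>i\<in>I. tmul r (q i))"
  for p q :: "'i \<Rightarrow> gen list \<Rightarrow> complex"
  by (induct I rule: infinite_finite_induct; simp add: tmul_add)+

lemma tmul_bv_bv [simp]: "tmul (bv u) (bv v) = bv (u @ v)"
proof
  fix w
  show "tmul (bv u) (bv v) w = bv (u @ v) w"
  proof (cases "w = u @ v")
    case True
    have "bv u (take k w) * bv v (drop k w) = (if k = length u then 1 else 0)" if "k \<in> {0..length w}" for k
    proof (cases "k = length u")
      case False
      then have "length (take k w) \<noteq> length u" using that by simp
      then have "take k w \<noteq> u" by blast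
      with False show ?thesis by (simp add: bv_def)
    qed (simp add: True bv_def)
    then have "tmul (bv u) (bv v) w = (\<Sum>k\<in>{0..length w}. if k = length u then 1 else 0)"
      unfolding tmul_def by (rule sum.cong[OF refl])
    also have "\<dots> = 1" using True by simp
    finally show ?thesis by (simp add: bv_def True)
  next
    case False
    have "bv u (take k w) * bv v (drop k w) = 0" for k
    proof (cases "take k w = u")
      case True
      then have "drop k w \<noteq> v" using False by (metis append_take_drop_id)
      then show ?thesis by (simp add: bv_def)
    qed (simp add: bv_def)
    then have "tmul (bv u) (bv v) w = 0" unfolding tmul_def by (intro sum.neutral ballI)
    with False show ?thesis by (simp add: bv_def)
  qed
qed

lemma fins_tmul [simp]: "fins p \<Longrightarrow> fins q \<Longrightarrow> fins (tmul p q)"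
proof (induct p rule: fins_induct)
  case (bv w)
  then show ?case by (induct q rule: fins_induct) (auto simp: tmul_add tmul_sc)
qed (auto simp: tmul_add tmul_sc)

lemma tmul_assoc: "fins p \<Longrightarrow> fins q \<Longrightarrow> fins r \<Longrightarrow> tmul (tmul p q) r = tmul p (tmul q r)"
proof (induct p rule: fins_induct)
  case (bv u)
  from bv(1) show ?case
  proof (induct q rule: fins_induct)
    case (bv v)
    from \<open>fins r\<close> show ?case by (induct r rule: fins_induct) (auto simp: tmul_add tmul_sc)
  qed (auto simp: tmul_add tmul_sc)
qed (auto simp: tmul_add tmul_sc)

lemma tmul_bv_Nil [simp]: "fins t \<Longrightarrow> tmul (bv []) t = t" "fins t \<Longrightarrow> tmul t (bv []) = t"
  by (induct t rule: fins_induct; simp add: tmul_add tmul_sc)+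

lemma iota_bv [simp]: "iota (bv g) = bv [g]"
  by (auto simp: iota_def bv_def fun_eq_iff split: list.splits)

lemma iota_zero [simp]: "iota 0 = 0"
  and iota_add: "iota (x + y) = iota x + iota y"
  and iota_sc: "iota (sc c x) = sc c (iota x)"
  by (auto simp: iota_def sc_def fun_eq_iff pointwise split: list.splits)

lemma iota_sum: "iota (sum f I) = (\<Sum>i\<in>I. iota (f i))" for f :: "'i \<Rightarrow> gen \<Rightarrow> complex"
  by (induct I rule: infinite_finite_induct) (simp_all add: iota_add)

lemma iota_expand: "fins x \<Longrightarrow> iota x = (\<Sum>g | x g \<noteq> 0. sc (x g) (bv [g]))"
  by (subst fins_expand) (simp_all add: iota_sum iota_sc)

lemma fins_iota [simp]: "fins x \<Longrightarrow> fins (iota x)"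
  by (induct x rule: fins_induct) (auto simp: iota_add iota_sc)

lemma lbr_bv [simp]: "lbr (bv a) (bv b) = bbr a b"
proof -
  have "{x. bv a x \<noteq> 0} = {a}" for a :: gen by (auto simp: bv_def)
  then show ?thesis by (auto simp: lbr_def bv_def fun_eq_iff)
qed

lemma bbr_EF: "bbr (Ee i) (Ff j) = bv (Hh (i + j))"
  by (auto simp: bv_def fun_eq_iff)

definition comm :: "gen \<Rightarrow> gen \<Rightarrow> bool" where
  "comm a b \<longleftrightarrow> bbr a b = 0"

lemma comm_simps [simp]:
  "comm (Ee i) (Ee j)" "comm (Ff i) (Ff j)" "comm (Hh i) g" "comm g (Hh i)"
  by (cases g; auto simp: comm_def fun_eq_iff pointwise)+

lemma urel_fins: "r \<in> urel \<Longrightarrow> fins r"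
proof -
  have fl: "fins (lbr x y)" if "fins x" "fins y" for x y
  proof -
    have "{g. lbr x y g \<noteq> 0} \<subseteq> (\<Union>a\<in>{a. x a \<noteq> 0}. \<Union>b\<in>{b. y b \<noteq> 0}. {Hh (gidx a + gidx b)})"
    proof
      fix g assume "g \<in> {g. lbr x y g \<noteq> 0}"
      then have "lbr x y g \<noteq> 0" by simp
      then obtain a where a: "a \<in> {a. x a \<noteq> 0}" "(\<Sum>b\<in>{b. y b \<noteq> 0}. x a * y b * bbr a b g) \<noteq> 0"
        unfolding lbr_def by (meson sum.neutral)
      then obtain b where b: "b \<in> {b. y b \<noteq> 0}" "x a * y b * bbr a b g \<noteq> 0"
        by (meson sum.neutral)
      then have "bbr a b g \<noteq> 0" by simp
      then have "g = Hh (gidx a + gidx b)" by (cases a; cases b) (auto split: if_splits)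
      then show "g \<in> (\<Union>a\<in>{a. x a \<noteq> 0}. \<Union>b\<in>{b. y b \<noteq> 0}. {Hh (gidx a + gidx b)})"
        using a b by blast
    qed
    moreover have "finite (\<Union>a\<in>{a. x a \<noteq> 0}. \<Union>b\<in>{b. y b \<noteq> 0}. {Hh (gidx a + gidx b)})"
      using that by (auto simp: fins_def)
    ultimately show ?thesis unfolding fins_def by (rule finite_subset)
  qed
  show "r \<in> urel \<Longrightarrow> fins r" by (auto simp: urel_def fl)
qed

lemma subspace_LM: "fv.subspace LM"
  and subspace_JW: "fv.subspace JW"
  and subspace_Jbar: "fv.subspace (Jbar M N)"
  by (auto simp: LM_def JW_def Jbar_def lspan_eq_span)

lemma subspace_JMN: "fv.subspace (JMN M N)"
  by (simp add: JMN_def subspace_Jbar lspan_eq_span)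

lemma tmul_bv_span:
  assumes "x \<in> fv.span A" "fv.subspace J" "\<And>a. a \<in> A \<Longrightarrow> tmul p a \<in> J"
  shows "tmul p x \<in> J"
proof -
  have "x \<in> lspan A" using assms(1) by (simp add: lspan_eq_span)
  then show ?thesis
    by induction (use assms in \<open>auto simp: tmul_add tmul_sc intro: fv.subspace_0 fv.subspace_add fv.subspace_scale\<close>)
qed

lemma LM_urel: "fins a \<Longrightarrow> r \<in> urel \<Longrightarrow> fins b \<Longrightarrow> tmul (tmul a r) b \<in> LM"
  and LM_Hminus: "fins a \<Longrightarrow> x \<in> Hminus \<Longrightarrow> tmul a (iota x) \<in> LM"
  unfolding LM_def by (rule lspan_base, blast)+

text \<open>Both families generating \<open>LM\<close> carry an arbitrary left factor, which absorbs
  \<open>p\<close>. In the second family \<open>H^-\<close> stands at the right end, so only a left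
  ideal results.\<close>

lemma LM_left_ideal:
  assumes "t \<in> LM" "fins p" shows "tmul p t \<in> LM"
proof (rule tmul_bv_span[OF assms(1)[unfolded LM_def lspan_eq_span] subspace_LM], goal_cases)
  case (1 x)
  then show ?case
  proof
    assume "x \<in> {tmul (tmul a r) b |a r b. fins a \<and> r \<in> urel \<and> fins b}"
    then obtain a r b where x: "x = tmul (tmul a r) b" "fins a" "r \<in> urel" "fins b" by auto
    then have "tmul p x = tmul (tmul (tmul p a) r) b"
      using assms by (simp add: tmul_assoc urel_fins)
    then show ?thesis using x assms by (simp add: LM_urel LM_Hminus)
  next
    assume "x \<in> {tmul a (iota x) |a x. fins a \<and> x \<in> Hminus}"
    then obtain a y where x: "x = tmul a (iota y)" "fins a" "y \<in> Hminus" by auto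
    then have "tmul p x = tmul (tmul p a) (iota y)"
      using assms by (simp add: tmul_assoc Hminus_def)
    then show ?thesis using x assms by (simp add: LM_urel LM_Hminus)
  qed
qed

lemma swap_LM:
  assumes "fins t"
  shows "tmul (bv [x, y]) t - tmul (bv [y, x]) t - tmul (iota (bbr x y)) t \<in> LM"
proof -
  have "tmul (iota (bv x)) (iota (bv y)) - tmul (iota (bv y)) (iota (bv x)) - iota (lbr (bv x) (bv y)) \<in> urel"
    unfolding urel_def by (rule CollectI, rule exI[of _ "bv x"], rule exI[of _ "bv y"]) simp
  then have r: "bv [x, y] - bv [y, x] - iota (bbr x y) \<in> urel" (is "?r \<in> _") by simp
  then have "tmul (tmul (bv []) ?r) t \<in> LM"
    using assms by (intro LM_urel) auto
  moreover have "tmul (bv []) ?r = ?r" using urel_fins[OF r] by (rule tmul_bv_Nil)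
  ultimately show ?thesis by (simp add: tmul_diff)
qed

lemma swap_comm_LM: "fins t \<Longrightarrow> comm x y \<Longrightarrow> tmul (bv [x, y]) t - tmul (bv [y, x]) t \<in> LM"
  using swap_LM[of t x y] by (simp add: comm_def)

lemma swap_EF_LM:
  "fins t \<Longrightarrow> tmul (bv [Ee i, Ff j]) t - tmul (bv [Ff j, Ee i]) t - tmul (bv [Hh (i + j)]) t \<in> LM"
  using swap_LM[of t "Ee i" "Ff j"] by (simp add: bbr_EF)

lemma nonpos_LM: "gidx g \<le> 0 \<Longrightarrow> bv [g] \<in> LM"
proof -
  assume "gidx g \<le> 0"
  then have "bv g \<in> Hminus" by (simp add: Hminus_def) (simp add: bv_def)
  then have "tmul (bv []) (iota (bv g)) \<in> LM"
    by (intro LM_Hminus) auto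
  then show ?thesis by simp
qed

lemma bv2_tmul: "fins t \<Longrightarrow> tmul (bv [x, y]) t = tmul (bv [x]) (tmul (bv [y]) t)"
  by (simp flip: tmul_assoc)

section \<open>The quadratic relations generate a left ideal\<close>

lemma bbr_cases:
  obtains "bbr x y = 0" | "bbr x y = bv (Hh (gidx x + gidx y))"
  | "bbr x y = sc (-1) (bv (Hh (gidx x + gidx y)))"
  by (cases x; cases y; fastforce simp: fun_eq_iff bv_def sc_def pointwise add.commute)

text \<open>A letter of low index is moved through the word towards the vacuum. Each exchange leaves
  a letter of index \<open>gidx g + gidx x\<close> in front of the shorter word, so the threshold
  has to be lowered by \<open>gidx x\<close> as well.\<close>

lemma eventually_annihilates_bv:
  "\<exists>k. \<forall>g. gidx g \<le> k \<longrightarrow> bv (g # w) \<in> LM"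
proof (induct w)
  case Nil
  then show ?case using nonpos_LM by blast
next
  case (Cons x w)
  then obtain k where k: "\<And>g. gidx g \<le> k \<Longrightarrow> bv (g # w) \<in> LM" by blast
  have "bv (g # x # w) \<in> LM" if g: "gidx g \<le> min k (k - gidx x)" for g
  proof -
    have sw: "bv (g # x # w) - bv (x # g # w) - tmul (iota (bbr g x)) (bv w) \<in> LM"
      using swap_LM[of "bv w" g x] by simp
    have "tmul (bv [x]) (bv (g # w)) \<in> LM"
      using g by (intro LM_left_ideal k) auto
    moreover have "bv (Hh (gidx g + gidx x) # w) \<in> LM"
      using g by (intro k) auto
    then have "tmul (iota (bbr g x)) (bv w) \<in> LM"
      by (cases g x rule: bbr_cases)
        (auto simp: iota_sc tmul_sc fv.subspace_0[OF subspace_LM] simp del: fv.scale_minus_left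
          intro: fv.subspace_scale[OF subspace_LM])
    ultimately have "(bv (g # x # w) - bv (x # g # w) - tmul (iota (bbr g x)) (bv w)) + bv (x # g # w)
       + tmul (iota (bbr g x)) (bv w) \<in> LM"
      using sw by (intro fv.subspace_add[OF subspace_LM]) auto
    then show ?thesis by simp
  qed
  then show ?case by blast
qed

lemma eventually_annihilates:
  assumes "fins t" shows "\<exists>k. \<forall>g. gidx g \<le> k \<longrightarrow> tmul (bv [g]) t \<in> LM"
  using assms
proof (induct t rule: fins_induct)
  case (bv w)
  then show ?case using eventually_annihilates_bv[of w] by simp
next
  case (add p q)
  then obtain k l where "\<forall>g. gidx g \<le> k \<longrightarrow> tmul (bv [g]) p \<in> LM"
    "\<forall>g. gidx g \<le> l \<longrightarrow> tmul (bv [g]) q \<in> LM" by blast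
  then have "\<forall>g. gidx g \<le> min k l \<longrightarrow> tmul (bv [g]) (p + q) \<in> LM"
    by (simp add: tmul_add fv.subspace_add[OF subspace_LM])
  then show ?case by blast
qed (auto simp: tmul_sc fv.subspace_0[OF subspace_LM] intro: fv.subspace_scale[OF subspace_LM])

lemma LM_JW: "LM \<subseteq> JW"
  unfolding JW_def using lspan_base by blast

lemma mod_LM:
  assumes "a - b \<in> LM" "b \<in> J" "LM \<subseteq> J" "fv.subspace J" shows "a \<in> J"
proof -
  have "(a - b) + b \<in> J" using assms by (intro fv.subspace_add) auto
  then show ?thesis by simp
qed

definition comm_fields :: "(int \<Rightarrow> gen) \<Rightarrow> (int \<Rightarrow> gen) \<Rightarrow> bool" where
  "comm_fields X Y \<longleftrightarrow> (\<forall>i j. comm (X i) (Y j)) \<and> (\<forall>i. gidx (X i) = i) \<and> (\<forall>i. gidx (Y i) = i)"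

text \<open>For large \<open>i\<close> the right factor has very low index and annihilates
  \<open>t\<close>; for very negative \<open>i\<close> the left factor does, once the two commuting
  letters are exchanged.\<close>

lemma product_eventually_LM:
  assumes "comm_fields X Y" "fins t"
  shows "\<exists>k. \<forall>i. k < \<bar>i\<bar> \<longrightarrow> tmul (bv [X i, Y (n - i)]) t \<in> LM"
proof -
  obtain k where k: "\<And>g. gidx g \<le> k \<Longrightarrow> tmul (bv [g]) t \<in> LM"
    using eventually_annihilates[OF assms(2)] by blast
  have "tmul (bv [X i, Y (n - i)]) t \<in> LM" if i: "\<bar>k\<bar> + \<bar>n\<bar> < \<bar>i\<bar>" for i
  proof (cases "i > 0")
    case True
    then have "tmul (bv [Y (n - i)]) t \<in> LM"
      using i assms by (intro k) (auto simp: comm_fields_def)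
    then show ?thesis by (simp add: bv2_tmul assms LM_left_ideal)
  next
    case False
    then have "tmul (bv [X i]) t \<in> LM"
      using i assms by (intro k) (auto simp: comm_fields_def)
    then have "tmul (bv [Y (n - i), X i]) t \<in> LM" by (simp add: bv2_tmul assms LM_left_ideal)
    moreover have "tmul (bv [X i, Y (n - i)]) t - tmul (bv [Y (n - i), X i]) t \<in> LM"
      using assms by (intro swap_comm_LM) (auto simp: comm_fields_def)
    ultimately show ?thesis using mod_LM subspace_LM by blast
  qed
  then show ?thesis by blast
qed

lemma rpairs_comm: "(X, Y) \<in> rpairs \<Longrightarrow> comm_fields X Y"
  by (auto simp: rpairs_def comm_fields_def)

lemma rpairs_sum_JW:
  assumes "(X, Y) \<in> rpairs" "fins t"
  shows "\<exists>k. \<forall>I. finite I \<and> {-k..k} \<subseteq> I \<longrightarrow> (\<Sum>i\<in>I. tmul (bv [X i, Y (n - i)]) t) \<in> JW"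
proof -
  obtain k where k: "\<And>i. k < \<bar>i\<bar> \<Longrightarrow> tmul (bv [X i, Y (n - i)]) t \<in> LM"
    using product_eventually_LM[OF rpairs_comm[OF assms(1)] assms(2)] by blast
  define c where "c = psum X Y n t (nat k)"
  have diff: "(\<Sum>i\<in>I. tmul (bv [X i, Y (n - i)]) t) - c \<in> LM" if "finite I" "{- \<bar>k\<bar>..\<bar>k\<bar>} \<subseteq> I" for I
  proof -
    have sub: "{-int (nat k)..int (nat k)} \<subseteq> I" using that(2) by auto
    have "(\<Sum>i\<in>I. tmul (bv [X i, Y (n - i)]) t) - c
      = (\<Sum>i\<in>I - {-int (nat k)..int (nat k)}. tmul (bv [X i, Y (n - i)]) t)"
      unfolding c_def psum_def using sum_diff[OF that(1) sub, of "\<lambda>i. tmul (bv [X i, Y (n - i)]) t"] by simp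
    also have "\<dots> \<in> LM"
      by (intro fv.subspace_sum[OF subspace_LM] k) (auto split: if_splits)
    finally show ?thesis .
  qed
  have "\<forall>K\<ge>nat \<bar>k\<bar>. psum X Y n t K - c \<in> LM"
    unfolding psum_def by (intro allI impI diff) auto
  moreover have "fins c" unfolding c_def psum_def using assms by (intro fins_sum) auto
  ultimately have "c \<in> Rco" unfolding Rco_def using assms
    by (intro CollectI conjI bexI[of _ "(X, Y)"]) auto
  then have "c \<in> JW" unfolding JW_def by (auto intro: lspan_base)
  then have "\<forall>I. finite I \<and> {- \<bar>k\<bar>..\<bar>k\<bar>} \<subseteq> I \<longrightarrow> (\<Sum>i\<in>I. tmul (bv [X i, Y (n - i)]) t) \<in> JW"
    using mod_LM[OF diff _ LM_JW subspace_JW] by simp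
  then show ?thesis by blast
qed

text \<open>Bracketing a relation with a letter shifts the index of one field and may produce a pair
  in reversed order, such as \<open>(Hh, Ee)\<close>. Shifting or reflecting the sum displaces the
  window by \<open>s\<close> or \<open>n\<close>, which a larger \<open>K\<close>
  compensates.\<close>

lemma rpairs_shift_sum_JW:
  assumes "(X, Y) \<in> rpairs \<or> (Y, X) \<in> rpairs" "fins t"
  shows "\<exists>k. \<forall>K\<ge>k. (\<Sum>i\<in>{-K..K}. tmul (bv [X (s + i), Y (n - i)]) t) \<in> JW"
  using assms(1)
proof
  assume r: "(X, Y) \<in> rpairs"
  from rpairs_sum_JW[OF r assms(2), of "n + s"]
  obtain k where k: "\<And>I. finite I \<Longrightarrow> {-k..k} \<subseteq> I \<Longrightarrow> (\<Sum>i\<in>I. tmul (bv [X i, Y (n + s - i)]) t) \<in> JW"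
    by blast
  have "(\<Sum>i\<in>{-K..K}. tmul (bv [X (s + i), Y (n - i)]) t) \<in> JW" if "K \<ge> k + \<bar>s\<bar>" for K
  proof -
    have "(\<Sum>i\<in>{-K..K}. tmul (bv [X (s + i), Y (n - i)]) t)
        = (\<Sum>i\<in>{s-K..s+K}. tmul (bv [X i, Y (n + s - i)]) t)"
      by (rule sum.reindex_bij_witness[of _ "\<lambda>i. i - s" "\<lambda>i. s + i"]) auto
    also have "\<dots> \<in> JW" using that by (intro k) auto
    finally show ?thesis .
  qed
  then show ?thesis by blast
next
  assume r: "(Y, X) \<in> rpairs"
  from rpairs_sum_JW[OF r assms(2), of "n + s"]
  obtain k where k: "\<And>I. finite I \<Longrightarrow> {-k..k} \<subseteq> I \<Longrightarrow> (\<Sum>i\<in>I. tmul (bv [Y i, X (n + s - i)]) t) \<in> JW"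
    by blast
  have "(\<Sum>i\<in>{-K..K}. tmul (bv [X (s + i), Y (n - i)]) t) \<in> JW" if "K \<ge> k + \<bar>n\<bar>" for K
  proof -
    let ?a = "\<lambda>i. tmul (bv [X (s + i), Y (n - i)]) t" and ?b = "\<lambda>i. tmul (bv [Y (n - i), X (s + i)]) t"
    have "?a i - ?b i \<in> LM" for i
      by (intro swap_comm_LM assms(2)) (use r in \<open>auto simp: rpairs_def\<close>)
    then have "(\<Sum>i\<in>{-K..K}. ?a i - ?b i) \<in> LM" by (intro fv.subspace_sum[OF subspace_LM])
    then have d: "sum ?a {-K..K} - sum ?b {-K..K} \<in> LM" by (simp only: sum_subtractf)
    have "sum ?b {-K..K} = (\<Sum>i\<in>{n-K..n+K}. tmul (bv [Y i, X (n + s - i)]) t)"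
      by (rule sum.reindex_bij_witness[of _ "\<lambda>i. n - i" "\<lambda>i. n - i"]) (simp_all add: algebra_simps)
    also have "\<dots> \<in> JW" using that by (intro k) auto
    finally show ?thesis by (rule mod_LM[OF d _ LM_JW subspace_JW])
  qed
  then show ?thesis by blast
qed

text \<open>Bracketing with a letter annihilates the field \<open>X\<close> or turns it, up to sign,
  into a shifted field \<open>Hh\<close>. The list of quadratic relations is closed under replacing
  a factor \<open>Ee\<close> or \<open>Ff\<close> by \<open>Hh\<close>, up to the order of the
  factors.\<close>

lemma bracket_left_sum_JW:
  assumes "(X, Y) \<in> rpairs" "fins t"
  shows "\<exists>k. \<forall>K\<ge>k. (\<Sum>i\<in>{-K..K}. tmul (iota (bbr g (X i))) (tmul (bv [Y (n - i)]) t)) \<in> JW"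
proof (cases "\<forall>i. bbr g (X i) = 0")
  case True
  then show ?thesis by (simp add: fv.subspace_0[OF subspace_JW])
next
  case False
  then obtain c where "(X = Ee \<and> g = Ff (gidx g) \<or> X = Ff \<and> g = Ee (gidx g))"
    and c: "\<And>i. bbr g (X i) = sc c (bv (Hh (gidx g + i)))"
  proof (cases g)
    case (Ee s)
    with False assms(1) have "X = Ff" by (auto simp: rpairs_def fun_eq_iff pointwise)
    with Ee show ?thesis by (intro that[of 1]) (auto simp: bbr_EF)
  next
    case (Ff s)
    with False assms(1) have "X = Ee" by (auto simp: rpairs_def fun_eq_iff pointwise)
    with Ff show ?thesis by (intro that[of "-1"]) (auto simp: fun_eq_iff sc_def bv_def add.commute)
  next
    case (Hh s)
    with False assms(1) have False by (auto simp: rpairs_def fun_eq_iff pointwise)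
    then show ?thesis ..
  qed
  then have "(Hh, Y) \<in> rpairs \<or> (Y, Hh) \<in> rpairs"
    using assms(1) by (auto simp: rpairs_def)
  from rpairs_shift_sum_JW[OF this assms(2), of "gidx g" n]
  obtain k where k: "\<And>K. K \<ge> k \<Longrightarrow> (\<Sum>i\<in>{-K..K}. tmul (bv [Hh (gidx g + i), Y (n - i)]) t) \<in> JW" by blast
  have "(\<Sum>i\<in>{-K..K}. tmul (iota (bbr g (X i))) (tmul (bv [Y (n - i)]) t)) \<in> JW" if "K \<ge> k" for K
  proof -
    have "(\<Sum>i\<in>{-K..K}. tmul (iota (bbr g (X i))) (tmul (bv [Y (n - i)]) t))
      = sc c (\<Sum>i\<in>{-K..K}. tmul (bv [Hh (gidx g + i), Y (n - i)]) t)"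
      using assms(2) by (simp add: c iota_sc tmul_sc bv2_tmul fv.scale_sum_right)
    then show ?thesis using k[OF that] fv.subspace_scale[OF subspace_JW] by simp
  qed
  then show ?thesis by blast
qed

lemma bracket_right_sum_JW:
  assumes "(X, Y) \<in> rpairs" "fins t"
  shows "\<exists>k. \<forall>K\<ge>k. (\<Sum>i\<in>{-K..K}. tmul (bv [X i]) (tmul (iota (bbr g (Y (n - i)))) t)) \<in> JW"
proof (cases "\<forall>i. bbr g (Y i) = 0")
  case True
  then show ?thesis by (simp add: fv.subspace_0[OF subspace_JW])
next
  case False
  then obtain c where "(Y = Ee \<and> g = Ff (gidx g) \<or> Y = Ff \<and> g = Ee (gidx g))"
    and c: "\<And>i. bbr g (Y i) = sc c (bv (Hh (gidx g + i)))"
  proof (cases g)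
    case (Ee s)
    with False assms(1) have "Y = Ff" by (auto simp: rpairs_def fun_eq_iff pointwise)
    with Ee show ?thesis by (intro that[of 1]) (auto simp: bbr_EF)
  next
    case (Ff s)
    with False assms(1) have "Y = Ee" by (auto simp: rpairs_def fun_eq_iff pointwise)
    with Ff show ?thesis by (intro that[of "-1"]) (auto simp: fun_eq_iff sc_def bv_def add.commute)
  next
    case (Hh s)
    with False assms(1) have False by (auto simp: rpairs_def fun_eq_iff pointwise)
    then show ?thesis ..
  qed
  then have "(X, Hh) \<in> rpairs \<or> (Hh, X) \<in> rpairs"
    using assms(1) by (auto simp: rpairs_def)
  from rpairs_shift_sum_JW[OF this assms(2), of 0 "gidx g + n"]
  obtain k where k: "\<And>K. K \<ge> k \<Longrightarrow> (\<Sum>i\<in>{-K..K}. tmul (bv [X i, Hh (gidx g + n - i)]) t) \<in> JW" by auto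
  have "(\<Sum>i\<in>{-K..K}. tmul (bv [X i]) (tmul (iota (bbr g (Y (n - i)))) t)) \<in> JW" if "K \<ge> k" for K
  proof -
    have "(\<Sum>i\<in>{-K..K}. tmul (bv [X i]) (tmul (iota (bbr g (Y (n - i)))) t))
      = sc c (\<Sum>i\<in>{-K..K}. tmul (bv [X i, Hh (gidx g + n - i)]) t)"
      using assms(2) by (simp add: c iota_sc tmul_sc bv2_tmul fv.scale_sum_right add_diff_eq)
    then show ?thesis using k[OF that] fv.subspace_scale[OF subspace_JW] by simp
  qed
  then show ?thesis by blast
qed

lemma fins_bbr [simp]: "fins (bbr x y)"
  by (cases x y rule: bbr_cases) (simp_all only: fins_zero fins_bv fins_sc)

lemma commute_past_product_LM:
  assumes "fins t"
  shows "tmul (bv [g]) (tmul (bv [x, y]) t) - (tmul (bv [x, y]) (tmul (bv [g]) t)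
      + tmul (iota (bbr g x)) (tmul (bv [y]) t) + tmul (bv [x]) (tmul (iota (bbr g y)) t)) \<in> LM"
proof -
  have "tmul (bv [g, x]) (tmul (bv [y]) t) - tmul (bv [x, g]) (tmul (bv [y]) t)
      - tmul (iota (bbr g x)) (tmul (bv [y]) t) \<in> LM" (is "?a \<in> _")
    using assms by (intro swap_LM) auto
  moreover have "tmul (bv [x]) (tmul (bv [g, y]) t - tmul (bv [y, g]) t - tmul (iota (bbr g y)) t) \<in> LM"
    (is "?b \<in> _")
    using assms by (intro LM_left_ideal swap_LM) auto
  ultimately have "?a + ?b \<in> LM" by (rule fv.subspace_add[OF subspace_LM])
  then show ?thesis using assms
    by (simp add: tmul_diff tmul_add bv2_tmul algebra_simps)
qed

text \<open>By the Leibniz rule, \<open>g\<close> applied to a relation is the same relation applied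
  to \<open>g t\<close> plus two bracket sums, which are again relations. Each sum lies in
  \<open>JW\<close> only for large windows, hence the common \<open>K\<close>.\<close>

lemma Rco_left_JW:
  assumes "c \<in> Rco" shows "tmul (bv [g]) c \<in> JW"
proof -
  from assms obtain X Y n t K0 where XY: "(X, Y) \<in> rpairs" and t: "fins t"
    and K0: "\<And>K. K \<ge> K0 \<Longrightarrow> psum X Y n t K - c \<in> LM"
    unfolding Rco_def by blast
  have tg: "fins (tmul (bv [g]) t)" using t by simp
  from rpairs_shift_sum_JW[OF disjI1[OF XY] tg, of 0 n]
  obtain k1 where k1: "\<And>K. K \<ge> k1 \<Longrightarrow> (\<Sum>i\<in>{-K..K}. tmul (bv [X i, Y (n - i)]) (tmul (bv [g]) t)) \<in> JW"
    by auto
  obtain k2 where k2: "\<And>K. K \<ge> k2 \<Longrightarrow>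
      (\<Sum>i\<in>{-K..K}. tmul (iota (bbr g (X i))) (tmul (bv [Y (n - i)]) t)) \<in> JW"
    using bracket_left_sum_JW[OF XY t] by blast
  obtain k3 where k3: "\<And>K. K \<ge> k3 \<Longrightarrow>
      (\<Sum>i\<in>{-K..K}. tmul (bv [X i]) (tmul (iota (bbr g (Y (n - i)))) t)) \<in> JW"
    using bracket_right_sum_JW[OF XY t] by blast
  define K where "K = max K0 (nat (max k1 (max k2 k3)))"
  define A where "A = (\<lambda>i. tmul (bv [X i, Y (n - i)]) (tmul (bv [g]) t))"
  define B where "B = (\<lambda>i. tmul (iota (bbr g (X i))) (tmul (bv [Y (n - i)]) t))"
  define C where "C = (\<lambda>i. tmul (bv [X i]) (tmul (iota (bbr g (Y (n - i)))) t))"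
  let ?I = "{- int K..int K}"
  have le: "k1 \<le> int K" "k2 \<le> int K" "k3 \<le> int K" unfolding K_def by linarith+
  have abc: "sum A ?I + sum B ?I + sum C ?I \<in> JW"
    unfolding A_def B_def C_def
    by (intro fv.subspace_add[OF subspace_JW] k1 k2 k3 le)
  have "(\<Sum>i\<in>?I. tmul (bv [g]) (tmul (bv [X i, Y (n - i)]) t) - (A i + B i + C i)) \<in> LM"
    unfolding A_def B_def C_def
    by (intro fv.subspace_sum[OF subspace_LM] commute_past_product_LM t)
  then have "tmul (bv [g]) (psum X Y n t K) - (sum A ?I + sum B ?I + sum C ?I) \<in> LM"
    by (simp add: psum_def tmul_sum sum_subtractf sum.distrib)
  then have "tmul (bv [g]) (psum X Y n t K) \<in> JW"
    using abc mod_LM[OF _ _ LM_JW subspace_JW] by blast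
  moreover have "tmul (bv [g]) (psum X Y n t K - c) \<in> JW"
    using LM_left_ideal[OF K0[of K]] LM_JW by (auto simp: K_def)
  ultimately have "tmul (bv [g]) (psum X Y n t K) - tmul (bv [g]) (psum X Y n t K - c) \<in> JW"
    by (rule fv.subspace_diff[OF subspace_JW])
  then show ?thesis by (simp add: tmul_diff)
qed

lemma JW_left_ideal:
  assumes "x \<in> JW" shows "tmul (bv [g]) x \<in> JW"
proof (rule tmul_bv_span[OF assms[unfolded JW_def lspan_eq_span] subspace_JW])
  fix a assume "a \<in> LM \<union> Rco"
  then show "tmul (bv [g]) a \<in> JW"
    using Rco_left_JW LM_left_ideal[of a "bv [g]"] LM_JW by auto
qed

section \<open>Upper bound for the dimension\<close>

fun gen_in :: "int \<Rightarrow> int \<Rightarrow> gen \<Rightarrow> bool" where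
  "gen_in M N (Ee i) \<longleftrightarrow> M \<le> i"
| "gen_in M N (Ff j) \<longleftrightarrow> N \<le> j"
| "gen_in M N (Hh k) \<longleftrightarrow> M + N \<le> k"

text \<open>The span of the letters allowed by \<open>gen_in\<close> is closed under brackets: the
  only nonzero ones add the index of an \<open>Ee\<close>, at least \<open>M\<close>, to that of an
  \<open>Ff\<close>, at least \<open>N\<close>, and give an \<open>Hh\<close>.\<close>

lemma gsub_support: "x \<in> gsub M N \<Longrightarrow> x \<in> fv.span (bv ` Collect (gen_in M N))"
proof (induct rule: gsub.induct)
  case (gsub_br x y)
  let ?S = "bv ` Collect (gen_in M N)"
  have supp: "gen_in M N g" if "z \<in> fv.span ?S" "z g \<noteq> 0" for z g
  proof -
    have "z \<in> lspan ?S" using that by (simp add: lspan_eq_span)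
    then have "\<forall>g. z g \<noteq> 0 \<longrightarrow> gen_in M N g"
      by induction (auto simp: pointwise bv_def sc_def split: if_splits, (metis add_0_right)+)
    then show ?thesis using that(2) by blast
  qed
  have fin: "fins z" if "z \<in> fv.span ?S" for z
    using that fv.span_mono[of ?S "range bv"] by (auto simp: fins_iff_span)
  have eq: "lbr x y = (\<Sum>a\<in>{a. x a \<noteq> 0}. \<Sum>b\<in>{b. y b \<noteq> 0}. sc (x a * y b) (bbr a b))"
    by (simp add: fun_eq_iff lbr_def sum_fun_apply sc_def)
  have "bbr a b \<in> fv.span ?S" if "x a \<noteq> 0" "y b \<noteq> 0" for a b
  proof -
    have ab: "gen_in M N a" "gen_in M N b" using supp gsub_br that by blast+
    then have "bbr a b \<noteq> 0 \<Longrightarrow> gen_in M N (Hh (gidx a + gidx b))"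
      by (cases a; cases b) (auto simp: fun_eq_iff pointwise)
    then have "bbr a b \<noteq> 0 \<Longrightarrow> bv (Hh (gidx a + gidx b)) \<in> fv.span ?S"
      by (intro fv.span_base imageI) simp
    then show ?thesis
      by (cases a b rule: bbr_cases) (metis fv.span_zero fv.span_scale)+
  qed
  then show ?case unfolding eq by (intro fv.span_sum fv.span_scale) auto
qed (auto intro: fv.span_base fv.span_zero fv.span_add fv.span_scale)

lemma gsub_gen: "gen_in M N g \<Longrightarrow> bv g \<in> gsub M N"
proof (cases g)
  case (Hh k)
  assume "gen_in M N g"
  then have "lbr (bv (Ee M)) (bv (Ff (k - M))) \<in> gsub M N"
    using Hh by (intro gsub_br gsub_e gsub_f) auto
  then show ?thesis by (simp add: Hh bbr_EF)
qed (auto intro: gsub_e gsub_f)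

lemma JW_Jbar: "JW \<subseteq> Jbar M N"
  unfolding Jbar_def using lspan_base by blast

lemma Jbar_gen: "gen_in M N g \<Longrightarrow> fins t \<Longrightarrow> tmul (bv [g]) t \<in> Jbar M N"
  unfolding Jbar_def
  by (intro lspan_base UnI2 CollectI exI[of _ "bv g"] exI[of _ t]) (simp add: gsub_gen)

lemma Jbar_least:
  assumes "fv.subspace Z" "JW \<subseteq> Z" "\<And>g t. gen_in M N g \<Longrightarrow> fins t \<Longrightarrow> tmul (bv [g]) t \<in> Z"
  shows "Jbar M N \<subseteq> Z"
  unfolding Jbar_def lspan_eq_span
proof (rule fv.span_minimal[OF _ assms(1)], intro Un_least assms(2) subsetI)
  fix y assume "y \<in> {tmul (iota x) t |x t. x \<in> gsub M N \<and> fins t}"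
  then obtain x t where y: "y = tmul (iota x) t" "x \<in> gsub M N" "fins t" by blast
  have "x \<in> lspan (bv ` Collect (gen_in M N))" using gsub_support[OF y(2)] by (simp add: lspan_eq_span)
  then have "tmul (iota x) t \<in> Z"
    by induction
      (use assms y(3) in \<open>auto simp: iota_add iota_sc tmul_add tmul_sc
        intro: fv.subspace_0 fv.subspace_add fv.subspace_scale\<close>)
  then show "y \<in> Z" using y by simp
qed

lemma Jbar_JMN: "Jbar M N \<subseteq> JMN M N"
  by (auto simp: JMN_def intro: lspan_base)

text \<open>Only the letters \<open>f_{N-1}\<close> and \<open>h_{M+N-1}\<close> are new in
  \<open>g(M, N - 1)\<close>. The latter is \<open>[e_M, f_{N-1}]\<close>; of its two products one
  starts with \<open>e_M\<close> and lies in \<open>Jbar M N\<close>, the other starts with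
  \<open>f_{N-1}\<close>.\<close>

lemma Jbar_F_step:
  "Jbar M (N - 1) \<subseteq> fv.span ({tmul (bv [Ff (N - 1)]) t |t. fins t} \<union> Jbar M N)" (is "_ \<subseteq> fv.span (?F \<union> _)")
proof (rule Jbar_least)
  have J: "Jbar M N \<subseteq> fv.span (?F \<union> Jbar M N)" by (auto intro: fv.span_base)
  then show "JW \<subseteq> fv.span (?F \<union> Jbar M N)" using JW_Jbar by blast
  fix g and t :: "gen list \<Rightarrow> complex" assume g: "gen_in M (N - 1) g" and t: "fins t"
  have "gen_in M N g \<or> g = Ff (N - 1) \<or> g = Hh (M + N - 1)"
    using g by (cases g) auto
  then consider "gen_in M N g" | "g = Ff (N - 1)" | "g = Hh (M + N - 1)" by blast
  then show "tmul (bv [g]) t \<in> fv.span (?F \<union> Jbar M N)"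
  proof cases
    case 1
    then show ?thesis using Jbar_gen t J by blast
  next
    case 2
    then show ?thesis using t by (auto intro: fv.span_base)
  next
    case 3
    let ?e = "tmul (bv [Ee M]) (tmul (bv [Ff (N - 1)]) t)"
    let ?f = "tmul (bv [Ff (N - 1)]) (tmul (bv [Ee M]) t)"
    have eq: "M + (N - 1) = M + N - 1" by simp
    have "?e - ?f - tmul (bv [g]) t \<in> Jbar M N"
      using swap_EF_LM[OF t, of M "N - 1"] LM_JW JW_Jbar t 3 unfolding eq by (auto simp: bv2_tmul)
    moreover have "?e \<in> Jbar M N" using t by (intro Jbar_gen) auto
    moreover have "?f \<in> ?F" using t by auto
    ultimately have "?e - ?f - (?e - ?f - tmul (bv [g]) t) \<in> fv.span (?F \<union> Jbar M N)"
      by (intro fv.span_diff fv.span_base) auto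
    then show ?thesis by simp
  qed
qed simp

lemma Jbar_E_step:
  "Jbar (M - 1) N \<subseteq> fv.span ({tmul (bv [Ee (M - 1)]) t |t. fins t} \<union> Jbar M N)" (is "_ \<subseteq> fv.span (?F \<union> _)")
proof (rule Jbar_least)
  have J: "Jbar M N \<subseteq> fv.span (?F \<union> Jbar M N)" by (auto intro: fv.span_base)
  then show "JW \<subseteq> fv.span (?F \<union> Jbar M N)" using JW_Jbar by blast
  fix g and t :: "gen list \<Rightarrow> complex" assume g: "gen_in (M - 1) N g" and t: "fins t"
  have "gen_in M N g \<or> g = Ee (M - 1) \<or> g = Hh (M + N - 1)"
    using g by (cases g) auto
  then consider "gen_in M N g" | "g = Ee (M - 1)" | "g = Hh (M + N - 1)" by blast
  then show "tmul (bv [g]) t \<in> fv.span (?F \<union> Jbar M N)"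
  proof cases
    case 1
    then show ?thesis using Jbar_gen t J by blast
  next
    case 2
    then show ?thesis using t by (auto intro: fv.span_base)
  next
    case 3
    let ?f = "tmul (bv [Ff N]) (tmul (bv [Ee (M - 1)]) t)"
    let ?e = "tmul (bv [Ee (M - 1)]) (tmul (bv [Ff N]) t)"
    have eq: "M - 1 + N = M + N - 1" by simp
    have "?e - ?f - tmul (bv [g]) t \<in> Jbar M N"
      using swap_EF_LM[OF t, of "M - 1" N] LM_JW JW_Jbar t 3 unfolding eq by (auto simp: bv2_tmul)
    moreover have "?f \<in> Jbar M N" using t by (intro Jbar_gen) auto
    moreover have "?e \<in> ?F" using t by auto
    ultimately have "?e - ?f - (?e - ?f - tmul (bv [g]) t) \<in> fv.span (?F \<union> Jbar M N)"
      by (intro fv.span_diff fv.span_base) auto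
    then show ?thesis by simp
  qed
qed simp

text \<open>Modulo \<open>J\<close> a coefficient of a quadratic relation reduces to
  \<open>card A\<close> copies of \<open>u\<close>. Two copies occur when two different letters of
  one field appear in both orders; dividing by \<open>card A\<close> uses characteristic
  zero.\<close>

lemma relation_dominant_term:
  assumes r: "(X, Y) \<in> rpairs" and t: "fins t" and J: "fv.subspace J" "JW \<subseteq> J"
    and A: "finite A" "A \<noteq> {}" "\<And>i. i \<in> A \<Longrightarrow> tmul (bv [X i, Y (n - i)]) t - u \<in> J"
    and other: "\<And>i. i \<notin> A \<Longrightarrow> tmul (bv [X i, Y (n - i)]) t \<in> J"
  shows "u \<in> J"
proof -
  let ?p = "\<lambda>i. tmul (bv [X i, Y (n - i)]) t"
  obtain k where k: "\<And>I. finite I \<Longrightarrow> {-k..k} \<subseteq> I \<Longrightarrow> sum ?p I \<in> JW"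
    using rpairs_sum_JW[OF r t, of n] by blast
  let ?I = "{-k..k} \<union> A"
  have "sum ?p ?I \<in> J" using k[of ?I] A(1) J by auto
  moreover have "sum ?p (?I - A) \<in> J" using other by (intro fv.subspace_sum[OF J(1)]) auto
  moreover have "sum ?p ?I = sum ?p (?I - A) + sum ?p A"
    using A by (intro sum.subset_diff) auto
  ultimately have "sum ?p ?I - sum ?p (?I - A) \<in> J" by (intro fv.subspace_diff[OF J(1)])
  then have s: "sum ?p A \<in> J" using \<open>sum ?p ?I = _\<close> by simp
  have "(\<Sum>i\<in>A. ?p i - u) \<in> J" using A by (intro fv.subspace_sum[OF J(1)]) auto
  then have "sum ?p A - (\<Sum>i\<in>A. ?p i - u) \<in> J" using s by (intro fv.subspace_diff[OF J(1)])
  moreover have "(\<Sum>i\<in>A. u) = sc (of_nat (card A)) u"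
    by (simp add: fun_eq_iff sum_fun_apply sc_def)
  ultimately have "sc (of_nat (card A)) u \<in> J" by (simp add: sum_subtractf)
  then have "sc (inverse (of_nat (card A))) (sc (of_nat (card A)) u) \<in> J"
    by (rule fv.subspace_scale[OF J(1)])
  then show ?thesis using A by (simp add: fv.scale_scale)
qed

lemma Jbar_swap:
  assumes "comm x y" "gen_in M N y" "fins t" shows "tmul (bv [x, y]) t \<in> Jbar M N"
proof (rule mod_LM[OF swap_comm_LM[OF assms(3,1)]])
  show "tmul (bv [y, x]) t \<in> Jbar M N" using assms by (simp add: bv2_tmul Jbar_gen)
  show "LM \<subseteq> Jbar M N" using LM_JW JW_Jbar by blast
qed (rule subspace_Jbar)

text \<open>The shift by \<open>(1, -2)\<close> is what the relations permit. Commuting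
  \<open>f_{N-1}\<close> past \<open>e_i\<close> with \<open>i > M\<close> leaves an
  \<open>h\<close> of index at least \<open>M + N\<close>. In the coefficients of
  \<open>f(z)^2\<close> of degree \<open>2 N - 2\<close> and \<open>2 N - 3\<close>, and in that of
  \<open>f(z) h(z)\<close> of degree \<open>M + 2 N - 2\<close>, every term except the wanted
  product contains a letter of \<open>g(M, N)\<close>.\<close>

lemma F_mul_Jbar:
  assumes "x \<in> Jbar (M + 1) (N - 2)" shows "tmul (bv [Ff (N - 1)]) x \<in> Jbar M N"
proof -
  let ?F = "Ff (N - 1)"
  let ?Z = "{x. tmul (bv [?F]) x \<in> Jbar M N}"
  have g2: "tmul (bv [g, h]) t \<in> Jbar M N" if "gen_in M N g" "fins t" for g h t
    using that by (simp add: bv2_tmul Jbar_gen)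
  have "Jbar (M + 1) (N - 2) \<subseteq> ?Z"
  proof (rule Jbar_least)
    show "fv.subspace ?Z"
      using subspace_Jbar[of M N] by (auto simp: fv.subspace_def tmul_add tmul_sc)
    show "JW \<subseteq> ?Z" using JW_left_ideal JW_Jbar by blast
    fix g and t :: "gen list \<Rightarrow> complex" assume g: "gen_in (M + 1) (N - 2) g" and t: "fins t"
    have "tmul (bv [?F, g]) t \<in> Jbar M N"
    proof (cases g)
      case (Ee i)
      have "tmul (bv [Ee i, ?F]) t - tmul (bv [?F, Ee i]) t - tmul (bv [Hh (i + (N - 1))]) t \<in> Jbar M N"
        using swap_EF_LM[OF t] LM_JW JW_Jbar by blast
      moreover have "tmul (bv [Ee i, ?F]) t \<in> Jbar M N" using Ee g t by (intro g2) auto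
      moreover have "tmul (bv [Hh (i + (N - 1))]) t \<in> Jbar M N" using Ee g t by (intro Jbar_gen) auto
      ultimately have "tmul (bv [Ee i, ?F]) t - tmul (bv [Hh (i + (N - 1))]) t
        - (tmul (bv [Ee i, ?F]) t - tmul (bv [?F, Ee i]) t - tmul (bv [Hh (i + (N - 1))]) t) \<in> Jbar M N"
        by (metis fv.subspace_diff[OF subspace_Jbar])
      then show ?thesis using Ee by (simp add: algebra_simps)
    next
      case (Ff j)
      show ?thesis
      proof (cases "j \<ge> N")
        case True
        then show ?thesis using Ff t by (intro Jbar_swap) auto
      next
        case False
        then have j: "j = N - 1 \<or> j = N - 2" using g Ff by auto
        show ?thesis
        proof (rule relation_dominant_term[where X = Ff and Y = Ff and n = "N - 1 + j" and A = "{N - 1, j}" and t = t])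
          fix i assume "i \<in> {N - 1, j}"
          then show "tmul (bv [Ff i, Ff (N - 1 + j - i)]) t - tmul (bv [?F, g]) t \<in> Jbar M N"
          proof
            assume "i = N - 1"
            then show ?thesis using Ff by (simp add: fv.subspace_0[OF subspace_Jbar])
          next
            assume "i \<in> {j}"
            then show ?thesis using Ff swap_comm_LM[OF t, of "Ff j" ?F] LM_JW JW_Jbar by auto
          qed
        next
          fix i assume i: "i \<notin> {N - 1, j}"
          then have "N \<le> i \<or> N \<le> N - 1 + j - i" using j by auto
          then show "tmul (bv [Ff i, Ff (N - 1 + j - i)]) t \<in> Jbar M N"
          proof
            assume "N \<le> i"
            then show ?thesis using t by (intro g2) auto
          next
            assume "N \<le> N - 1 + j - i"
            then show ?thesis using t by (intro Jbar_swap) auto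
          qed
        qed (use t JW_Jbar subspace_Jbar in \<open>auto simp: rpairs_def\<close>)
      qed
    next
      case (Hh k)
      show ?thesis
      proof (cases "k \<ge> M + N")
        case True
        then show ?thesis using Hh t by (intro Jbar_swap) auto
      next
        case False
        then have k: "k = M + N - 1" using g Hh by auto
        show ?thesis
        proof (rule relation_dominant_term[where X = Ff and Y = Hh and n = "N - 1 + k" and A = "{N - 1}" and t = t])
          fix i assume "i \<in> {N - 1}"
          then show "tmul (bv [Ff i, Hh (N - 1 + k - i)]) t - tmul (bv [?F, g]) t \<in> Jbar M N"
            using Hh by (simp add: fv.subspace_0[OF subspace_Jbar])
        next
          fix i assume "i \<notin> {N - 1}"
          then have "N \<le> i \<or> M + N \<le> N - 1 + k - i" using k by auto
          then show "tmul (bv [Ff i, Hh (N - 1 + k - i)]) t \<in> Jbar M N"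
          proof
            assume "N \<le> i"
            then show ?thesis using t by (intro g2) auto
          next
            assume "M + N \<le> N - 1 + k - i"
            then show ?thesis using t by (intro Jbar_swap) auto
          qed
        qed (use t JW_Jbar subspace_Jbar in \<open>auto simp: rpairs_def\<close>)
      qed
    qed
    then show "tmul (bv [g]) t \<in> ?Z" using t by (simp add: bv2_tmul)
  qed
  then show ?thesis using assms by blast
qed

lemma E_mul_Jbar:
  assumes "x \<in> Jbar (M - 2) (N + 1)" shows "tmul (bv [Ee (M - 1)]) x \<in> Jbar M N"
proof -
  let ?E = "Ee (M - 1)"
  let ?Z = "{x. tmul (bv [?E]) x \<in> Jbar M N}"
  have g2: "tmul (bv [g, h]) t \<in> Jbar M N" if "gen_in M N g" "fins t" for g h t
    using that by (simp add: bv2_tmul Jbar_gen)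
  have "Jbar (M - 2) (N + 1) \<subseteq> ?Z"
  proof (rule Jbar_least)
    show "fv.subspace ?Z"
      using subspace_Jbar[of M N] by (auto simp: fv.subspace_def tmul_add tmul_sc)
    show "JW \<subseteq> ?Z" using JW_left_ideal JW_Jbar by blast
    fix g and t :: "gen list \<Rightarrow> complex" assume g: "gen_in (M - 2) (N + 1) g" and t: "fins t"
    have "tmul (bv [?E, g]) t \<in> Jbar M N"
    proof (cases g)
      case (Ff j)
      have "tmul (bv [?E, Ff j]) t - tmul (bv [Ff j, ?E]) t - tmul (bv [Hh (M - 1 + j)]) t \<in> Jbar M N"
        using swap_EF_LM[OF t] LM_JW JW_Jbar by blast
      moreover have "tmul (bv [Ff j, ?E]) t \<in> Jbar M N" using Ff g t by (intro g2) auto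
      moreover have "tmul (bv [Hh (M - 1 + j)]) t \<in> Jbar M N" using Ff g t by (intro Jbar_gen) auto
      ultimately have "tmul (bv [?E, Ff j]) t - tmul (bv [Ff j, ?E]) t - tmul (bv [Hh (M - 1 + j)]) t
        + tmul (bv [Ff j, ?E]) t + tmul (bv [Hh (M - 1 + j)]) t \<in> Jbar M N"
        by (intro fv.subspace_add[OF subspace_Jbar])
      then show ?thesis using Ff by (simp add: algebra_simps)
    next
      case (Ee j)
      show ?thesis
      proof (cases "j \<ge> M")
        case True
        then show ?thesis using Ee t by (intro Jbar_swap) auto
      next
        case False
        then have j: "j = M - 1 \<or> j = M - 2" using g Ee by auto
        show ?thesis
        proof (rule relation_dominant_term[where X = Ee and Y = Ee and n = "M - 1 + j" and A = "{M - 1, j}" and t = t])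
          fix i assume "i \<in> {M - 1, j}"
          then show "tmul (bv [Ee i, Ee (M - 1 + j - i)]) t - tmul (bv [?E, g]) t \<in> Jbar M N"
          proof
            assume "i = M - 1"
            then show ?thesis using Ee by (simp add: fv.subspace_0[OF subspace_Jbar])
          next
            assume "i \<in> {j}"
            then show ?thesis using Ee swap_comm_LM[OF t, of "Ee j" ?E] LM_JW JW_Jbar by auto
          qed
        next
          fix i assume i: "i \<notin> {M - 1, j}"
          then have "M \<le> i \<or> M \<le> M - 1 + j - i" using j by auto
          then show "tmul (bv [Ee i, Ee (M - 1 + j - i)]) t \<in> Jbar M N"
          proof
            assume "M \<le> i"
            then show ?thesis using t by (intro g2) auto
          next
            assume "M \<le> M - 1 + j - i"
            then show ?thesis using t by (intro Jbar_swap) auto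
          qed
        qed (use t JW_Jbar subspace_Jbar in \<open>auto simp: rpairs_def\<close>)
      qed
    next
      case (Hh k)
      show ?thesis
      proof (cases "k \<ge> M + N")
        case True
        then show ?thesis using Hh t by (intro Jbar_swap) auto
      next
        case False
        then have k: "k = M + N - 1" using g Hh by auto
        show ?thesis
        proof (rule relation_dominant_term[where X = Ee and Y = Hh and n = "M - 1 + k" and A = "{M - 1}" and t = t])
          fix i assume "i \<in> {M - 1}"
          then show "tmul (bv [Ee i, Hh (M - 1 + k - i)]) t - tmul (bv [?E, g]) t \<in> Jbar M N"
            using Hh by (simp add: fv.subspace_0[OF subspace_Jbar])
        next
          fix i assume "i \<notin> {M - 1}"
          then have "M \<le> i \<or> M + N \<le> M - 1 + k - i" using k by auto
          then show "tmul (bv [Ee i, Hh (M - 1 + k - i)]) t \<in> Jbar M N"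
          proof
            assume "M \<le> i"
            then show ?thesis using t by (intro g2) auto
          next
            assume "M + N \<le> M - 1 + k - i"
            then show ?thesis using t by (intro Jbar_swap) auto
          qed
        qed (use t JW_Jbar subspace_Jbar in \<open>auto simp: rpairs_def\<close>)
      qed
    qed
    then show "tmul (bv [g]) t \<in> ?Z" using t by (simp add: bv2_tmul)
  qed
  then show ?thesis using assms by blast
qed

section \<open>Codimension bounds and the induction on \<open>M + N\<close>\<close>

definition codim_le :: "(gen list \<Rightarrow> complex) set \<Rightarrow> nat \<Rightarrow> bool" where
  "codim_le J n \<longleftrightarrow> (\<exists>B. finite B \<and> card B \<le> n \<and> (\<forall>b\<in>B. fins b) \<and> (\<forall>t. fins t \<longrightarrow> t \<in> fv.span (B \<union> J)))"

text \<open>Multiplication by \<open>g\<close> is well defined from the quotient by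
  \<open>J2\<close> to the quotient by \<open>J\<close>, and whatever vanishes modulo
  \<open>J1\<close> is hit by it modulo \<open>J\<close>. So a spanning set modulo \<open>J1\<close>
  together with \<open>g\<close> times one modulo \<open>J2\<close> spans modulo
  \<open>J\<close>.\<close>

lemma codim_le_step:
  assumes "codim_le J1 n1" "codim_le J2 n2"
    and J1: "J1 \<subseteq> fv.span ({tmul (bv [g]) t |t. fins t} \<union> J)"
    and J2: "\<And>t. t \<in> J2 \<Longrightarrow> tmul (bv [g]) t \<in> J"
  shows "codim_le J (n1 + n2)"
proof -
  obtain B1 where B1: "finite B1" "card B1 \<le> n1" "\<And>b. b \<in> B1 \<Longrightarrow> fins b" "\<And>t. fins t \<Longrightarrow> t \<in> fv.span (B1 \<union> J1)"
    using assms(1) unfolding codim_le_def by blast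
  obtain B2 where B2: "finite B2" "card B2 \<le> n2" "\<And>b. b \<in> B2 \<Longrightarrow> fins b" "\<And>t. fins t \<Longrightarrow> t \<in> fv.span (B2 \<union> J2)"
    using assms(2) unfolding codim_le_def by blast
  let ?B = "B1 \<union> tmul (bv [g]) ` B2"
  have g: "tmul (bv [g]) t \<in> fv.span (?B \<union> J)" if "fins t" for t
    by (rule tmul_bv_span[OF B2(4)[OF that]]) (auto intro: fv.span_base J2)
  have "J1 \<subseteq> fv.span (?B \<union> J)"
  proof
    fix x assume "x \<in> J1"
    then have "x \<in> fv.span ({tmul (bv [g]) t |t. fins t} \<union> J)" using J1 by blast
    also have "\<dots> \<subseteq> fv.span (?B \<union> J)"
      by (rule fv.span_minimal) (use g in \<open>auto intro: fv.span_base\<close>)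
    finally show "x \<in> fv.span (?B \<union> J)" .
  qed
  then have "fv.span (B1 \<union> J1) \<subseteq> fv.span (?B \<union> J)"
    by (intro fv.span_minimal) (auto intro: fv.span_base)
  then have "\<forall>t. fins t \<longrightarrow> t \<in> fv.span (?B \<union> J)" using B1(4) by blast
  moreover have "card ?B \<le> n1 + n2"
    using card_Un_le[of B1 "tmul (bv [g]) ` B2"] card_image_le[OF B2(1), of "tmul (bv [g])"] B1 B2 by linarith
  ultimately show ?thesis unfolding codim_le_def using B1 B2
    by (intro exI[of _ ?B]) auto
qed

text \<open>Bounding the length of the tail keeps the bracket terms within reach of the induction.\<close>

lemma vacuum_spans_mod_positive:
  "length w \<le> n \<Longrightarrow> bv w \<in> fv.span ({bv []} \<union> LM \<union> {bv (p # x) |p x. 0 < gidx p \<and> length x < n})"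
proof (induct n arbitrary: w)
  case 0
  then show ?case by (auto intro: fv.span_base)
next
  case (Suc n)
  let ?S = "\<lambda>n. {bv []} \<union> LM \<union> {bv (p # x) |p x. 0 < gidx p \<and> length x < n}"
  have mono: "fv.span (?S n) \<subseteq> fv.span (?S (Suc n))" 
    by (rule fv.span_mono) (use less_SucI in blast)
  show ?case
  proof (cases w)
    case (Cons g w')
    show ?thesis
    proof (cases "0 < gidx g")
      case True
      moreover have "length w' < Suc n" using Cons Suc.prems by simp
      ultimately have "bv (g # w') \<in> ?S (Suc n)"
        by (intro UnI2 CollectI exI[of _ g] exI[of _ w'] conjI refl)
      then show ?thesis unfolding Cons by (rule fv.span_base)
    next
      case False
      have "bv w' \<in> fv.span (?S n)" using Suc Cons by auto
      then have "tmul (bv [g]) (bv w') \<in> fv.span (?S (Suc n))"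
      proof (rule tmul_bv_span)
        fix a assume "a \<in> ?S n"
        then consider "a = bv []" | "a \<in> LM" | p x where "a = bv (p # x)" "0 < gidx p" "length x < n" by blast
        then show "tmul (bv [g]) a \<in> fv.span (?S (Suc n))"
        proof cases
          case 1
          then show ?thesis using nonpos_LM[of g] False by (auto intro!: fv.span_base)
        next
          case 2
          then show ?thesis using LM_left_ideal[of a "bv [g]"] by (auto intro!: fv.span_base)
        next
          case 3
          have "tmul (bv [g, p]) (bv x) - tmul (bv [p, g]) (bv x) - tmul (iota (bbr g p)) (bv x) \<in> LM"
            by (intro swap_LM) auto
          then have "bv (g # p # x) - bv (p # g # x) - tmul (iota (bbr g p)) (bv x) \<in> fv.span (?S (Suc n))"
            by (intro fv.span_base) auto
          moreover have "length (g # x) < Suc n" using 3 by simp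
          then have "bv (p # g # x) \<in> ?S (Suc n)"
            by (intro UnI2 CollectI exI[of _ p] exI[of _ "g # x"] conjI refl 3(2))
          then have "bv (p # g # x) \<in> fv.span (?S (Suc n))" by (rule fv.span_base)
          \<comment> \<open>The bracket merges two letters into one, so this word has length at most
            \<open>n\<close> and the induction hypothesis applies whatever the sign of its
            index.\<close>
          moreover have "bv (Hh (gidx g + gidx p) # x) \<in> fv.span (?S (Suc n))"
            using Suc.hyps[of "Hh (gidx g + gidx p) # x"] 3 mono by auto
          then have "tmul (iota (bbr g p)) (bv x) \<in> fv.span (?S (Suc n))"
            by (cases g p rule: bbr_cases)
              (simp_all only: iota_zero iota_bv iota_sc tmul_zero tmul_sc tmul_bv_bv append_Cons append_Nil
                fv.span_zero fv.span_scale)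
          ultimately have "bv (g # p # x) - bv (p # g # x) - tmul (iota (bbr g p)) (bv x) + bv (p # g # x)
              + tmul (iota (bbr g p)) (bv x) \<in> fv.span (?S (Suc n))"
            by (intro fv.span_add)
          then show ?thesis using 3 by simp
        qed
      qed simp
      then show ?thesis using Cons by simp
    qed
  qed (auto intro: fv.span_base)
qed

text \<open>Since \<open>M\<close>, \<open>N\<close> and \<open>M + N\<close> are at most 1, every
  letter of positive index belongs to \<open>g(M, N)\<close>. Words starting with such a letter
  vanish in the quotient, and only the vacuum is left.\<close>

lemma vacuum_spans_Jbar:
  assumes "M \<le> 1" "N \<le> 1" "M + N \<le> 1" "fins t"
  shows "t \<in> fv.span ({bv []} \<union> Jbar M N)"
  using assms(4)
proof (induct t rule: fins_induct)
  case (bv w)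
  have "bv w \<in> fv.span ({bv []} \<union> LM \<union> {bv (p # x) |p x. 0 < gidx p \<and> length x < length w})"
    by (rule vacuum_spans_mod_positive) simp
  also have "\<dots> \<subseteq> fv.span ({bv []} \<union> Jbar M N)"
  proof (rule fv.span_mono, intro Un_least)
    show "{bv []} \<subseteq> {bv []} \<union> Jbar M N" by simp
    show "LM \<subseteq> {bv []} \<union> Jbar M N" using LM_JW JW_Jbar by blast
    show "{bv (p # x) |p x. 0 < gidx p \<and> length x < length w} \<subseteq> {bv []} \<union> Jbar M N"
    proof clarsimp
      fix p x assume "0 < gidx p" "bv (p # x) \<notin> Jbar M N"
      moreover have "gen_in M N p" using \<open>0 < gidx p\<close> assms by (cases p) auto
      then have "tmul (bv [p]) (bv x) \<in> Jbar M N" by (intro Jbar_gen) auto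
      ultimately show "bv (p # x) = bv []" by simp
    qed
  qed
  finally show ?case .
qed (auto intro: fv.span_zero fv.span_add fv.span_scale)

lemma codim_le_Jbar_base: "M \<le> 1 \<Longrightarrow> N \<le> 1 \<Longrightarrow> M + N \<le> 1 \<Longrightarrow> codim_le (Jbar M N) 1"
  unfolding codim_le_def using vacuum_spans_Jbar by (intro exI[of _ "{bv []}"]) auto

lemma codim_le_JMN_vacuum: "N \<le> 1 \<Longrightarrow> codim_le (JMN (-1) N) 0"
  unfolding codim_le_def using vacuum_spans_Jbar[of "-1" N]
  by (intro exI[of _ "{}"]) (auto simp: JMN_def lspan_eq_span fv.span_span Un_commute)

lemma JMN_F_step: "JMN (-1) (N - 1) \<subseteq> fv.span ({tmul (bv [Ff (N - 1)]) t |t. fins t} \<union> JMN (-1) N)"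
    (is "_ \<subseteq> fv.span (?F \<union> _)")
proof -
  have "Jbar (-1) (N - 1) \<subseteq> fv.span (?F \<union> Jbar (-1) N)"
    by (rule Jbar_F_step)
  also have "\<dots> \<subseteq> fv.span (?F \<union> JMN (-1) N)"
    by (rule fv.span_mono) (use Jbar_JMN in blast)
  finally have "Jbar (-1) (N - 1) \<subseteq> fv.span (?F \<union> JMN (-1) N)" .
  moreover have "bv [] \<in> JMN (-1) N" by (simp add: JMN_def lspan_base)
  then have "{bv []} \<subseteq> fv.span (?F \<union> JMN (-1) N)" by (simp add: fv.span_base)
  ultimately have "fv.span (Jbar (-1) (N - 1) \<union> {bv []}) \<subseteq> fv.span (?F \<union> JMN (-1) N)"
    by (intro fv.span_minimal) auto
  then show ?thesis by (simp add: JMN_def[of "-1" "N - 1"] lspan_eq_span)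
qed

text \<open>Both parts of a step have index sum \<open>M + N - 1\<close>, so the bound
  doubles.\<close>

lemma codim_le_JMN:
  assumes "M \<in> {-1, 0, 1}" "M + N \<ge> 1"
  shows "codim_le (JMN M N) (2 ^ nat (M + N - 1))"
  using assms
proof (induct "nat (M + N)" arbitrary: M N rule: less_induct)
  case less
  have J01: "JMN M N = Jbar M N" if "M \<in> {0, 1}" "N \<ge> 0" for M N
    using that by (auto simp: JMN_def)
  from less.prems consider "M = 0" "N = 1" | "M = 1" "N = 0" | "M = -1" "N = 2"
    | "M = 0" "N \<ge> 2" | "M = 1" "N \<ge> 1" | "M = -1" "N \<ge> 3" by fastforce
  then show ?case
  proof cases
    case 1
    then show ?thesis using codim_le_Jbar_base[of 0 1] by (simp add: J01)
  next
    case 2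
    then show ?thesis using codim_le_Jbar_base[of 1 0] by (simp add: J01)
  next
    case 3
    \<comment> \<open>Both parts lie below the range of the induction here: \<open>(-1, 1)\<close>
      contributes nothing, as its vacuum is divided out, and \<open>(0, 0)\<close> only the
      vacuum.\<close>
    have "codim_le (JMN (-1) 2) (0 + 1)"
    proof (rule codim_le_step[where g = "Ff 1"])
      show "codim_le (JMN (-1) 1) 0" by (rule codim_le_JMN_vacuum) simp
      show "codim_le (Jbar 0 0) 1" by (rule codim_le_Jbar_base) auto
      show "JMN (-1) 1 \<subseteq> fv.span ({tmul (bv [Ff 1]) t |t. fins t} \<union> JMN (-1) 2)"
        using JMN_F_step[of 2] by simp
      show "tmul (bv [Ff 1]) t \<in> JMN (-1) 2" if "t \<in> Jbar 0 0" for t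
        using F_mul_Jbar[of t "-1" 2] that Jbar_JMN by auto
    qed
    then show ?thesis using 3 by simp
  next
    case 4
    have "codim_le (Jbar 0 N) (2 ^ nat (0 + (N - 1) - 1) + 2 ^ nat (1 + (N - 2) - 1))"
    proof (rule codim_le_step[where g = "Ff (N - 1)"])
      show "codim_le (Jbar 0 (N - 1)) (2 ^ nat (0 + (N - 1) - 1))"
        using less.hyps[of 0 "N - 1"] 4 by (simp add: J01)
      show "codim_le (Jbar 1 (N - 2)) (2 ^ nat (1 + (N - 2) - 1))"
        using less.hyps[of 1 "N - 2"] 4 by (simp add: J01)
      show "tmul (bv [Ff (N - 1)]) t \<in> Jbar 0 N" if "t \<in> Jbar 1 (N - 2)" for t
        using F_mul_Jbar[of t 0 N] that by simp
    qed (rule Jbar_F_step)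
    moreover have "2 ^ nat (0 + (N - 1) - 1) + 2 ^ nat (1 + (N - 2) - 1) = (2 :: nat) ^ nat (M + N - 1)"
    proof -
      have "nat (M + N - 1) = Suc (nat (N - 2))" using 4 by simp
      then show ?thesis by simp
    qed
    ultimately show ?thesis using 4 by (simp add: J01)
  next
    case 5
    have "codim_le (Jbar 1 N) (2 ^ nat (0 + N - 1) + 2 ^ nat (-1 + (N + 1) - 1))"
    proof (rule codim_le_step[where g = "Ee 0"])
      show "codim_le (Jbar 0 N) (2 ^ nat (0 + N - 1))"
        using less.hyps[of 0 N] 5 by (simp add: J01)
      show "codim_le (JMN (-1) (N + 1)) (2 ^ nat (-1 + (N + 1) - 1))"
        using less.hyps[of "-1" "N + 1"] 5 by simp
      show "Jbar 0 N \<subseteq> fv.span ({tmul (bv [Ee 0]) t |t. fins t} \<union> Jbar 1 N)"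
        using Jbar_E_step[of 1 N] by simp
      \<comment> \<open>The domain may be divided by the vacuum because \<open>e_0\<close>
        annihilates it.\<close>
      show "tmul (bv [Ee 0]) t \<in> Jbar 1 N" if "t \<in> JMN (-1) (N + 1)" for t
      proof (rule tmul_bv_span[OF _ subspace_Jbar])
        show "t \<in> fv.span (Jbar (-1) (N + 1) \<union> {bv []})" using that by (simp add: JMN_def lspan_eq_span)
        fix a assume "a \<in> Jbar (-1) (N + 1) \<union> {bv []}"
        then show "tmul (bv [Ee 0]) a \<in> Jbar 1 N"
          using E_mul_Jbar[of a 1 N] subsetD[OF subset_trans[OF LM_JW JW_Jbar] nonpos_LM[of "Ee 0"]] by auto
      qed
    qed
    moreover have "2 ^ nat (0 + N - 1) + 2 ^ nat (-1 + (N + 1) - 1) = (2 :: nat) ^ nat (M + N - 1)"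
    proof -
      have "nat (M + N - 1) = Suc (nat (N - 1))" using 5 by simp
      then show ?thesis by simp
    qed
    ultimately show ?thesis using 5 by (simp add: J01)
  next
    case 6
    have "codim_le (JMN (-1) N) (2 ^ nat (-1 + (N - 1) - 1) + 2 ^ nat (0 + (N - 2) - 1))"
    proof (rule codim_le_step[where g = "Ff (N - 1)"])
      show "codim_le (JMN (-1) (N - 1)) (2 ^ nat (-1 + (N - 1) - 1))"
        using less.hyps[of "-1" "N - 1"] 6 by simp
      show "codim_le (Jbar 0 (N - 2)) (2 ^ nat (0 + (N - 2) - 1))"
        using less.hyps[of 0 "N - 2"] 6 by (simp add: J01)
      show "JMN (-1) (N - 1) \<subseteq> fv.span ({tmul (bv [Ff (N - 1)]) t |t. fins t} \<union> JMN (-1) N)"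
        by (rule JMN_F_step)
      show "tmul (bv [Ff (N - 1)]) t \<in> JMN (-1) N" if "t \<in> Jbar 0 (N - 2)" for t
        using F_mul_Jbar[of t "-1" N] that Jbar_JMN by auto
    qed
    moreover have "2 ^ nat (-1 + (N - 1) - 1) + 2 ^ nat (0 + (N - 2) - 1) = (2 :: nat) ^ nat (M + N - 1)"
    proof -
      have "nat (M + N - 1) = Suc (nat (N - 3))" using 6 by simp
      then show ?thesis by simp
    qed
    ultimately show ?thesis using 6 by simp
  qed
qed

section \<open>Bases modulo a subspace\<close>

lemma span_insert_subspace:
  assumes "fv.subspace J" "finite B" "x \<in> fv.span (B \<union> J)"
  shows "\<exists>c. x - (\<Sum>b\<in>B. sc (c b) b) \<in> J"
proof -
  obtain u v where "u \<in> fv.span B" "v \<in> fv.span J" "x = u + v"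
    using assms(3) by (auto simp: fv.span_Un)
  moreover from \<open>u \<in> fv.span B\<close> obtain c where "u = (\<Sum>b\<in>B. sc (c b) b)"
    using fv.span_finite[OF assms(2)] by auto
  moreover have "v \<in> J" using \<open>v \<in> fv.span J\<close> fv.span_minimal[OF subset_refl assms(1)] by blast
  ultimately show ?thesis by (intro exI[of _ c]) simp
qed

text \<open>There are more rows than columns. A repeated row is treated separately, because
  \<open>fv.dependent\<close> speaks about sets and does not see repetitions.\<close>

lemma dependent_coeffs:
  fixes m :: "'i \<Rightarrow> 'b \<Rightarrow> complex"
  assumes "finite B" "finite S" "card B < card S" "\<And>s b. s \<in> S \<Longrightarrow> b \<notin> B \<Longrightarrow> m s b = 0"
  shows "\<exists>c. (\<exists>s\<in>S. c s \<noteq> 0) \<and> (\<Sum>s\<in>S. sc (c s) (m s)) = 0"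
proof (cases "inj_on m S")
  case False
  then obtain s t where st: "s \<in> S" "t \<in> S" "s \<noteq> t" "m s = m t" by (auto simp: inj_on_def)
  let ?c = "(\<lambda>_. 0)(s := 1, t := - 1) :: 'i \<Rightarrow> complex"
  have "(\<Sum>x\<in>S. sc (?c x) (m x)) = (\<Sum>x\<in>{s, t}. sc (?c x) (m x))"
    using assms st by (intro sum.mono_neutral_right) auto
  also have "\<dots> = 0" using st by simp
  finally show ?thesis using st by (intro exI[of _ ?c]) auto
next
  case True
  have "m s = (\<Sum>b\<in>B. sc (m s b) (bv b))" if "s \<in> S" for s
  proof
    fix x
    have "(\<Sum>b\<in>B. sc (m s b) (bv b)) x = (\<Sum>b\<in>B. if b = x then m s b else 0)"
      unfolding sum_fun_apply by (intro sum.cong) (auto simp: sc_def bv_def)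
    also have "\<dots> = m s x" using assms(1,4) that by auto
    finally show "m s x = (\<Sum>b\<in>B. sc (m s b) (bv b)) x" by simp
  qed
  then have "m s \<in> fv.span (bv ` B)" if "s \<in> S" for s
    using that by (metis (no_types, lifting) fv.span_sum fv.span_scale fv.span_base imageI)
  then have "m ` S \<subseteq> fv.span (bv ` B)" by auto
  moreover have "card (bv ` B) < card (m ` S)"
    using assms True card_image_le[OF assms(1), of bv] by (simp add: card_image)
  ultimately have "fv.dependent (m ` S)"
    using fv.independent_span_bound[of "bv ` B" "m ` S"] assms(1) by force
  then obtain u where u: "\<exists>v\<in>m ` S. u v \<noteq> 0" "(\<Sum>v\<in>m ` S. sc (u v) v) = 0"
    using fv.dependent_finite[of "m ` S"] assms(2) by auto
  then have "(\<Sum>s\<in>S. sc (u (m s)) (m s)) = 0" by (simp add: sum.reindex[OF True])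
  then show ?thesis using u(1) by (intro exI[of _ "\<lambda>s. u (m s)"]) auto
qed

lemma indep_mod_card_le:
  assumes J: "fv.subspace J" and B: "finite B" and f: "\<And>s. s \<in> S \<Longrightarrow> f s \<in> fv.span (B \<union> J)"
    and indep: "indep_mod J f S" and S: "finite S"
  shows "card S \<le> card B"
proof (rule ccontr)
  assume "\<not> card S \<le> card B"
  then have lt: "card B < card S" by simp
  have "\<forall>s\<in>S. \<exists>c. f s - (\<Sum>b\<in>B. sc (c b) b) \<in> J"
    using span_insert_subspace[OF J B] f by blast
  then obtain m where m: "\<And>s. s \<in> S \<Longrightarrow> f s - (\<Sum>b\<in>B. sc (m s b) b) \<in> J" by metis
  let ?m = "\<lambda>s b. if b \<in> B then m s b else 0"
  obtain c where c: "\<exists>s\<in>S. c s \<noteq> 0" "(\<Sum>s\<in>S. sc (c s) (?m s)) = 0"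
    using dependent_coeffs[OF B S lt, of ?m] by auto
  have z: "(\<Sum>s\<in>S. c s * m s b) = 0" if "b \<in> B" for b
  proof -
    have "(\<Sum>s\<in>S. sc (c s) (?m s)) b = 0" using c(2) by (simp add: zero_fun_apply)
    then show ?thesis using that by (simp add: sum_fun_apply sc_def)
  qed
  have "(\<Sum>s\<in>S. sc (c s) (\<Sum>b\<in>B. sc (m s b) b)) = (\<Sum>b\<in>B. sc (\<Sum>s\<in>S. c s * m s b) b)"
    by (simp add: fv.scale_sum_right fv.scale_sum_left sum.swap[of _ B])
  also have "\<dots> = 0" using z by simp
  finally have e: "(\<Sum>s\<in>S. sc (c s) (\<Sum>b\<in>B. sc (m s b) b)) = 0" .
  have "(\<Sum>s\<in>S. sc (c s) (f s - (\<Sum>b\<in>B. sc (m s b) b))) \<in> J"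
    using m by (intro fv.subspace_sum[OF J] fv.subspace_scale[OF J])
  then have "(\<Sum>s\<in>S. sc (c s) (f s)) \<in> J"
    by (simp add: fv.scale_right_diff_distrib sum_subtractf e)
  then have "\<forall>s\<in>S. c s = 0" using indep S unfolding indep_mod_def by blast
  then show False using c(1) by blast
qed

lemma indep_mod_subset: "indep_mod J f S \<Longrightarrow> S' \<subseteq> S \<Longrightarrow> indep_mod J f S'"
  unfolding indep_mod_def by (meson order_trans)

text \<open>An independent family as large as the codimension bound is a basis: one more vector
  \<open>t\<close> makes it too long to be independent, and in the resulting relation
  \<open>t\<close> has a nonzero coefficient.\<close>

lemma basis_mod_criterion:
  assumes J: "fv.subspace J" and n: "codim_le J n" and f: "\<And>s. s \<in> C \<Longrightarrow> fins (f s)"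
    and indep: "indep_mod J f C" and S: "S \<subseteq> C" "finite S" "card S = n"
  shows "spans_mod J f C" and "qdim J = n"
proof -
  obtain B where B: "finite B" "card B \<le> n" "\<forall>b\<in>B. fins b" "\<And>t. fins t \<Longrightarrow> t \<in> fv.span (B \<union> J)"
    using n unfolding codim_le_def by blast
  have indS: "indep_mod J f S" using indep_mod_subset[OF indep S(1)] .
  have fS: "fins (f s)" if "s \<in> S" for s using f S that by auto
  have injS: "inj_on f S"
  proof (rule inj_onI, rule ccontr)
    fix s t assume st: "s \<in> S" "t \<in> S" "f s = f t" "s \<noteq> t"
    let ?c = "(\<lambda>_. 0 :: complex)(s := 1, t := - 1)"
    have "(\<Sum>x\<in>{s, t}. sc (?c x) (f x)) \<in> J" using st fv.subspace_0[OF J] by simp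
    then have "\<forall>x\<in>{s, t}. ?c x = 0"
      using indS[unfolded indep_mod_def, THEN spec[of _ ?c], THEN spec[of _ "{s, t}"]] st by simp
    then show False using st by simp
  qed
  have key: "\<exists>c. t - (\<Sum>s\<in>S. sc (c s) (f s)) \<in> J" if t: "fins t" for t
  proof -
    \<comment> \<open>\<open>None\<close> indexes the additional vector, so that \<open>t\<close>
      counts as a new member even if it coincides with some \<open>f s\<close>.\<close>
    define g where "g x = (case x of None \<Rightarrow> t | Some s \<Rightarrow> f s)" for x
    have "\<not> indep_mod J g (insert None (Some ` S))"
    proof
      assume "indep_mod J g (insert None (Some ` S))"
      moreover have "g x \<in> fv.span (B \<union> J)" if "x \<in> insert None (Some ` S)" for x
        using that B(4) t fS by (auto simp: g_def)
      ultimately have "card (insert None (Some ` S)) \<le> card B"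
        using S(2) by (intro indep_mod_card_le[OF J B(1)]) auto
      then show False using S B by (simp add: card_image)
    qed
    then obtain c S' where c: "S' \<subseteq> insert None (Some ` S)" "finite S'" "(\<Sum>x\<in>S'. sc (c x) (g x)) \<in> J"
      "\<exists>x\<in>S'. c x \<noteq> 0" unfolding indep_mod_def by blast
    define d where "d x = (if x \<in> S' then c x else 0)" for x
    have "(\<Sum>x\<in>insert None (Some ` S). sc (d x) (g x)) = (\<Sum>x\<in>S'. sc (d x) (g x))"
      using c S(2) by (intro sum.mono_neutral_right) (auto simp: d_def)
    also have "\<dots> = (\<Sum>x\<in>S'. sc (c x) (g x))" by (intro sum.cong) (auto simp: d_def)
    finally have d: "(\<Sum>x\<in>insert None (Some ` S). sc (d x) (g x)) \<in> J" using c by simp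
    have "(\<Sum>x\<in>Some ` S. sc (d x) (g x)) = (\<Sum>s\<in>S. sc (d (Some s)) (f s))"
      by (simp add: sum.reindex g_def)
    then have d': "sc (d None) t + (\<Sum>s\<in>S. sc (d (Some s)) (f s)) \<in> J"
      using d S(2) by (simp add: g_def)
    have "d None \<noteq> 0"
    proof
      assume z: "d None = 0"
      then have "(\<Sum>s\<in>S. sc (d (Some s)) (f s)) \<in> J" using d' by simp
      then have "\<forall>s\<in>S. d (Some s) = 0"
        using indS[unfolded indep_mod_def, THEN spec[of _ "\<lambda>s. d (Some s)"], THEN spec[of _ S]] S(2) by simp
      then have "d x = 0" if "x \<in> S'" for x using z c(1) that by (cases x) auto
      then show False using c(4) by (auto simp: d_def)
    qed
    then have "t - (\<Sum>s\<in>S. sc (- d (Some s) / d None) (f s))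
        = sc (inverse (d None)) (sc (d None) t + (\<Sum>s\<in>S. sc (d (Some s)) (f s)))"
      by (simp add: fv.scale_right_distrib fv.scale_sum_right fv.scale_scale sum_negf divide_inverse mult.commute)
    also have "\<dots> \<in> J" by (rule fv.subspace_scale[OF J d'])
    finally show ?thesis by (rule exI[where x = "\<lambda>s. - d (Some s) / d None"])
  qed
  show "spans_mod J f C"
    unfolding spans_mod_def using key S by blast
  show "qdim J = n"
    unfolding qdim_def
  proof (rule Least_equality)
    have "t \<in> fv.span (f ` S \<union> J)" if "fins t" for t
    proof -
      obtain c where "t - (\<Sum>s\<in>S. sc (c s) (f s)) \<in> J" using key \<open>fins t\<close> by blast
      then have "t - (\<Sum>s\<in>S. sc (c s) (f s)) + (\<Sum>s\<in>S. sc (c s) (f s)) \<in> fv.span (f ` S \<union> J)"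
        by (intro fv.span_add[OF fv.span_base] fv.span_sum fv.span_scale fv.span_base) auto
      then show ?thesis by simp
    qed
    then show "\<exists>B. finite B \<and> card B = n \<and> (\<forall>b\<in>B. fins b) \<and> (\<forall>t. fins t \<longrightarrow> t \<in> lspan (B \<union> J))"
      using S fS by (intro exI[of _ "f ` S"]) (auto simp: lspan_eq_span card_image[OF injS])
  next
    fix k assume "\<exists>B. finite B \<and> card B = k \<and> (\<forall>b\<in>B. fins b) \<and> (\<forall>t. fins t \<longrightarrow> t \<in> lspan (B \<union> J))"
    then obtain B' where "finite B'" "card B' = k" "\<And>t. fins t \<Longrightarrow> t \<in> fv.span (B' \<union> J)"
      by (auto simp: lspan_eq_span)
    then show "n \<le> k" using indep_mod_card_le[OF J _ _ indS S(2)] S fS by blast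
  qed
qed

section \<open>Counting configurations\<close>

text \<open>Every configuration extends by one site next to the origin in two ways, so their number
  doubles. In the second way \<open>b 1\<close> moves into the new site, and \<open>a 1\<close> becomes the right neighbour
  of a new entry \<open>b 1\<close>.\<close>

definition add_empty :: "(int \<Rightarrow> nat) \<times> (int \<Rightarrow> nat) \<Rightarrow> (int \<Rightarrow> nat) \<times> (int \<Rightarrow> nat)" where
  "add_empty = (\<lambda>(a, b). ((\<lambda>i. a (i - 1)), (\<lambda>i. b (i - 1))))"

definition add_occupied :: "(int \<Rightarrow> nat) \<times> (int \<Rightarrow> nat) \<Rightarrow> (int \<Rightarrow> nat) \<times> (int \<Rightarrow> nat)" where
  "add_occupied = (\<lambda>(a, b). ((\<lambda>i. if i = 1 then 1 - a 1 - b 1 else a (i - 1)),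
     (\<lambda>i. if i = 1 then a 1 + b 1 else if i = 2 then 0 else b (i - 1))))"

lemma add_empty_C0: "ab \<in> C0 N \<Longrightarrow> add_empty ab \<in> C0 (N + 1)"
proof -
  obtain a b where ab: "ab = (a, b)" by fastforce
  assume "ab \<in> C0 N"
  then have C: "\<forall>i. a i \<le> 1 \<and> b i \<le> 1" "\<forall>i. i < 0 \<or> N - 1 < i \<longrightarrow> a i = 0" "\<forall>i. i < 1 \<or> N - 1 < i \<longrightarrow> b i = 0"
    "a 0 = 0" and t: "triangle a b" and r: "rightnb a b" by (auto simp: C0_def ab)
  have "triangle (\<lambda>i. a (i - 1)) (\<lambda>i. b (i - 1))"
    unfolding triangle_def
  proof
    fix i show "b (i + 1 - 1) + a (i + 1 - 1) + a (i - 1) \<le> 1 \<and> b (i + 1 - 1) + b (i - 1) + a (i - 1) \<le> 1"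
      using t[unfolded triangle_def, THEN spec[of _ "i - 1"]] by simp
  qed
  moreover have "rightnb (\<lambda>i. a (i - 1)) (\<lambda>i. b (i - 1))"
    unfolding rightnb_def
  proof (intro allI impI)
    fix i assume "b (i - 1) \<noteq> 0"
    then obtain j where "j > i - 1" "a j \<noteq> 0" "\<forall>s. i - 1 + 1 \<le> s \<and> s \<le> j \<longrightarrow> b s = 0"
      using r unfolding rightnb_def by blast
    then show "\<exists>j>i. a (j - 1) \<noteq> 0 \<and> (\<forall>s. i + 1 \<le> s \<and> s \<le> j \<longrightarrow> b (s - 1) = 0)"
      by (intro exI[of _ "j + 1"]) auto
  qed
  ultimately show ?thesis using C unfolding ab add_empty_def C0_def by simp
qed

lemma add_occupied_C0: "N \<ge> 1 \<Longrightarrow> ab \<in> C0 N \<Longrightarrow> add_occupied ab \<in> C0 (N + 1)"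
proof -
  obtain a b where ab: "ab = (a, b)" by fastforce
  assume N: "N \<ge> 1" and "ab \<in> C0 N"
  then have C: "\<And>i. a i \<le> 1 \<and> b i \<le> 1" "\<And>i. i < 0 \<or> N - 1 < i \<Longrightarrow> a i = 0" "\<And>i. i < 1 \<or> N - 1 < i \<Longrightarrow> b i = 0"
    "a 0 = 0" and t: "triangle a b" and r: "rightnb a b" by (auto simp: C0_def ab)
  define a' where "a' i = (if i = 1 then 1 - a 1 - b 1 else a (i - 1))" for i
  define b' where "b' i = (if i = 1 then a 1 + b 1 else if i = 2 then 0 else b (i - 1))" for i
  have tr: "b (i + 1) + a (i + 1) + a i \<le> 1" "b (i + 1) + b i + a i \<le> 1" for i
    using t unfolding triangle_def by auto
  have t1: "a 1 + b 1 \<le> 1" using tr(1)[of 0] by simp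
  have "triangle a' b'"
    unfolding triangle_def
  proof
    fix i :: int
    consider "i < 0" | "i = 0" | "i = 1" | "i = 2" | "i > 2" by linarith
    then show "b' (i + 1) + a' (i + 1) + a' i \<le> 1 \<and> b' (i + 1) + b' i + a' i \<le> 1"
    proof cases
      case 2
      then show ?thesis using t1 C(2)[of "-1"] C(3)[of "-1"] by (auto simp: a'_def b'_def)
    next
      case 3
      then show ?thesis using t1 by (auto simp: a'_def b'_def)
    next
      case 4
      then show ?thesis using tr[of 1] by (auto simp: a'_def b'_def)
    next
      case 5
      then show ?thesis using tr[of "i - 1"] by (auto simp: a'_def b'_def)
    qed (auto simp: a'_def b'_def C)
  qed
  moreover have "rightnb a' b'"
    unfolding rightnb_def
  proof (intro allI impI)
    fix i assume i: "b' i \<noteq> 0"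
    show "\<exists>j>i. a' j \<noteq> 0 \<and> (\<forall>s. i + 1 \<le> s \<and> s \<le> j \<longrightarrow> b' s = 0)"
    proof (cases "i = 1 \<and> b 1 = 0")
      case True
      then have "a 1 \<noteq> 0" using i by (simp add: b'_def)
      then show ?thesis using True by (intro exI[of _ 2]) (auto simp: a'_def b'_def)
    next
      case False
      \<comment> \<open>\<open>k\<close> is the old site from which the entry at \<open>i\<close>
        comes: \<open>b 1\<close> keeps its index while the higher entries are shifted. Its right
        neighbour moves from \<open>j\<close> to \<open>j + 1\<close> in either case.\<close>
      define k where "k = (if i = 1 then 1 else i - 1)"
      have k: "b k \<noteq> 0" and "i \<noteq> 2"
        using i False by (auto simp: b'_def k_def split: if_splits)
      have "k \<ge> 1" using k C(3)[of k] by linarith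
      from k obtain j where j: "j > k" "a j \<noteq> 0" "\<And>s. k + 1 \<le> s \<Longrightarrow> s \<le> j \<Longrightarrow> b s = 0"
        using r unfolding rightnb_def by meson
      have "i \<ge> 1" using \<open>k \<ge> 1\<close> by (auto simp: k_def split: if_splits)
      then show ?thesis using j \<open>k \<ge> 1\<close> \<open>i \<noteq> 2\<close>
        by (intro exI[of _ "j + 1"]) (auto simp: a'_def b'_def k_def split: if_splits)
    qed
  qed
  moreover have "\<forall>i. a' i \<le> 1 \<and> b' i \<le> 1" using C t1 by (auto simp: a'_def b'_def)
  moreover have "\<forall>i. i < 0 \<or> N < i \<longrightarrow> a' i = 0" using C N by (auto simp: a'_def)
  moreover have "\<forall>i. i < 1 \<or> N < i \<longrightarrow> b' i = 0" using C N by (auto simp: b'_def)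
  moreover have "a' 0 = 0" using C by (simp add: a'_def)
  moreover have "add_occupied ab = (a', b')" by (simp add: add_occupied_def ab a'_def b'_def fun_eq_iff)
  ultimately show ?thesis unfolding C0_def by simp
qed

lemma C0_large: "\<exists>S\<subseteq>C0 (int n + 1). finite S \<and> card S = 2 ^ n"
proof (induct n)
  case 0
  have "((\<lambda>_. 0), (\<lambda>_. 0)) \<in> C0 (int 0 + 1)" by (auto simp: C0_def triangle_def rightnb_def)
  then show ?case by (intro exI[of _ "{((\<lambda>_. 0), (\<lambda>_. 0))}"]) auto
next
  case (Suc n)
  then obtain S where S: "S \<subseteq> C0 (int n + 1)" "finite S" "card S = 2 ^ n" by blast
  have z: "a 0 = 0" "b 0 = 0" "a 1 + b 1 \<le> 1" if "(a, b) \<in> S" for a b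
  proof -
    have C: "(a, b) \<in> C0 (int n + 1)" using S that by blast
    then show "a 0 = 0" "b 0 = 0" by (auto simp: C0_def)
    have "b (0 + 1) + a (0 + 1) + a 0 \<le> 1" using C unfolding C0_def triangle_def by blast
    then show "a 1 + b 1 \<le> 1" by simp
  qed
  have e: "inj_on add_empty S"
  proof (rule inj_onI)
    fix x y assume "add_empty x = add_empty y"
    moreover obtain a b c d where xy: "x = (a, b)" "y = (c, d)" by (cases x, cases y) blast
    ultimately have "(\<lambda>i. a (i - 1)) = (\<lambda>i. c (i - 1))" "(\<lambda>i. b (i - 1)) = (\<lambda>i. d (i - 1))"
      by (auto simp: add_empty_def)
    then have "a i = c i" "b i = d i" for i by (metis add_diff_cancel)+
    then show "x = y" by (auto simp: xy)
  qed
  have o: "inj_on add_occupied S"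
  proof (rule inj_onI)
    fix x y assume S': "x \<in> S" "y \<in> S" and eq: "add_occupied x = add_occupied y"
    obtain a b c d where xy: "x = (a, b)" "y = (c, d)" by (cases x, cases y) blast
    have A: "(if i = 1 then 1 - a 1 - b 1 else a (i - 1)) = (if i = 1 then 1 - c 1 - d 1 else c (i - 1))" for i
      using eq by (auto simp: add_occupied_def xy dest: fun_cong[of _ _ i])
    have B: "(if i = 1 then a 1 + b 1 else if i = 2 then 0 else b (i - 1))
        = (if i = 1 then c 1 + d 1 else if i = 2 then 0 else d (i - 1))" for i
      using eq by (auto simp: add_occupied_def xy dest: fun_cong[of _ _ i])
    have "a i = c i" for i using A[of "i + 1"] z[of a b] z[of c d] S' xy by (cases "i = 0") auto
    moreover have "b i = d i" for i
    proof -
      consider "i = 0" | "i = 1" | "i \<noteq> 0" "i \<noteq> 1" by blast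
      then show ?thesis
      proof cases
        case 1
        then show ?thesis using z[of a b] z[of c d] S' xy by simp
      next
        case 2
        then show ?thesis using B[of 1] \<open>\<And>i. a i = c i\<close>[of 1] by simp
      next
        case 3
        then show ?thesis using B[of "i + 1"] by simp
      qed
    qed
    ultimately show "x = y" by (auto simp: xy)
  qed
  \<comment> \<open>The images are told apart at site 1: \<open>add_empty\<close> leaves both
    entries 0 there, whereas \<open>add_occupied\<close> makes exactly one of them 1.\<close>
  have disj: "add_empty ` S \<inter> add_occupied ` S = {}"
  proof (intro equals0I)
    fix p assume "p \<in> add_empty ` S \<inter> add_occupied ` S"
    then obtain a b c d where p: "(a, b) \<in> S" "(c, d) \<in> S" "p = add_empty (a, b)" "p = add_occupied (c, d)"
      by (auto simp del: split_paired_All)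
    then have "a 0 = 1 - c 1 - d 1" "b 0 = c 1 + d 1"
      by (auto simp: add_empty_def add_occupied_def dest: fun_cong[of _ _ 1])
    then show False using z(1,2)[OF p(1)] by simp
  qed
  let ?S = "add_empty ` S \<union> add_occupied ` S"
  have "card ?S = 2 ^ Suc n"
    using S by (simp add: card_Un_disjoint disj card_image e o)
  moreover have "?S \<subseteq> C0 (int (Suc n) + 1)"
    using S(1) add_empty_C0[of _ "int n + 1"] add_occupied_C0[of "int n + 1"] by (auto simp: add.commute)
  ultimately show ?case using S(2) by (intro exI[of _ ?S]) auto
qed

section \<open>From \<open>C0\<close> to \<open>C1\<close>\<close>

definition lowest_a :: "(int \<Rightarrow> nat) \<times> (int \<Rightarrow> nat) \<Rightarrow> bool" where
  "lowest_a = (\<lambda>(a, b). \<exists>j. a j \<noteq> 0 \<and> (\<forall>s\<le>j. b s = 0))"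

text \<open>\<open>C1\<close> demands an \<open>a\<close> below all \<open>b\<close>, while
  \<open>C0\<close> demands \<open>a 0 = 0\<close>. If the former fails, an entry is put at the
  origin, where \<open>C0\<close> has left room; the triangle relations then force
  \<open>b 1\<close> to be removed.\<close>

definition to_C1 :: "(int \<Rightarrow> nat) \<times> (int \<Rightarrow> nat) \<Rightarrow> (int \<Rightarrow> nat) \<times> (int \<Rightarrow> nat)" where
  "to_C1 = (\<lambda>(a, b). if lowest_a (a, b) then (a, b) else (a(0 := 1), b(1 := 0)))"

lemma to_C1_C1: "N \<ge> 0 \<Longrightarrow> ab \<in> C0 (N + 1) \<Longrightarrow> to_C1 ab \<in> C1 N"
proof -
  obtain a b where ab: "ab = (a, b)" by fastforce
  assume N: "N \<ge> 0" and "ab \<in> C0 (N + 1)"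
  then have C: "\<And>i. a i \<le> 1 \<and> b i \<le> 1" "\<And>i. i < 0 \<or> N < i \<Longrightarrow> a i = 0" "\<And>i. i < 1 \<or> N < i \<Longrightarrow> b i = 0"
    "a 0 = 0" and t: "triangle a b" and r: "rightnb a b" by (auto simp: C0_def ab)
  show ?thesis
  proof (cases "lowest_a ab")
    case True
    then show ?thesis using C t r by (auto simp: to_C1_def C1_def ab lowest_a_def)
  next
    case False
    have tr: "b (i + 1) + a (i + 1) + a i \<le> 1" "b (i + 1) + b i + a i \<le> 1" for i
      using t unfolding triangle_def by auto
    \<comment> \<open>Otherwise the triangle relation gives \<open>b 1 = 0\<close>, and
      \<open>a 1\<close> lies below every \<open>b\<close>. Both neighbours of the new entry
      \<open>a 0 = 1\<close> must be empty.\<close>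
    have a1: "a 1 = 0"
    proof (rule ccontr)
      assume "a 1 \<noteq> 0"
      then have "b 1 = 0" using tr(1)[of 0] by simp
      then have "\<forall>s\<le>1. b s = 0" using C(3) by (metis less_le)
      then show False using False \<open>a 1 \<noteq> 0\<close> unfolding ab lowest_a_def by blast
    qed
    let ?a = "a(0 := 1)" and ?b = "b(1 := 0)"
    have "triangle ?a ?b"
      unfolding triangle_def
    proof
      fix i
      show "?b (i + 1) + ?a (i + 1) + ?a i \<le> 1 \<and> ?b (i + 1) + ?b i + ?a i \<le> 1"
        using tr[of i] a1 C(2)[of i] C(3)[of i] C(3)[of 0] by auto
    qed
    moreover have "rightnb ?a ?b"
      unfolding rightnb_def
    proof (intro allI impI)
      fix i assume "?b i \<noteq> 0"
      then have "b i \<noteq> 0" by (auto split: if_splits)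
      then obtain j where "j > i" "a j \<noteq> 0" "\<forall>s. i + 1 \<le> s \<and> s \<le> j \<longrightarrow> b s = 0"
        using r unfolding rightnb_def by blast
      then show "\<exists>j>i. ?a j \<noteq> 0 \<and> (\<forall>s. i + 1 \<le> s \<and> s \<le> j \<longrightarrow> ?b s = 0)"
        by (intro exI[of _ j]) auto
    qed
    moreover have "\<exists>j. ?a j \<noteq> 0 \<and> (\<forall>s\<le>j. ?b s = 0)"
      using C by (intro exI[of _ 0]) auto
    moreover have "to_C1 ab = (?a, ?b)" using False by (simp add: to_C1_def ab)
    moreover have "\<forall>i. i < 0 \<or> N < i \<longrightarrow> ?a i = 0" using C N by auto
    moreover have "\<forall>i. i < 1 \<or> N < i \<longrightarrow> ?b i = 0" using C by auto
    moreover have "\<forall>i. ?a i \<le> 1 \<and> ?b i \<le> 1" using C by auto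
    ultimately show ?thesis unfolding C1_def by (simp only: mem_Collect_eq case_prod_conv simp_thms)
  qed
qed

text \<open>If \<open>b 1\<close> was deleted, its right neighbour is now the lowest entry above the origin;
  this recovers \<open>b 1\<close>.\<close>

lemma inj_on_to_C1: "inj_on to_C1 (C0 N)"
proof (rule inj_onI)
  fix x y assume xy: "x \<in> C0 N" "y \<in> C0 N" and eq: "to_C1 x = to_C1 y"
  obtain a b c d where p: "x = (a, b)" "y = (c, d)" by (cases x, cases y) blast
  have z: "a 0 = 0" "c 0 = 0" using xy by (auto simp: C0_def p)
  have deleted: "d 1 = 0" if "(a, b) \<in> C0 N" "\<not> lowest_a (a, b)" and cd: "(c, d) \<in> C0 N" and "\<not> lowest_a (c, d)"
    "a = c" "\<And>i. i \<noteq> 1 \<Longrightarrow> b i = d i" "b 1 = 0" for a b c d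
  proof (rule ccontr)
    assume "d 1 \<noteq> 0"
    then obtain j where j: "j > 1" "c j \<noteq> 0" "\<forall>s. 1 + 1 \<le> s \<and> s \<le> j \<longrightarrow> d s = 0"
      using cd unfolding C0_def rightnb_def by blast
    have "b s = 0" if "s \<le> j" for s
    proof -
      consider "s < 1" | "s = 1" | "s \<ge> 2" by linarith
      then show ?thesis
        using \<open>(a, b) \<in> C0 N\<close> \<open>b 1 = 0\<close> j that \<open>\<And>i. i \<noteq> 1 \<Longrightarrow> b i = d i\<close>[of s] by cases (auto simp: C0_def)
    qed
    then show False using \<open>\<not> lowest_a (a, b)\<close> j \<open>a = c\<close> unfolding lowest_a_def by blast
  qed
  show "x = y"
  proof (cases "lowest_a x"; cases "lowest_a y")
    assume n: "\<not> lowest_a x" "\<not> lowest_a y"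
    then have ab: "a(0 := 1) = c(0 := 1)" "b(1 := 0) = d(1 := 0)" using eq by (auto simp: to_C1_def p)
    have "a i = c i" for i using fun_cong[OF ab(1), of i] z by (cases "i = 0") auto
    then have ac: "a = c" by (rule ext)
    have bd: "b i = d i" if "i \<noteq> 1" for i using fun_cong[OF ab(2), of i] that by simp
    have "b i \<le> 1 \<and> d i \<le> 1" for i using xy by (auto simp: C0_def p)
    moreover have "b 1 = 0 \<longleftrightarrow> d 1 = 0"
    proof
      assume "b 1 = 0"
      show "d 1 = 0" by (rule deleted[OF xy(1)[unfolded p] n(1)[unfolded p] xy(2)[unfolded p] n(2)[unfolded p] ac bd \<open>b 1 = 0\<close>])
    next
      assume "d 1 = 0"
      show "b 1 = 0"
        by (rule deleted[OF xy(2)[unfolded p] n(2)[unfolded p] xy(1)[unfolded p] n(1)[unfolded p] ac[symmetric] bd[symmetric] \<open>d 1 = 0\<close>])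
    qed
    ultimately have "b 1 = d 1" by (metis One_nat_def le_SucE le_zero_eq)
    then have "b i = d i" for i using bd by (cases "i = 1") auto
    then have "b = d" by (rule ext)
    then show ?thesis using ac p by simp
  next
    assume "lowest_a x" "\<not> lowest_a y"
    then have "a = c(0 := 1)" using eq by (auto simp: to_C1_def p)
    then show ?thesis using z by simp
  next
    assume "\<not> lowest_a x" "lowest_a y"
    then have "c = a(0 := 1)" using eq by (auto simp: to_C1_def p)
    then show ?thesis using z by simp
  next
    assume "lowest_a x" "lowest_a y"
    then show ?thesis using eq by (auto simp: to_C1_def p)
  qed
qed

lemma C1_large: "\<exists>S\<subseteq>C1 (int n). finite S \<and> card S = 2 ^ n"
proof -
  obtain S where S: "S \<subseteq> C0 (int n + 1)" "finite S" "card S = 2 ^ n" using C0_large by blast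
  have "card (to_C1 ` S) = 2 ^ n"
    using card_image[OF inj_on_subset[OF inj_on_to_C1 S(1)]] S(3) by simp
  then show ?thesis using S to_C1_C1[of "int n"] by (intro exI[of _ "to_C1 ` S"]) auto
qed

lemma Cset_large:
  assumes "M \<in> {-1, 0, 1}" "M + N \<ge> 1"
  shows "\<exists>S\<subseteq>Cset M N. finite S \<and> card S = 2 ^ nat (M + N - 1)"
proof -
  from assms(1) consider "M = -1" | "M = 0" | "M = 1" by blast
  then show ?thesis
  proof cases
    case 1
    then have "int (nat (N - 2)) = N - 2" "nat (M + N - 1) = nat (N - 2)" using assms(2) by auto
    then show ?thesis using C1_large[of "nat (N - 2)"] 1 by (simp add: Cset_def)
  next
    case 2
    then have "int (nat (N - 1)) + 1 = N" "nat (M + N - 1) = nat (N - 1)" using assms(2) by auto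
    then show ?thesis using C0_large[of "nat (N - 1)"] 2 by (simp add: Cset_def)
  next
    case 3
    then have "int (nat N) = N" "nat (M + N - 1) = nat N" using assms(2) by auto
    then show ?thesis using C1_large[of "nat N"] 3 by (simp add: Cset_def)
  qed
qed

section \<open>Free fermions\<close>

type_synonym fock = "int set \<Rightarrow> complex"

text \<open>A state is a set of occupied sites of the infinite wedge, site \<open>3 k + c\<close> being the \<open>k\<close>-th
  mode of the fermion of colour \<open>c\<close> in \<open>{1, 2, 3}\<close>. The sign vanishes on sets unbounded above, so
  that distinct modes anticommute without side conditions.\<close>

definition sg :: "int \<Rightarrow> int set \<Rightarrow> complex" where
  "sg a S = (if bdd_above S then (-1) ^ card {x \<in> S. a < x} else 0)"

text \<open>Operators act on coefficient functions, and \<open>S\<close> is the resulting state.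
  Creation therefore demands \<open>a \<in> S\<close> and reads \<open>F\<close> at the state
  without \<open>a\<close>; for the annihilator \<open>psis\<close> it is the reverse.\<close>

definition psi :: "int \<Rightarrow> fock \<Rightarrow> fock" where
  "psi a F S = (if a \<in> S then sg a S * F (S - {a}) else 0)"

definition psis :: "int \<Rightarrow> fock \<Rightarrow> fock" where
  "psis a F S = (if a \<notin> S then sg a S * F (insert a S) else 0)"

lemma finite_above: "bdd_above S \<Longrightarrow> finite {x \<in> S. a < x}" for a :: int
proof -
  assume "bdd_above S"
  then obtain U where "\<And>x. x \<in> S \<Longrightarrow> x \<le> U" by (auto simp: bdd_above_def)
  then have "{x \<in> S. a < x} \<subseteq> {a..U}" by auto
  then show ?thesis by (rule finite_subset) simp
qed

lemma bdd_above_remove [simp]: "bdd_above (S - {b}) \<longleftrightarrow> bdd_above S" for b :: int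
  by (metis bdd_above_insert insert_Diff_single)

lemma sg_insert: "b \<notin> S \<Longrightarrow> sg a (insert b S) = (if a < b then - sg a S else sg a S)"
proof (cases "bdd_above S \<and> a < b")
  case True
  moreover assume "b \<notin> S"
  moreover from True have "{x \<in> insert b S. a < x} = insert b {x \<in> S. a < x}" by auto
  ultimately show ?thesis using finite_above[of S a] by (simp add: sg_def)
next
  case False
  then have "bdd_above S \<Longrightarrow> {x \<in> insert b S. a < x} = {x \<in> S. a < x}" by auto
  then show ?thesis using False by (auto simp: sg_def)
qed

lemma sg_remove: "b \<in> S \<Longrightarrow> sg a (S - {b}) = (if a < b then - sg a S else sg a S)"
  using sg_insert[of b "S - {b}" a] by (simp add: insert_absorb split: if_splits)

lemma sg_square: "bdd_above S \<Longrightarrow> sg a S * sg a S = 1"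
  by (simp add: sg_def flip: power_mult_distrib)

lemma sg_nonzero: "bdd_above S \<Longrightarrow> sg a S \<noteq> 0"
  by (simp add: sg_def)

lemma psi_psi: "psi a (psi b F) = - psi b (psi a F)"
proof
  fix S
  have "S - {a} - {b} = S - {b} - {a}" by auto
  then show "psi a (psi b F) S = (- psi b (psi a F)) S"
    by (auto simp: psi_def sg_remove)
qed

lemma psis_psis: "psis a (psis b F) = - psis b (psis a F)"
proof
  fix S
  have "insert a (insert b S) = insert b (insert a S)" by auto
  then show "psis a (psis b F) S = (- psis b (psis a F)) S"
    by (auto simp: psis_def sg_insert)
qed

lemma psi_psis: "a \<noteq> b \<Longrightarrow> psi a (psis b F) = - psis b (psi a F)"
proof
  fix S assume "a \<noteq> b"
  then have "insert b (S - {a}) = insert b S - {a}" by auto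
  then show "psi a (psis b F) S = (- psis b (psi a F)) S"
    using \<open>a \<noteq> b\<close> by (auto simp: psis_def psi_def sg_insert sg_remove)
qed

lemma psi_psis_same: "bdd_above S \<Longrightarrow> psis b (psi b G) S + psi b (psis b G) S = G S"
proof (cases "b \<in> S")
  case True
  assume "bdd_above S"
  then show ?thesis using True sg_square[of S b]
    by (simp add: psi_def psis_def sg_remove insert_absorb flip: mult.assoc)
next
  case False
  assume "bdd_above S"
  then show ?thesis using False sg_square[of S b]
    by (simp add: psi_def psis_def sg_insert flip: mult.assoc)
qed

lemma psi_linear:
  "psi a (F + G) = psi a F + psi a G" "psi a (sc c F) = sc c (psi a F)" "psi a (- F) = - psi a F"
  "psis a (F + G) = psis a F + psis a G" "psis a (sc c F) = sc c (psis a F)" "psis a (- F) = - psis a F"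
  by (auto simp: psi_def psis_def fun_eq_iff sc_def pointwise algebra_simps)

definition hop :: "int \<Rightarrow> int \<Rightarrow> fock \<Rightarrow> fock" where
  "hop a b F = psi a (psis b F)"

lemma hop_eval:
  "a \<noteq> b \<Longrightarrow> hop a b F S = (if a \<in> S \<and> b \<notin> S then sg a S * sg b (S - {a}) * F (insert b (S - {a})) else 0)"
  by (auto simp: hop_def psi_def psis_def)

lemma hop_linear: "hop a b (F + G) = hop a b F + hop a b G" "hop a b (sc c F) = sc c (hop a b F)"
  by (simp_all add: hop_def psi_linear)

lemma hop_commute:
  assumes "a \<noteq> b'" "b \<noteq> a'" shows "hop a b (hop a' b' F) = hop a' b' (hop a b F)"
proof -
  have "psi a (psis b (psi a' (psis b' F))) = - psi a (psi a' (psis b (psis b' F)))"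
    using psi_psis[of a' b "psis b' F"] assms by (simp add: psi_linear)
  also have "\<dots> = psi a' (psi a (psis b (psis b' F)))"
    using psi_psi[of a a'] by simp
  also have "\<dots> = - psi a' (psi a (psis b' (psis b F)))"
    using psis_psis[of b b' F] by (simp add: psi_linear)
  also have "\<dots> = psi a' (psis b' (psi a (psis b F)))"
    using psi_psis[of a b' "psis b F"] assms by (simp add: psi_linear)
  finally show ?thesis by (simp add: hop_def)
qed

text \<open>Anticommuting brings both products to the form \<open>psi a\<close>, then
  \<open>psi b\<close> and \<open>psis b\<close> in one of the two orders, then
  \<open>psis d\<close>; the two orders add up to 1. At a state unbounded above the outer
  \<open>psi a\<close> gives zero on both sides.\<close>

lemma hop_contract:
  assumes "a \<noteq> b" "b \<noteq> d" "a \<noteq> d"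
  shows "hop a b (hop b d F) S - hop b d (hop a b F) S = hop a d F S"
proof -
  have "psi b (psis d (psi a (psis b F))) = - psi b (psi a (psis d (psis b F)))"
    using psi_psis[of a d "psis b F"] assms by (simp add: psi_linear)
  also have "\<dots> = psi a (psi b (psis d (psis b F)))" using psi_psi[of b a] by simp
  also have "\<dots> = - psi a (psi b (psis b (psis d F)))"
    using psis_psis[of d b F] by (simp add: psi_linear)
  finally have 1: "hop b d (hop a b F) = - psi a (psi b (psis b (psis d F)))" by (simp add: hop_def)
  have "psi a (psis b (psi b (psis d F)) + psi b (psis b (psis d F))) S = psi a (psis d F) S"
  proof (cases "bdd_above S")
    case True
    then have "bdd_above (S - {a})" by simp
    then show ?thesis unfolding psi_def[of a] by (simp add: pointwise psi_psis_same)
  next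
    case False
    then show ?thesis by (simp add: psi_def sg_def)
  qed
  then show ?thesis by (simp add: hop_def 1[unfolded hop_def] psi_linear pointwise)
qed

section \<open>Good states and fermion currents\<close>

definition good :: "int set \<Rightarrow> bool" where
  "good S \<longleftrightarrow> (\<exists>L U. {..L} \<subseteq> S \<and> S \<subseteq> {..U})"

lemma good_hop:
  assumes "good S" shows "good (insert b (S - {a}))"
proof -
  obtain L U where "{..L} \<subseteq> S" "S \<subseteq> {..U}" using assms by (auto simp: good_def)
  then have "{..min L (a - 1)} \<subseteq> insert b (S - {a})" "insert b (S - {a}) \<subseteq> {..max U b}" by auto
  then show ?thesis unfolding good_def by blast
qed

lemma good_bdd: "good S \<Longrightarrow> bdd_above S"
  by (auto simp: good_def intro: bdd_above_mono)

definition site :: "int \<Rightarrow> int \<Rightarrow> int" where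
  "site c k = 3 * k + c"

definition col :: "int \<Rightarrow> bool" where "col c \<longleftrightarrow> c \<in> {1, 2, 3}"

lemma col_simps [simp]: "col 1" "col 2" "col 3"
  by (auto simp: col_def)

lemma site_eq_iff: "col c \<Longrightarrow> col d \<Longrightarrow> site c x = site d y \<longleftrightarrow> c = d \<and> x = y"
  unfolding col_def site_def by (elim insertE emptyE; simp; presburger)

lemma site_eq_simps [simp]:
  "site 1 x = site 2 y \<longleftrightarrow> False" "site 2 x = site 1 y \<longleftrightarrow> False" "site 1 x = site 3 y \<longleftrightarrow> False"
  "site 3 x = site 1 y \<longleftrightarrow> False" "site 2 x = site 3 y \<longleftrightarrow> False" "site 3 x = site 2 y \<longleftrightarrow> False"
  "site c x = site c y \<longleftrightarrow> x = y"
  by (auto simp: site_eq_iff) (simp_all add: site_def)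

lemma col_neq: "col c \<Longrightarrow> col d \<Longrightarrow> c \<noteq> d \<Longrightarrow> site c x \<noteq> site d y"
  by (simp add: site_eq_iff)

text \<open>One mode of the current with creator of colour \<open>c\<close> and annihilator of
  colour \<open>d\<close>. Only hops that can lead to \<open>S\<close> are summed; at a good state
  these are finitely many for every \<open>F\<close>, so no condition on \<open>F\<close>
  arises.\<close>

definition cur :: "int \<Rightarrow> int \<Rightarrow> int \<Rightarrow> fock \<Rightarrow> fock" where
  "cur c d i F S = (\<Sum>k | site c (k + i) \<in> S \<and> site d k \<notin> S. hop (site c (k + i)) (site d k) F S)"

lemma cur_support_bounded:
  assumes "good S"
  shows "\<exists>n. \<forall>k. site c (k + i) \<in> S \<and> site d k \<notin> S \<longrightarrow> \<bar>k\<bar> \<le> n"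
proof -
  obtain L U where LU: "{..L} \<subseteq> S" "S \<subseteq> {..U}" using assms by (auto simp: good_def)
  have "\<bar>k\<bar> \<le> \<bar>U - c - 3 * i\<bar> + \<bar>L - d\<bar>" if "site c (k + i) \<in> S" "site d k \<notin> S" for k
  proof -
    have "site c (k + i) \<le> U" using LU that by auto
    moreover have "L < site d k" using LU that by (meson atMost_iff not_le subsetD)
    ultimately have "3 * k \<le> U - c - 3 * i" "L - d < 3 * k" by (simp_all add: site_def)
    moreover have "\<bar>k\<bar> \<le> \<bar>x\<bar> + \<bar>y\<bar>" if "3 * k \<le> x" "y < 3 * k" for x y
      using that by linarith
    ultimately show ?thesis by blast
  qed
  then show ?thesis by blast
qed

text \<open>The window depends on the state but not on \<open>F\<close>, so it stays valid when
  \<open>F\<close> is itself the result of another current.\<close>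

lemma cur_window:
  assumes "good S" "col c" "col d" "c \<noteq> d"
  shows "\<forall>\<^sub>F n in at_top. \<forall>F. cur c d i F S = (\<Sum>k\<in>{-n..n}. hop (site c (k + i)) (site d k) F S)"
proof -
  obtain N where N: "\<And>k. site c (k + i) \<in> S \<Longrightarrow> site d k \<notin> S \<Longrightarrow> \<bar>k\<bar> \<le> N"
    using cur_support_bounded[OF assms(1), of c i d] by blast
  have "cur c d i F S = (\<Sum>k\<in>{-n..n}. hop (site c (k + i)) (site d k) F S)" if "n \<ge> N" for n F
    unfolding cur_def
  proof (rule sum.mono_neutral_left)
    show "{k. site c (k + i) \<in> S \<and> site d k \<notin> S} \<subseteq> {-n..n}" using N that by fastforce
    show "\<forall>k\<in>{-n..n} - {k. site c (k + i) \<in> S \<and> site d k \<notin> S}. hop (site c (k + i)) (site d k) F S = 0"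
      using col_neq[OF assms(2-4)] by (auto simp: hop_eval)
  qed simp
  then show ?thesis unfolding eventually_at_top_linorder by blast
qed

text \<open>The outer current involves only finitely many intermediate states \<open>?T k\<close>,
  each with its own window for the inner one; a common window turns the product into a finite double
  sum.\<close>

lemma cur_cur_window:
  assumes "good S" "col c" "col d" "c \<noteq> d" "col c'" "col d'" "c' \<noteq> d'"
  shows "\<forall>\<^sub>F n in at_top. cur c d i (cur c' d' j F) S
    = (\<Sum>k\<in>{-n..n}. \<Sum>l\<in>{-n..n}. hop (site c (k + i)) (site d k) (hop (site c' (l + j)) (site d' l) F) S)"
proof -
  let ?K = "{k. site c (k + i) \<in> S \<and> site d k \<notin> S}"
  let ?T = "\<lambda>k. insert (site d k) (S - {site c (k + i)})"
  obtain N where "\<And>k. site c (k + i) \<in> S \<Longrightarrow> site d k \<notin> S \<Longrightarrow> \<bar>k\<bar> \<le> N"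
    using cur_support_bounded[OF assms(1), of c i d] by blast
  then have "?K \<subseteq> {-N..N}" by fastforce
  then have fin: "finite ?K" by (rule finite_subset) simp
  have "\<forall>k\<in>?K. \<forall>\<^sub>F n in at_top. \<forall>F. cur c' d' j F (?T k) = (\<Sum>l\<in>{-n..n}. hop (site c' (l + j)) (site d' l) F (?T k))"
    using good_hop[OF assms(1)] assms by (intro ballI cur_window) auto
  then have "\<forall>\<^sub>F n in at_top. \<forall>k\<in>?K. \<forall>F. cur c' d' j F (?T k) = (\<Sum>l\<in>{-n..n}. hop (site c' (l + j)) (site d' l) F (?T k))"
    by (rule eventually_ball_finite[OF fin])
  with cur_window[OF assms(1-4), of i] show ?thesis
  proof eventually_elim
    case (elim n)
    have "cur c d i (cur c' d' j F) S = (\<Sum>k\<in>{-n..n}. hop (site c (k + i)) (site d k) (cur c' d' j F) S)"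
      using elim(1) by blast
    also have "\<dots> = (\<Sum>k\<in>{-n..n}. \<Sum>l\<in>{-n..n}. hop (site c (k + i)) (site d k) (hop (site c' (l + j)) (site d' l) F) S)"
    proof (rule sum.cong[OF refl])
      fix k
      show "hop (site c (k + i)) (site d k) (cur c' d' j F) S
        = (\<Sum>l\<in>{-n..n}. hop (site c (k + i)) (site d k) (hop (site c' (l + j)) (site d' l) F) S)"
      proof (cases "k \<in> ?K")
        case True
        then show ?thesis using elim(2) col_neq[OF assms(2-4)] by (simp add: hop_eval sum_distrib_left)
      next
        case False
        then show ?thesis using col_neq[OF assms(2-4)] by (auto simp: hop_eval)
      qed
    qed
    finally show ?case .
  qed
qed

lemma cur_commute:
  assumes "good S" "col c" "col d" "c \<noteq> d" "col c'" "col d'" "c' \<noteq> d'" "c \<noteq> d'" "d \<noteq> c'"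
  shows "cur c d i (cur c' d' j F) S = cur c' d' j (cur c d i F) S"
proof -
  have "\<forall>\<^sub>F n :: int in at_top. cur c d i (cur c' d' j F) S = cur c' d' j (cur c d i F) S"
    using cur_cur_window[OF assms(1-7), of i j F] cur_cur_window[OF assms(1,5-7,2-4), of j i F]
  proof eventually_elim
    case (elim n)
    have "hop (site c (k + i)) (site d k) (hop (site c' (l + j)) (site d' l) F)
      = hop (site c' (l + j)) (site d' l) (hop (site c (k + i)) (site d k) F)" for k l
      using assms by (intro hop_commute col_neq)
    then show ?case unfolding elim by (subst sum.swap) simp
  qed
  then show ?thesis by simp
qed

text \<open>Two hops contract exactly when the mode \<open>k\<close> of colour 2 that one
  annihilates is the mode \<open>l + j\<close> that the other creates. Colours 1 and 3 differ, so no
  second contraction and hence no central term appears.\<close>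

lemma cur_EF:
  assumes "good S"
  shows "cur 1 2 i (cur 2 3 j F) S - cur 2 3 j (cur 1 2 i F) S = cur 1 3 (i + j) F S"
proof -
  have col: "col 1" "col 2" "col 3" and ne: "(1::int) \<noteq> 2" "(2::int) \<noteq> 3" "(1::int) \<noteq> 3" by auto
  obtain N where N: "\<And>k. site 1 (k + (i + j)) \<in> S \<Longrightarrow> site 3 k \<notin> S \<Longrightarrow> \<bar>k\<bar> \<le> N"
    using cur_support_bounded[OF assms, of 1 "i + j" 3] by blast
  have "\<forall>\<^sub>F n :: int in at_top. cur 1 2 i (cur 2 3 j F) S - cur 2 3 j (cur 1 2 i F) S = cur 1 3 (i + j) F S"
    using cur_cur_window[OF assms col(1,2) ne(1) col(2,3) ne(2), of i j F]
      cur_cur_window[OF assms col(2,3) ne(2) col(1,2) ne(1), of j i F]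
      cur_window[OF assms col(1,3) ne(3), of "i + j"] eventually_ge_at_top[of "N + \<bar>j\<bar>"]
  proof eventually_elim
    case (elim n)
    let ?e = "\<lambda>k. hop (site 1 (k + i)) (site 2 k)" and ?f = "\<lambda>l. hop (site 2 (l + j)) (site 3 l)"
    let ?h = "\<lambda>l. hop (site 1 (l + (i + j))) (site 3 l) F S"
    have br: "?e k (?f l F) S - ?f l (?e k F) S = (if k = l + j then ?h l else 0)" for k l
    proof (cases "k = l + j")
      case True
      have "site 1 (k + i) = site 1 (l + (i + j))" using True by (simp add: algebra_simps)
      then show ?thesis using hop_contract[of "site 1 (k + i)" "site 2 k" "site 3 l" F S] True
          col_neq[OF col(1,2)] col_neq[OF col(1,3)] col_neq[OF col(2,3)] by (simp add: add.commute add.left_commute)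
    next
      case False
      then have "?e k (?f l F) = ?f l (?e k F)"
        using col_neq[OF col(1,3)] by (intro hop_commute) auto
      then show ?thesis using False by simp
    qed
    have "cur 1 2 i (cur 2 3 j F) S - cur 2 3 j (cur 1 2 i F) S
      = (\<Sum>l\<in>{-n..n}. \<Sum>k\<in>{-n..n}. ?e k (?f l F) S) - (\<Sum>l\<in>{-n..n}. \<Sum>k\<in>{-n..n}. ?f l (?e k F) S)"
      using elim(1,2) by (subst sum.swap) simp
    also have "\<dots> = (\<Sum>l\<in>{-n..n}. \<Sum>k\<in>{-n..n}. if k = l + j then ?h l else 0)"
      by (simp add: br flip: sum_subtractf)
    also have "\<dots> = (\<Sum>l\<in>{-n..n}. ?h l)"
    proof (rule sum.cong[OF refl])
      fix l assume "l \<in> {-n..n}"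
      show "(\<Sum>k\<in>{-n..n}. if k = l + j then ?h l else 0) = ?h l"
      proof (cases "l + j \<in> {-n..n}")
        case False
        \<comment> \<open>If the partner \<open>l + j\<close> falls outside the window, then
          \<open>n >= N + |j|\<close> forces \<open>|l| > N\<close>, where the summand of the
          contracted current vanishes anyway.\<close>
        then have "\<not> \<bar>l\<bar> \<le> N" using elim(4) by auto
        then have "?h l = 0" using N[of l] col_neq[OF col(1,3)] by (auto simp: hop_eval)
        then show ?thesis by simp
      qed simp
    qed
    also have "\<dots> = cur 1 3 (i + j) F S" using elim(3) by simp
    finally show ?case .
  qed
  then show ?thesis by simp
qed

text \<open>Up to sign the product is two creators followed by two annihilators, so exchanging the
  created modes reverses its sign; the next lemma does the same for the annihilated modes.\<close>

lemma hop_hop_antisym: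
  assumes "a \<noteq> b" "a' \<noteq> b"
  shows "hop a b (hop a' b' F) = - hop a' b (hop a b' F)"
proof -
  have "psi a (psis b (psi a' (psis b' F))) = - psi a (psi a' (psis b (psis b' F)))"
    using psi_psis[of a' b "psis b' F"] assms by (simp add: psi_linear)
  also have "\<dots> = psi a' (psi a (psis b (psis b' F)))" using psi_psi[of a a'] by simp
  also have "\<dots> = - psi a' (psis b (psi a (psis b' F)))"
    using psi_psis[of a b "psis b' F"] assms by (simp add: psi_linear)
  finally show ?thesis by (simp add: hop_def)
qed

lemma hop_hop_antisym':
  assumes "a' \<noteq> b" "a' \<noteq> b'"
  shows "hop a b (hop a' b' F) = - hop a b' (hop a' b F)"
proof -
  have "psi a (psis b (psi a' (psis b' F))) = - psi a (psi a' (psis b (psis b' F)))"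
    using psi_psis[of a' b "psis b' F"] assms by (simp add: psi_linear)
  also have "\<dots> = psi a (psi a' (psis b' (psis b F)))" using psis_psis[of b b' F] by (simp add: psi_linear)
  also have "\<dots> = - psi a (psis b' (psi a' (psis b F)))"
    using psi_psis[of a' b' "psis b F"] assms by (simp add: psi_linear)
  finally show ?thesis by (simp add: hop_def)
qed

text \<open>The occupied sites are bounded above and the empty ones below, and \<open>p + q = k + l + n\<close>; hence
  all four modes are bounded, and exchanging two modes of equal colour reverses the sign.\<close>

lemma cur_product_coefficient_zero:
  assumes S: "good S" and cd: "col c" "col d" "c \<noteq> d" "col c'" "col d'" "c' \<noteq> d'" "c \<noteq> d'" "d \<noteq> c'"
    and eq: "c = c' \<or> d = d'"
  shows "\<exists>K0. \<forall>K\<ge>K0. (\<Sum>i\<in>{-K..K}. cur c d i (cur c' d' (n - i) F) S) = 0"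
proof -
  define Q where "Q p q k l = hop (site c p) (site d k) (hop (site c' q) (site d' l) F) S" for p q k l
  obtain L U where LU: "{..L} \<subseteq> S" "S \<subseteq> {..U}" using S by (auto simp: good_def)
  have occ: "3 * p \<le> U" if "site c p \<in> S" "col c" for c p
  proof -
    have "site c p \<le> U" using LU that by auto
    then show ?thesis using that(2) by (auto simp: site_def col_def)
  qed
  have emp: "L - 3 < 3 * k" if "site d k \<notin> S" "col d" for d k
  proof -
    have "L < site d k" using LU that by (meson atMost_iff not_le subsetD)
    then show ?thesis using that(2) by (auto simp: site_def col_def)
  qed
  \<comment> \<open>The colour conditions keep either hop from creating what the other annihilates,
    so a nonzero value imposes all four conditions on \<open>S\<close> itself.\<close>
  have Q0: "3 * p \<le> U \<and> 3 * q \<le> U \<and> L - 3 < 3 * k \<and> L - 3 < 3 * l" if "Q p q k l \<noteq> 0" for p q k l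
  proof -
    have n1: "site c p \<noteq> site d k" and n2: "site c' q \<noteq> site d' l"
      and n3: "site c' q \<noteq> site d k" and n4: "site d' l \<noteq> site c p"
      using cd by (simp_all add: site_eq_iff)
    have "site c p \<in> S \<and> site d k \<notin> S \<and> site c' q \<in> S \<and> site d' l \<notin> S"
      using that n1 n2 n3 n4 unfolding Q_def by (auto simp: hop_eval split: if_splits)
    then show ?thesis using occ emp cd by blast
  qed
  \<comment> \<open>\<open>p\<close> and \<open>q\<close> are at most \<open>B\<close>,
    \<open>k\<close> and \<open>l\<close> at least \<open>- B\<close>; solving
    \<open>p + q = k + l + n\<close> for any one of them bounds it by \<open>4 * B\<close> in
    absolute value.\<close>
  define B where "B = \<bar>U\<bar> + \<bar>L\<bar> + \<bar>n\<bar> + 3"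
  define Box where "Box = {(p, q, k, l). p \<in> {-4*B..4*B} \<and> q \<in> {-4*B..4*B} \<and> k \<in> {-4*B..4*B} \<and> l \<in> {-4*B..4*B} \<and> p + q = k + l + n}"
  have Bd: "(p, q, k, l) \<in> Box" if "Q p q k l \<noteq> 0" "p + q = k + l + n" for p q k l
  proof -
    have b: "U \<le> B - 3" "- B + 3 \<le> L" "n \<le> B - 3" "- B + 3 \<le> n" unfolding B_def by linarith+
    have "3 * p \<le> U" "3 * q \<le> U" "L - 3 < 3 * k" "L - 3 < 3 * l" using Q0[OF that(1)] by auto
    then have "p \<le> B" "q \<le> B" "- B \<le> k" "- B \<le> l" using b by linarith+
    moreover from this have "- 4 * B \<le> p" "- 4 * B \<le> q" "k \<le> 4 * B" "l \<le> 4 * B" using that(2) b by linarith+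
    moreover have "0 \<le> B" unfolding B_def by simp
    ultimately show ?thesis using that(2) unfolding Box_def by simp
  qed
  have "finite ({-4*B..4*B} \<times> {-4*B..4*B} \<times> {-4*B..4*B} \<times> {-4*B..4*B})" by blast
  then have finBox: "finite Box" by (rule rev_finite_subset) (auto simp: Box_def)
  have ne: "site c p \<noteq> site d k" "site c' p \<noteq> site d k" "site c' p \<noteq> site d' k" for p k
    using cd by (simp_all add: site_eq_iff)
  have "(\<Sum>(p, q, k, l)\<in>Box. Q p q k l) = (\<Sum>(p, q, k, l)\<in>Box. - Q p q k l)"
    using eq
  proof
    assume "c = c'"
    have "- Q q p k l = Q p q k l" for p q k l
      unfolding Q_def \<open>c = c'\<close>[symmetric]
      by (subst hop_hop_antisym[OF ne(1)[of p k] ne(1)[of q k]]) simp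
    then show ?thesis
      by (intro sum.reindex_bij_witness[of _ "\<lambda>(p, q, k, l). (q, p, k, l)" "\<lambda>(p, q, k, l). (q, p, k, l)"])
        (auto simp: Box_def)
  next
    assume "d = d'"
    have "- Q p q l k = Q p q k l" for p q k l
      unfolding Q_def \<open>d = d'\<close>[symmetric]
      by (subst hop_hop_antisym'[OF ne(2)[of q k] ne(2)[of q l]]) simp
    then show ?thesis
      by (intro sum.reindex_bij_witness[of _ "\<lambda>(p, q, k, l). (p, q, l, k)" "\<lambda>(p, q, k, l). (p, q, l, k)"])
        (auto simp: Box_def)
  qed
  also have "\<dots> = - (\<Sum>(p, q, k, l)\<in>Box. Q p q k l)" by (simp add: case_prod_unfold sum_negf)
  finally have zero: "(\<Sum>(p, q, k, l)\<in>Box. Q p q k l) = 0" by simp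
  \<comment> \<open>The summation index is \<open>i = p - k\<close>, a difference of two modes
    bounded by \<open>4 * B\<close>.\<close>
  have "(\<Sum>i\<in>{-K..K}. cur c d i (cur c' d' (n - i) F) S) = 0" if K: "K \<ge> 8 * B" for K
  proof -
    have "\<forall>\<^sub>F m in at_top. \<forall>i\<in>{-K..K}. cur c d i (cur c' d' (n - i) F) S
        = (\<Sum>k\<in>{-m..m}. \<Sum>l\<in>{-m..m}. Q (k + i) (l + (n - i)) k l)"
      unfolding Q_def
      by (rule eventually_ball_finite) (use S cd in \<open>auto intro: cur_cur_window\<close>)
    then have "\<forall>\<^sub>F m :: int in at_top. (\<Sum>i\<in>{-K..K}. cur c d i (cur c' d' (n - i) F) S) = 0"
      using eventually_ge_at_top[of "4 * B"]
    proof eventually_elim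
      case (elim m)
      let ?X = "{-K..K} \<times> {-m..m} \<times> {-m..m}"
      let ?j = "\<lambda>(i, k, l). (k + i, l + (n - i), k, l)"
      have "(\<Sum>i\<in>{-K..K}. cur c d i (cur c' d' (n - i) F) S)
        = (\<Sum>i\<in>{-K..K}. \<Sum>k\<in>{-m..m}. \<Sum>l\<in>{-m..m}. Q (k + i) (l + (n - i)) k l)"
        using elim(1) by (intro sum.cong) auto
      also have "\<dots> = (\<Sum>(i, k, l)\<in>?X. Q (k + i) (l + (n - i)) k l)"
        by (simp add: sum.cartesian_product)
      also have "\<dots> = (\<Sum>(p, q, k, l)\<in>Box. Q p q k l)"
      proof (rule sum.reindex_bij_witness_not_neutral[of "{x \<in> ?X. ?j x \<notin> Box}" "{}" _ "\<lambda>(p, q, k, l). (p - k, k, l)" ?j])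
        show "finite {x \<in> ?X. ?j x \<notin> Box}" by (rule finite_subset[of _ ?X]) auto
        fix x assume "x \<in> {x \<in> ?X. ?j x \<notin> Box}"
        then show "(case x of (i, k, l) \<Rightarrow> Q (k + i) (l + (n - i)) k l) = 0"
          using Bd[of "fst (snd x) + fst x" "snd (snd x) + (n - fst x)" "fst (snd x)" "snd (snd x)"]
          by (auto simp: case_prod_unfold)
      next
        fix y assume y: "y \<in> Box - {}"
        obtain p q k l where y': "y = (p, q, k, l)" by (cases y) auto
        have "l + (n - (p - k)) = q" using y by (simp add: y' Box_def)
        then show "?j (case y of (p, q, k, l) \<Rightarrow> (p - k, k, l)) = y" by (simp add: y')
        show "(case y of (p, q, k, l) \<Rightarrow> (p - k, k, l)) \<in> ?X - {x \<in> ?X. ?j x \<notin> Box}"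
          using y elim(2) K \<open>l + (n - (p - k)) = q\<close> by (auto simp: y' Box_def)
      qed auto
      also have "\<dots> = 0" by (rule zero)
      finally show ?case .
    qed
    then show ?thesis by simp
  qed
  then show ?thesis by blast
qed

section \<open>Action of the tensor algebra on Fock space\<close>

fun gen_op :: "gen \<Rightarrow> fock \<Rightarrow> fock" where
  "gen_op (Ee i) = cur 1 2 i"
| "gen_op (Ff i) = cur 2 3 i"
| "gen_op (Hh i) = cur 1 3 i"

fun act :: "gen list \<Rightarrow> fock \<Rightarrow> fock" where
  "act [] F = F"
| "act (g # w) F = gen_op g (act w F)"

definition vac :: fock where
  "vac S = (if S = {..3} then 1 else 0)"

definition Phi :: "(gen list \<Rightarrow> complex) \<Rightarrow> fock" where
  "Phi t S = (\<Sum>w | t w \<noteq> 0. t w * act w vac S)"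

lemma sc_apply: "sc c p w = c * p w"
  by (simp add: sc_def)

lemma cur_linear: "cur c d i (F + G) = cur c d i F + cur c d i G" "cur c d i (sc r F) = sc r (cur c d i F)"
  by (simp_all add: cur_def fun_eq_iff hop_linear pointwise sum.distrib sum_distrib_left sc_apply)

lemma gen_op_linear: "gen_op g (F + G) = gen_op g F + gen_op g G" "gen_op g (sc r F) = sc r (gen_op g F)"
  by (cases g; simp add: cur_linear)+

lemma act_linear: "act w (F + G) = act w F + act w G" "act w (sc r F) = sc r (act w F)"
  by (induct w) (simp_all add: gen_op_linear)

lemma act_zero [simp]: "act w 0 = 0"
  using act_linear(2)[of w 0 0] by simp

lemma act_append: "act (u @ v) F = act u (act v F)"
  by (induct u) simp_all

text \<open>The relations of \<open>U(H)\<close> are available only at good states. A hop relates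
  good states to good states, so agreement there survives the action of further letters.\<close>

lemma cur_cong_good:
  assumes "\<And>T. good T \<Longrightarrow> F T = G T" "good S" "col c" "col d" "c \<noteq> d"
  shows "cur c d i F S = cur c d i G S"
  unfolding cur_def
proof (rule sum.cong[OF refl])
  fix k
  have "F (insert (site d k) (S - {site c (k + i)})) = G (insert (site d k) (S - {site c (k + i)}))"
    by (intro assms(1) good_hop assms(2))
  then show "hop (site c (k + i)) (site d k) F S = hop (site c (k + i)) (site d k) G S"
    by (simp only: hop_eval[OF col_neq[OF assms(3-5)]])
qed

lemma gen_op_cong_good:
  assumes "\<And>T. good T \<Longrightarrow> F T = G T" "good S" shows "gen_op g F S = gen_op g G S"
  by (cases g) (simp_all add: cur_cong_good[of F G, OF assms])

lemma act_cong_good: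
  assumes "\<And>T. good T \<Longrightarrow> F T = G T" "good S" shows "act w F S = act w G S"
  using assms(2)
proof (induct w arbitrary: S)
  case (Cons g w)
  then show ?case using gen_op_cong_good[of "act w F" "act w G" S g] by simp
qed (simp add: assms(1))

lemma Phi_superset:
  assumes "finite W" "{w. t w \<noteq> 0} \<subseteq> W" shows "Phi t S = (\<Sum>w\<in>W. t w * act w vac S)"
  unfolding Phi_def using assms by (intro sum.mono_neutral_left) auto

lemma Phi_add: "fins p \<Longrightarrow> fins q \<Longrightarrow> Phi (p + q) = Phi p + Phi q"
proof
  fix S assume f: "fins p" "fins q"
  let ?W = "{w. p w \<noteq> 0} \<union> {w. q w \<noteq> 0}"
  have W: "finite ?W" using f by (simp add: fins_def)
  have "Phi (p + q) S = (\<Sum>w\<in>?W. (p + q) w * act w vac S)"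
    by (rule Phi_superset[OF W]) (auto simp: pointwise)
  moreover have "Phi p S = (\<Sum>w\<in>?W. p w * act w vac S)" "Phi q S = (\<Sum>w\<in>?W. q w * act w vac S)"
    by (rule Phi_superset[OF W]; auto)+
  ultimately show "Phi (p + q) S = (Phi p + Phi q) S"
    by (simp add: pointwise sum.distrib algebra_simps)
qed

lemma Phi_sc: "fins p \<Longrightarrow> Phi (sc c p) = sc c (Phi p)"
proof
  fix S assume f: "fins p"
  have "Phi (sc c p) S = (\<Sum>w | p w \<noteq> 0. sc c p w * act w vac S)"
    by (rule Phi_superset) (use f in \<open>auto simp: fins_def sc_def\<close>)
  then show "Phi (sc c p) S = sc c (Phi p) S"
    by (simp add: Phi_def sc_apply sum_distrib_left mult.assoc)
qed

lemma Phi_bv [simp]: "Phi (bv w) = act w vac"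
proof
  fix S
  have "{u. bv w u \<noteq> 0} = {w}" by (auto simp: bv_def)
  then show "Phi (bv w) S = act w vac S" unfolding Phi_def by (simp add: bv_def)
qed

lemma Phi_zero [simp]: "Phi 0 = 0"
  by (simp add: Phi_def fun_eq_iff pointwise)

lemma Phi_diff: "fins p \<Longrightarrow> fins q \<Longrightarrow> Phi (p - q) = Phi p - Phi q"
  using Phi_add[of "p - q" q] by simp

lemma Phi_sum: "(\<And>i. i \<in> I \<Longrightarrow> fins (p i)) \<Longrightarrow> Phi (sum p I) = (\<Sum>i\<in>I. Phi (p i))"
  by (induct I rule: infinite_finite_induct) (simp_all add: Phi_add fins_sum)

lemma Phi_tmul_bv: "fins t \<Longrightarrow> Phi (tmul (bv u) t) = act u (Phi t)"
proof (induct t rule: fins_induct)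
  case (bv w)
  then show ?case by (simp add: act_append)
qed (simp_all add: tmul_add tmul_sc Phi_add Phi_sc act_linear)

definition killed :: "int set set \<Rightarrow> (gen list \<Rightarrow> complex) set" where
  "killed X = {t. fins t \<and> (\<forall>S\<in>X. Phi t S = 0)}"

lemma subspace_killed: "fv.subspace (killed X)"
  unfolding fv.subspace_def killed_def
  by (auto simp: Phi_add Phi_sc pointwise sc_apply)

lemma gen_op_commute:
  assumes "good S" "comm x y" shows "gen_op x (gen_op y F) S = gen_op y (gen_op x F) S"
proof -
  have "\<not> comm (Ee i) (Ff j)" "\<not> comm (Ff j) (Ee i)" for i j
    by (auto simp: comm_def fun_eq_iff pointwise)
  then show ?thesis using assms(2)
    by (cases x; cases y) (auto intro!: cur_commute[OF assms(1)])
qed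

lemma gen_op_bracket:
  assumes "good S"
  shows "gen_op x (gen_op y F) S - gen_op y (gen_op x F) S = (\<Sum>g | bbr x y g \<noteq> 0. bbr x y g * gen_op g F S)"
proof (cases "comm x y")
  case True
  then have "\<And>g. bbr x y g = 0" by (simp add: comm_def pointwise)
  then show ?thesis using gen_op_commute[OF assms True] by simp
next
  case False
  then consider i j where "x = Ee i" "y = Ff j" | i j where "x = Ff j" "y = Ee i"
    by (cases x; cases y) auto
  then show ?thesis
  proof cases
    case 1
    have "{g. bbr x y g \<noteq> 0} = {Hh (i + j)}" using 1 by auto
    then show ?thesis using cur_EF[OF assms, of i j F] 1 by simp
  next
    case 2
    have "{g. bbr x y g \<noteq> 0} = {Hh (i + j)}" using 2 by auto
    then show ?thesis using cur_EF[OF assms, of i j F] 2 by (simp add: algebra_simps)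
  qed
qed

lemma Phi_iota_tmul:
  assumes "fins x" "fins t" shows "Phi (tmul (iota x) t) S = (\<Sum>g | x g \<noteq> 0. x g * gen_op g (Phi t) S)"
proof -
  have "tmul (iota x) t = (\<Sum>g | x g \<noteq> 0. sc (x g) (tmul (bv [g]) t))"
    by (simp add: iota_expand[OF assms(1)] tmul_sum tmul_sc)
  then show ?thesis using assms
    by (simp add: Phi_sum Phi_sc Phi_tmul_bv sum_fun_apply sc_apply)
qed

lemma urel_span: "r \<in> urel \<Longrightarrow> r \<in> fv.span (range (\<lambda>(a, b). bv [a, b] - bv [b, a] - iota (bbr a b)))"
proof -
  assume "r \<in> urel"
  then obtain x y where xy: "fins x" "fins y"
    and r: "r = tmul (iota x) (iota y) - tmul (iota y) (iota x) - iota (lbr x y)" by (auto simp: urel_def)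
  let ?A = "{a. x a \<noteq> 0}" and ?B = "{b. y b \<noteq> 0}"
  have lb: "lbr x y = (\<Sum>a\<in>?A. \<Sum>b\<in>?B. sc (x a * y b) (bbr a b))"
    by (simp add: fun_eq_iff lbr_def sum_fun_apply sc_apply)
  have "tmul (iota x) (iota y) = (\<Sum>a\<in>?A. \<Sum>b\<in>?B. sc (x a * y b) (bv [a, b]))"
    unfolding iota_expand[OF xy(1)] iota_expand[OF xy(2)]
    by (subst sum.swap) (simp add: tmul_sum tmul_sc fv.scale_sum_right fv.scale_scale mult.commute)
  moreover have "tmul (iota y) (iota x) = (\<Sum>a\<in>?A. \<Sum>b\<in>?B. sc (x a * y b) (bv [b, a]))"
    unfolding iota_expand[OF xy(1)] iota_expand[OF xy(2)]
    by (simp add: tmul_sum tmul_sc fv.scale_sum_right fv.scale_scale mult.commute)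
  moreover have "iota (lbr x y) = (\<Sum>a\<in>?A. \<Sum>b\<in>?B. sc (x a * y b) (iota (bbr a b)))"
    unfolding lb by (simp add: iota_sum iota_sc)
  ultimately have "r = (\<Sum>a\<in>?A. \<Sum>b\<in>?B. sc (x a * y b) (bv [a, b] - bv [b, a] - iota (bbr a b)))"
    unfolding r by (simp add: fv.scale_right_diff_distrib sum_subtractf)
  also have "\<dots> \<in> fv.span (range (\<lambda>(a, b). bv [a, b] - bv [b, a] - iota (bbr a b)))"
    by (intro fv.span_sum fv.span_scale, rule fv.span_base) auto
  finally show ?thesis .
qed

text \<open>A mode annihilated in the vacuum has index \<open>k <= 0\<close>; the mode
  \<open>k + i\<close> to be created is then already occupied.\<close>

lemma cur_vac_nonpos:
  assumes "i \<le> 0" "col c" "col d" "c \<noteq> d" shows "cur c d i vac S = 0"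
  unfolding cur_def
proof (rule sum.neutral, clarify)
  fix k assume "site c (k + i) \<in> S" "site d k \<notin> S"
  have "insert (site d k) (S - {site c (k + i)}) \<noteq> {..3}"
  proof
    assume eq: "insert (site d k) (S - {site c (k + i)}) = {..3}"
    then have "site d k \<le> 3" by auto
    then have "k \<le> 0" using assms by (auto simp: site_def col_def)
    then have "site c (k + i) \<le> 3" using assms by (auto simp: site_def col_def)
    then have "site c (k + i) \<in> insert (site d k) (S - {site c (k + i)})" using eq by auto
    then show False using col_neq[OF assms(2-4)] by auto
  qed
  then show "hop (site c (k + i)) (site d k) vac S = 0"
    using col_neq[OF assms(2-4)] by (simp add: hop_eval vac_def)
qed

lemma Phi_tmul_span_zero:
  assumes "a \<in> fv.span A" "fins t" "\<And>x. x \<in> A \<Longrightarrow> fins x \<and> Phi (tmul x t) S = 0"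
  shows "Phi (tmul a t) S = 0"
proof -
  have "fv.subspace {x. fins x \<and> Phi (tmul x t) S = 0}"
    unfolding fv.subspace_def using assms(2)
    by (auto simp: tmul_add tmul_sc Phi_add Phi_sc pointwise sc_apply)
  then have "fv.span A \<subseteq> {x. fins x \<and> Phi (tmul x t) S = 0}"
    using assms(3) by (intro fv.span_minimal) auto
  then show ?thesis using assms(1) by blast
qed

lemma LM_killed: "LM \<subseteq> killed (Collect good)"
  unfolding LM_def lspan_eq_span
proof (rule fv.span_minimal[OF _ subspace_killed], intro Un_least subsetI)
  fix z assume "z \<in> {tmul (tmul a r) b |a r b. fins a \<and> r \<in> urel \<and> fins b}"
  then obtain a r b where z: "z = tmul (tmul a r) b" "fins a" "r \<in> urel" "fins b" by blast
  have "fins r" using z(3) by (rule urel_fins)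
  have kr: "Phi (tmul r b) S = 0" if "good S" for S
  proof (rule Phi_tmul_span_zero[OF urel_span[OF z(3)] z(4)])
    fix w assume "w \<in> range (\<lambda>(a, b). bv [a, b] - bv [b, a] - iota (bbr a b))"
    then obtain x y where w: "w = bv [x, y] - bv [y, x] - iota (bbr x y)" by auto
    have "Phi (tmul w b) S = gen_op x (gen_op y (Phi b)) S - gen_op y (gen_op x (Phi b)) S
      - (\<Sum>g | bbr x y g \<noteq> 0. bbr x y g * gen_op g (Phi b) S)"
      using z(4) by (simp add: w tmul_diff Phi_diff Phi_tmul_bv pointwise Phi_iota_tmul)
    then show "fins w \<and> Phi (tmul w b) S = 0" using gen_op_bracket[OF that] w by simp
  qed
  have "Phi (tmul a (tmul r b)) S = 0" if "good S" for S
  proof (rule Phi_tmul_span_zero[OF z(2)[unfolded fins_iff_span]])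
    show "fins (tmul r b)" using z(4) \<open>fins r\<close> by simp
    fix x :: "gen list \<Rightarrow> complex" assume "x \<in> range bv"
    then obtain u where u: "x = bv u" by blast
    have "Phi (tmul (bv u) (tmul r b)) S = act u (Phi (tmul r b)) S"
      using z(4) \<open>fins r\<close> by (simp add: Phi_tmul_bv)
    also have "\<dots> = act u 0 S" by (rule act_cong_good[OF _ that]) (simp add: kr pointwise)
    finally show "fins x \<and> Phi (tmul x (tmul r b)) S = 0" by (simp add: pointwise u)
  qed
  then show "z \<in> killed (Collect good)"
    using z \<open>fins r\<close> by (simp add: killed_def tmul_assoc)
next
  fix z assume "z \<in> {tmul a (iota x) |a x. fins a \<and> x \<in> Hminus}"
  then obtain a x where z: "z = tmul a (iota x)" "fins a" "x \<in> Hminus" by blast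
  have x: "fins x" "\<And>g. x g \<noteq> 0 \<Longrightarrow> gidx g \<le> 0" using z(3) by (auto simp: Hminus_def)
  have "gen_op g vac = 0" if "gidx g \<le> 0" for g
    using that by (cases g) (auto simp: fun_eq_iff cur_vac_nonpos pointwise)
  then have "Phi (tmul (iota x) (bv [])) S = 0" for S
    using x by (subst Phi_iota_tmul) (auto intro!: sum.neutral simp: pointwise)
  then have i: "Phi (iota x) = 0" using x by (simp add: fun_eq_iff pointwise)
  have "Phi (tmul a (iota x)) S = 0" for S
  proof (rule Phi_tmul_span_zero[OF z(2)[unfolded fins_iff_span]])
    show "fins (iota x)" using x by simp
    fix y :: "gen list \<Rightarrow> complex" assume "y \<in> range bv"
    then show "fins y \<and> Phi (tmul y (iota x)) S = 0" using x by (auto simp: Phi_tmul_bv i pointwise)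
  qed
  then show "z \<in> killed (Collect good)" using z x by (simp add: killed_def pointwise)
qed

text \<open>In each of the five pairs the two currents share their created or their annihilated
  colour, and neither creates a colour that the other annihilates.\<close>

lemma gen_op_relation_zero:
  assumes "(X, Y) \<in> rpairs" "good S"
  shows "\<exists>K0. \<forall>K\<ge>K0. (\<Sum>i\<in>{-K..K}. gen_op (X i) (gen_op (Y (n - i)) F) S) = 0"
proof -
  have "(\<And>i. gen_op (X i) = cur c d i) \<Longrightarrow> (\<And>i. gen_op (Y i) = cur c' d' i) \<Longrightarrow>
      col c \<and> col d \<and> c \<noteq> d \<and> col c' \<and> col d' \<and> c' \<noteq> d' \<and> c \<noteq> d' \<and> d \<noteq> c' \<and> (c = c' \<or> d = d') \<Longrightarrow> ?thesis"
    for c d c' d'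
    using cur_product_coefficient_zero[OF assms(2), of c d c' d' n F] by simp
  from this[of 1 2 1 2] this[of 2 3 2 3] this[of 1 2 1 3] this[of 2 3 1 3] this[of 1 3 1 3]
  show ?thesis using assms(1) unfolding rpairs_def by (elim insertE emptyE; simp)
qed

lemma JW_killed: "JW \<subseteq> killed (Collect good)"
  unfolding JW_def lspan_eq_span
proof (rule fv.span_minimal[OF _ subspace_killed], intro Un_least LM_killed subsetI)
  fix c assume "c \<in> Rco"
  then obtain X Y n t K0 where XY: "(X, Y) \<in> rpairs" and t: "fins t" and c: "fins c"
    and K0: "\<And>K. K \<ge> K0 \<Longrightarrow> psum X Y n t K - c \<in> LM" unfolding Rco_def by blast
  have "Phi c S = 0" if S: "good S" for S
  proof -
    obtain K1 where K1: "\<And>K. K \<ge> K1 \<Longrightarrow> (\<Sum>i\<in>{-K..K}. gen_op (X i) (gen_op (Y (n - i)) (Phi t)) S) = 0"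
      using gen_op_relation_zero[OF XY S] by blast
    define K where "K = max K0 (nat K1)"
    have fp: "fins (psum X Y n t K)" unfolding psum_def using t by (intro fins_sum) auto
    have "Phi (psum X Y n t K - c) S = 0"
      using K0[of K] LM_killed S by (auto simp: killed_def K_def)
    then have "Phi c S = Phi (psum X Y n t K) S" using fp c by (simp add: Phi_diff pointwise)
    also have "\<dots> = (\<Sum>i\<in>{-int K..int K}. gen_op (X i) (gen_op (Y (n - i)) (Phi t)) S)"
      unfolding psum_def using t by (simp add: Phi_sum Phi_tmul_bv sum_fun_apply)
    also have "\<dots> = 0" by (rule K1) (unfold K_def, linarith)
    finally show ?thesis .
  qed
  then show "c \<in> killed (Collect good)" using c by (simp add: killed_def)
qed

lemma Jbar_killed:
  assumes "good S" "\<And>g F. gen_in M N g \<Longrightarrow> gen_op g F S = 0"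
  shows "Jbar M N \<subseteq> killed {S}"
proof (rule Jbar_least[OF subspace_killed])
  show "JW \<subseteq> killed {S}" using JW_killed assms(1) by (auto simp: killed_def)
qed (use assms in \<open>auto simp: killed_def Phi_tmul_bv\<close>)

text \<open>The coefficient at \<open>S\<close> is a linear functional of the tensor. Where the
  vacuum vector is divided out too, \<open>S\<close> must differ from the vacuum state, the only one
  with a nonzero coefficient in \<open>vac\<close>.\<close>

lemma JMN_killed:
  assumes "good S" "\<And>g F. gen_in M N g \<Longrightarrow> gen_op g F S = 0" "M = -1 \<or> N = -1 \<Longrightarrow> S \<noteq> {..3}"
  shows "JMN M N \<subseteq> killed {S}"
proof (cases "M = -1 \<or> N = -1")
  case True
  have "bv [] \<in> killed {S}" using assms(3)[OF True] by (simp add: killed_def vac_def)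
  moreover have "Jbar M N \<subseteq> killed {S}" by (rule Jbar_killed[OF assms(1,2)])
  ultimately have "fv.span (Jbar M N \<union> {bv []}) \<subseteq> killed {S}"
    by (intro fv.span_minimal[OF _ subspace_killed]) simp
  then show ?thesis using True by (simp add: JMN_def lspan_eq_span)
qed (use Jbar_killed[OF assms(1,2)] in \<open>simp add: JMN_def\<close>)

section \<open>Test states and the hops leading to them\<close>

definition St :: "int set \<Rightarrow> int set \<Rightarrow> int \<Rightarrow> int set" where
  "St Q R m = {site 1 k |k. k \<le> 0 \<or> k \<in> Q} \<union> {site 2 k |k. k \<le> m} \<union> {site 3 k |k. k \<le> 0 \<and> - k \<notin> R}"

lemma St_mem [simp]:
  "site 1 k \<in> St Q R m \<longleftrightarrow> k \<le> 0 \<or> k \<in> Q"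
  "site 2 k \<in> St Q R m \<longleftrightarrow> k \<le> m"
  "site 3 k \<in> St Q R m \<longleftrightarrow> k \<le> 0 \<and> - k \<notin> R"
  by (auto simp: St_def)

lemma ex_site: "\<exists>c k. (c = 1 \<or> c = 2 \<or> c = 3) \<and> x = site c k"
proof -
  have "x = 3 * ((x - 1) div 3) + ((x - 1) mod 3 + 1)" by simp
  moreover have "(x - 1) mod 3 + 1 = 1 \<or> (x - 1) mod 3 + 1 = 2 \<or> (x - 1) mod 3 + 1 = 3" by presburger
  ultimately show ?thesis unfolding site_def by blast
qed

lemma eq_by_sites:
  assumes "\<And>k. site 1 k \<in> A \<longleftrightarrow> site 1 k \<in> B" "\<And>k. site 2 k \<in> A \<longleftrightarrow> site 2 k \<in> B"
    "\<And>k. site 3 k \<in> A \<longleftrightarrow> site 3 k \<in> B"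
  shows "A = B"
proof (rule set_eqI)
  fix x show "x \<in> A \<longleftrightarrow> x \<in> B" using ex_site[of x] assms by auto
qed

lemma good_St:
  assumes "Q \<subseteq> {..q}" "R \<subseteq> {..r}" shows "good (St Q R m)"
proof -
  have "x \<in> St Q R m" if "x \<le> 3 * (- \<bar>r\<bar> - \<bar>m\<bar> - 1)" for x
  proof -
    obtain c k where x: "c = 1 \<or> c = 2 \<or> c = 3" "x = site c k" using ex_site by blast
    then have "k \<le> - \<bar>r\<bar> - \<bar>m\<bar> - 1" using that by (auto simp: site_def)
    then have "k \<le> 0" "k \<le> m" "- k > r" by linarith+
    then show ?thesis using x assms by auto
  qed
  moreover have "x \<le> 3 * (\<bar>q\<bar> + \<bar>m\<bar>) + 3" if "x \<in> St Q R m" for x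
  proof -
    obtain c k where x: "c = 1 \<or> c = 2 \<or> c = 3" "x = site c k" using ex_site by blast
    then have "k \<le> 0 \<or> k \<le> m \<or> k \<le> q" using that assms by auto
    then have "k \<le> \<bar>q\<bar> + \<bar>m\<bar>" by linarith
    then show ?thesis using x by (auto simp: site_def)
  qed
  ultimately show ?thesis unfolding good_def by (metis atMost_iff subsetI)
qed

lemma cur_unique:
  assumes "{k. site c (k + i) \<in> S \<and> site d k \<notin> S} = {k0}" "col c" "col d" "c \<noteq> d"
  shows "cur c d i F S = sg (site c (k0 + i)) S * sg (site d k0) (S - {site c (k0 + i)})
    * F (insert (site d k0) (S - {site c (k0 + i)}))"
proof -
  have "site c (k0 + i) \<in> S \<and> site d k0 \<notin> S" using assms(1) by blast
  then show ?thesis unfolding cur_def assms(1) using col_neq[OF assms(2-4)] by (simp add: hop_eval)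
qed

lemma cur_empty: "(\<And>k. \<not> (site c (k + i) \<in> S \<and> site d k \<notin> S)) \<Longrightarrow> cur c d i F S = 0"
  unfolding cur_def by (intro sum.neutral) auto

definition sgn_F :: "int set \<Rightarrow> int set \<Rightarrow> int \<Rightarrow> int \<Rightarrow> complex" where
  "sgn_F Q R m r = sg (site 2 m) (St Q R m) * sg (site 3 (- r)) (St Q R m - {site 2 m})"

definition sgn_H :: "int set \<Rightarrow> int set \<Rightarrow> int \<Rightarrow> int \<Rightarrow> int \<Rightarrow> complex" where
  "sgn_H Q R m r q = sg (site 1 q) (St Q R m) * sg (site 3 (- r)) (St Q R m - {site 1 q})"

lemma sgn_nonzero:
  assumes "Q \<subseteq> {..q}" "R \<subseteq> {..r}" shows "sgn_F Q R m x \<noteq> 0" "sgn_H Q R m x y \<noteq> 0"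
  using good_bdd[OF good_St[OF assms, of m]] by (simp_all add: sgn_F_def sgn_H_def sg_nonzero)

text \<open>\<open>R\<close> lists the vacancies of colour 3 by their negatives, so
  \<open>- r\<close> is the lowest possible one. To reach this state, \<open>Ff (m + r)\<close> has
  to create a mode of colour 2 that is at most \<open>m\<close> by annihilating one of colour 3 that
  is at least \<open>- r\<close>; the only choice is the extreme pair.\<close>

lemma F_St:
  assumes "R \<subseteq> {0..r}" "0 \<le> r" "u = m + r"
  shows "gen_op (Ff u) G (St Q R m) = (if r \<in> R then sgn_F Q R m r * G (St Q (R - {r}) (m - 1)) else 0)"
proof -
  have set: "{k. site 2 (k + u) \<in> St Q R m \<and> site 3 k \<notin> St Q R m} = (if r \<in> R then {- r} else {})"
  proof (rule set_eqI)
    fix k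
    have "k + u \<le> m \<and> \<not> (k \<le> 0 \<and> - k \<notin> R) \<longleftrightarrow> k = - r \<and> r \<in> R"
    proof
      assume k: "k + u \<le> m \<and> \<not> (k \<le> 0 \<and> - k \<notin> R)"
      then have "k \<le> 0" "- k \<in> R" using assms by auto
      then have "- k \<le> r" using assms(1) by auto
      then have "k = - r" using k assms by linarith
      then show "k = - r \<and> r \<in> R" using \<open>- k \<in> R\<close> by simp
    qed (use assms in auto)
    then show "k \<in> {k. site 2 (k + u) \<in> St Q R m \<and> site 3 k \<notin> St Q R m} \<longleftrightarrow> k \<in> (if r \<in> R then {- r} else {})"
      by simp
  qed
  show ?thesis
  proof (cases "r \<in> R")
    case True
    have "insert (site 3 (- r)) (St Q R m - {site 2 m}) = St Q (R - {r}) (m - 1)"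
      using assms(2) by (intro eq_by_sites) auto
    moreover have "- r + u = m" using assms(3) by simp
    ultimately show ?thesis using True cur_unique[of 2 u "St Q R m" 3 "- r" G] set by (simp add: sgn_F_def)
  next
    case False
    then have "{k. site 2 (k + u) \<in> St Q R m \<and> site 3 k \<notin> St Q R m} = {}" using set by argo
    then have "cur 2 3 u G (St Q R m) = 0" by (intro cur_empty) blast
    then show ?thesis using False by simp
  qed
qed

text \<open>The same extremal choice with colour 1: \<open>u\<close> is the full distance from the
  lowest possible vacancy \<open>- r\<close> to the highest possible occupied mode
  \<open>q\<close>.\<close>

lemma H_St:
  assumes "R \<subseteq> {0..r}" "0 \<le> r" "u = q + r" "1 \<le> q" "Q \<subseteq> {..q}"
  shows "gen_op (Hh u) G (St Q R m)
    = (if r \<in> R \<and> q \<in> Q then sgn_H Q R m r q * G (St (Q - {q}) (R - {r}) m) else 0)"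
proof -
  have set: "{k. site 1 (k + u) \<in> St Q R m \<and> site 3 k \<notin> St Q R m} = (if r \<in> R \<and> q \<in> Q then {- r} else {})"
  proof (rule set_eqI)
    fix k
    have "(k + u \<le> 0 \<or> k + u \<in> Q) \<and> \<not> (k \<le> 0 \<and> - k \<notin> R) \<longleftrightarrow> k = - r \<and> r \<in> R \<and> q \<in> Q"
    proof
      assume k: "(k + u \<le> 0 \<or> k + u \<in> Q) \<and> \<not> (k \<le> 0 \<and> - k \<notin> R)"
      then have le: "k + u \<le> q" using assms by auto
      then have "k \<le> 0" "- k \<in> R" using k assms by auto
      then have "- k \<le> r" using assms(1) by auto
      then have "k = - r" using le assms by linarith
      then show "k = - r \<and> r \<in> R \<and> q \<in> Q" using \<open>- k \<in> R\<close> k assms by auto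
    qed (use assms in auto)
    then show "k \<in> {k. site 1 (k + u) \<in> St Q R m \<and> site 3 k \<notin> St Q R m}
        \<longleftrightarrow> k \<in> (if r \<in> R \<and> q \<in> Q then {- r} else {})"
      by simp
  qed
  show ?thesis
  proof (cases "r \<in> R \<and> q \<in> Q")
    case True
    have "insert (site 3 (- r)) (St Q R m - {site 1 q}) = St (Q - {q}) (R - {r}) m"
      using assms(2,4) by (intro eq_by_sites) auto
    moreover have "- r + u = q" using assms(3) by simp
    ultimately show ?thesis using True cur_unique[of 1 u "St Q R m" 3 "- r" G] set by (simp add: sgn_H_def)
  next
    case False
    then have "{k. site 1 (k + u) \<in> St Q R m \<and> site 3 k \<notin> St Q R m} = {}" using set by argo
    then have "cur 1 3 u G (St Q R m) = 0" by (intro cur_empty) blast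
    then show ?thesis using False by auto
  qed
qed

text \<open>Occupied modes are at most \<open>m + M\<close> in colour 1 and \<open>m\<close> in
  colour 2; vacancies exceed \<open>m\<close> in colour 2 and \<open>m - N\<close> in colour 3. A
  hop of \<open>Ee\<close>, \<open>Ff\<close> or \<open>Hh\<close> into this state thus has index
  below \<open>M\<close>, \<open>N\<close> or \<open>M + N\<close>.\<close>

lemma gen_in_St_zero:
  assumes "Q \<subseteq> {..m + M}" "0 \<le> m + M" "R \<subseteq> {0..<N - m}" "m \<le> N" "gen_in M N g"
  shows "gen_op g F (St Q R m) = 0"
proof (cases g)
  case (Ee u)
  have "\<not> ((k + u \<le> 0 \<or> k + u \<in> Q) \<and> \<not> k \<le> m)" for k
    using assms Ee by (auto dest!: subsetD)
  then show ?thesis using Ee by (simp add: cur_empty)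
next
  case (Ff u)
  have "\<not> (k + u \<le> m \<and> \<not> (k \<le> 0 \<and> - k \<notin> R))" for k
    using assms Ff by (auto dest!: subsetD)
  then show ?thesis using Ff by (simp add: cur_empty)
next
  case (Hh u)
  have "\<not> ((k + u \<le> 0 \<or> k + u \<in> Q) \<and> \<not> (k \<le> 0 \<and> - k \<notin> R))" for k
  proof
    assume k: "(k + u \<le> 0 \<or> k + u \<in> Q) \<and> \<not> (k \<le> 0 \<and> - k \<notin> R)"
    then have "k + u \<le> m + M" using assms by auto
    moreover have "k > m - N" using k assms by (auto dest!: subsetD)
    ultimately show False using assms Hh by simp
  qed
  then show ?thesis using Hh by (simp add: cur_empty)
qed

section \<open>Charge of colour 2 and the vector \<open>e_1 v\<close>\<close>

fun chg :: "gen list \<Rightarrow> int" where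
  "chg [] = 0"
| "chg (Ff i # w) = chg w + 1"
| "chg (Ee i # w) = chg w - 1"
| "chg (Hh i # w) = chg w"

lemma cur_nonzero:
  assumes "cur c d i F S \<noteq> 0" "col c" "col d" "c \<noteq> d"
  obtains k where "site c (k + i) \<in> S" "site d k \<notin> S" "F (insert (site d k) (S - {site c (k + i)})) \<noteq> 0"
proof -
  obtain k where k: "site c (k + i) \<in> S" "site d k \<notin> S" "hop (site c (k + i)) (site d k) F S \<noteq> 0"
    using assms(1) unfolding cur_def by (metis (mono_tags, lifting) mem_Collect_eq sum.neutral)
  then show thesis using that[of k] col_neq[OF assms(2-4)] by (simp add: hop_eval)
qed

lemma finite_window: "finite {l \<in> {-n..n}. P l}" for n :: int
  by (rule finite_subset[of _ "{-n..n}"]) auto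

text \<open>\<open>chg w\<close> is the change in the number of fermions of colour 2. That number is
  infinite, so it is counted in windows \<open>-n..n\<close>, of which the vacuum fills
  \<open>n + 1\<close> modes; the count is right once the window contains the modes that
  moved.\<close>

lemma act_vac_charge:
  "act w vac S \<noteq> 0 \<Longrightarrow> \<exists>n0. \<forall>n\<ge>n0. int (card {k \<in> {-n..n}. site 2 k \<in> S}) = n + 1 + chg w"
proof (induct w arbitrary: S)
  case Nil
  then have S: "S = {..3}" by (simp add: vac_def split: if_splits)
  have "{k \<in> {-n..n}. site 2 k \<in> S} = {-n..0}" if "n \<ge> 0" for n
    using that by (auto simp: S site_def)
  then have "\<forall>n\<ge>0. int (card {k \<in> {-n..n}. site 2 k \<in> S}) = n + 1 + chg []" by simp
  then show ?case by blast
next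
  case (Cons g w)
  show ?case
  proof (cases g)
    case (Ee i)
    then obtain k where k: "site 1 (k + i) \<in> S" "site 2 k \<notin> S" "act w vac (insert (site 2 k) (S - {site 1 (k + i)})) \<noteq> 0"
      using Cons.prems cur_nonzero[of 1 2 i "act w vac" S] by auto
    then obtain n0 where n0: "\<And>n. n \<ge> n0 \<Longrightarrow>
        int (card {l \<in> {-n..n}. site 2 l \<in> insert (site 2 k) (S - {site 1 (k + i)})}) = n + 1 + chg w"
      using Cons.hyps by blast
    have "int (card {l \<in> {-n..n}. site 2 l \<in> S}) = n + 1 + chg (g # w)" if "n \<ge> max n0 \<bar>k\<bar>" for n
    proof -
      have "{l \<in> {-n..n}. site 2 l \<in> insert (site 2 k) (S - {site 1 (k + i)})} = insert k {l \<in> {-n..n}. site 2 l \<in> S}"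
        using that by auto
      moreover have "card (insert k {l \<in> {-n..n}. site 2 l \<in> S}) = Suc (card {l \<in> {-n..n}. site 2 l \<in> S})"
        using k(2) by (intro card_insert_disjoint finite_window) auto
      moreover have "n \<ge> n0" using that by simp
      ultimately show ?thesis using n0[of n] Ee by (simp del: site_eq_simps)
    qed
    then show ?thesis by blast
  next
    case (Ff i)
    then obtain k where k: "site 2 (k + i) \<in> S" "site 3 k \<notin> S" "act w vac (insert (site 3 k) (S - {site 2 (k + i)})) \<noteq> 0"
      using Cons.prems cur_nonzero[of 2 3 i "act w vac" S] by auto
    then obtain n0 where n0: "\<And>n. n \<ge> n0 \<Longrightarrow>
        int (card {l \<in> {-n..n}. site 2 l \<in> insert (site 3 k) (S - {site 2 (k + i)})}) = n + 1 + chg w"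
      using Cons.hyps by blast
    have "int (card {l \<in> {-n..n}. site 2 l \<in> S}) = n + 1 + chg (g # w)" if "n \<ge> max n0 \<bar>k + i\<bar>" for n
    proof -
      have "{l \<in> {-n..n}. site 2 l \<in> S} = insert (k + i) {l \<in> {-n..n}. site 2 l \<in> insert (site 3 k) (S - {site 2 (k + i)})}"
        using that k(1) by auto
      moreover have "card (insert (k + i) {l \<in> {-n..n}. site 2 l \<in> insert (site 3 k) (S - {site 2 (k + i)})})
          = Suc (card {l \<in> {-n..n}. site 2 l \<in> insert (site 3 k) (S - {site 2 (k + i)})})"
        by (intro card_insert_disjoint finite_window) auto
      moreover have "n \<ge> n0" using that by simp
      ultimately show ?thesis using n0[of n] Ff by (simp del: site_eq_simps)
    qed
    then show ?thesis by blast
  next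
    case (Hh i)
    then obtain k where k: "site 1 (k + i) \<in> S" "site 3 k \<notin> S" "act w vac (insert (site 3 k) (S - {site 1 (k + i)})) \<noteq> 0"
      using Cons.prems cur_nonzero[of 1 3 i "act w vac" S] by auto
    then obtain n0 where n0: "\<And>n. n \<ge> n0 \<Longrightarrow>
        int (card {l \<in> {-n..n}. site 2 l \<in> insert (site 3 k) (S - {site 1 (k + i)})}) = n + 1 + chg w"
      using Cons.hyps by blast
    then have "\<forall>n\<ge>n0. int (card {l \<in> {-n..n}. site 2 l \<in> S}) = n + 1 + chg (g # w)" using Hh by simp
    then show ?thesis by blast
  qed
qed

lemma act_vac_St_charge:
  assumes "act w vac (St Q R m) \<noteq> 0" shows "chg w = m"
proof -
  obtain n0 where n0: "\<And>n. n \<ge> n0 \<Longrightarrow> int (card {k \<in> {-n..n}. site 2 k \<in> St Q R m}) = n + 1 + chg w"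
    using act_vac_charge[OF assms] by blast
  define n where "n = max n0 \<bar>m\<bar>"
  have "{k \<in> {-n..n}. site 2 k \<in> St Q R m} = {-n..m}" unfolding n_def by auto
  moreover have "-n \<le> m" "n \<ge> n0" unfolding n_def by auto
  ultimately show ?thesis using n0[of n] by simp
qed

text \<open>\<open>e_1 v\<close> has mode 1 of colour 1 occupied, and no letter annihilates a
  fermion of colour 1.\<close>

lemma act_E1_vac_unoccupied: "site 1 1 \<notin> S \<Longrightarrow> act w (cur 1 2 1 vac) S = 0"
proof (induct w arbitrary: S)
  case Nil
  show ?case
  proof (rule ccontr)
    assume "act [] (cur 1 2 1 vac) S \<noteq> 0"
    then have "cur 1 2 1 vac S \<noteq> 0" by simp
    then obtain k where k: "site 1 (k + 1) \<in> S" "site 2 k \<notin> S" "vac (insert (site 2 k) (S - {site 1 (k + 1)})) \<noteq> 0"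
      by (rule cur_nonzero) simp_all
    from k(3) have eq: "insert (site 2 k) (S - {site 1 (k + 1)}) = {..3}" by (simp add: vac_def split: if_splits)
    then have "site 2 k \<le> 3" by blast
    moreover have "site 1 (k + 1) \<notin> insert (site 2 k) (S - {site 1 (k + 1)})" by simp
    then have "\<not> site 1 (k + 1) \<le> 3" unfolding eq by simp
    ultimately have "k = 0" unfolding site_def by presburger
    then show False using k Nil by simp
  qed
next
  case (Cons g w)
  have "cur c d i (act w (cur 1 2 1 vac)) S = 0" if cd: "col c" "col d" "c \<noteq> d" "d \<noteq> 1" for c d i
  proof (rule ccontr)
    assume "cur c d i (act w (cur 1 2 1 vac)) S \<noteq> 0"
    then obtain k where "site c (k + i) \<in> S" "site d k \<notin> S"
      and "act w (cur 1 2 1 vac) (insert (site d k) (S - {site c (k + i)})) \<noteq> 0"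
      by (rule cur_nonzero[OF _ cd(1-3)])
    moreover have "site 1 1 \<noteq> site d k" using cd by (intro col_neq) simp_all
    then have "site 1 1 \<notin> insert (site d k) (S - {site c (k + i)})" using Cons.prems by blast
    then have "act w (cur 1 2 1 vac) (insert (site d k) (S - {site c (k + i)})) = 0" by (rule Cons.hyps)
    ultimately show False by simp
  qed
  then show ?case by (cases g) simp_all
qed

lemma vac_St: "St {} {} 0 = {..3}"
proof -
  have "site 1 k \<le> 3 \<longleftrightarrow> k \<le> 0" "site 2 k \<le> 3 \<longleftrightarrow> k \<le> 0" "site 3 k \<le> 3 \<longleftrightarrow> k \<le> 0" for k
    unfolding site_def by presburger+
  then show ?thesis by (intro eq_by_sites) simp_all
qed

lemma E1_vac_St: "cur 1 2 1 vac (St {1} {} (-1)) \<noteq> 0"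
proof -
  let ?S = "St {1} {} (-1)"
  have "cur 1 2 1 vac ?S = sg (site 1 (0 + 1)) ?S * sg (site 2 0) (?S - {site 1 (0 + 1)})
      * vac (insert (site 2 0) (?S - {site 1 (0 + 1)}))"
    by (rule cur_unique) auto
  moreover have "insert (site 2 0) (?S - {site 1 (0 + 1)}) = {..3}"
    unfolding vac_St[symmetric] by (rule eq_by_sites) auto
  moreover have "bdd_above ?S" by (rule good_bdd[OF good_St[of _ 1 _ 0]]) auto
  ultimately show ?thesis by (simp add: vac_def sg_nonzero)
qed

section \<open>Linear independence\<close>

text \<open>Here \<open>a\<close> counts the letters \<open>Ff\<close>, the flag says whether the previous letter was an \<open>Ff\<close>, and
  \<open>u - (a + s)\<close>, \<open>u - (a + m)\<close> are the modes of colour 3 that the first letter can fill in a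
  suitable state; they decrease along the word.\<close>

fun adm :: "int \<Rightarrow> int \<Rightarrow> int \<Rightarrow> int \<Rightarrow> bool \<Rightarrow> int \<Rightarrow> gen list \<Rightarrow> bool" where
  "adm s m f0 a fl B [] \<longleftrightarrow> a = 0"
| "adm s m f0 a fl B (Ff u # w) \<longleftrightarrow>
    1 \<le> a \<and> 0 \<le> u - (a + s) \<and> u - (a + s) < B \<and> adm s m f0 (a - 1) True (u - (a + s)) w"
| "adm s m f0 a fl B (Hh u # w) \<longleftrightarrow>
    fl \<and> f0 \<le> a \<and> 0 \<le> u - (a + m) \<and> u - (a + m) < B \<and> adm s m f0 a False (u - (a + m)) w"
| "adm s m f0 a fl B (Ee u # w) \<longleftrightarrow> False"

lemma adm_chg: "adm s m f0 a fl B w \<Longrightarrow> chg w = a \<and> 0 \<le> a"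
  by (induct s m f0 a fl B w rule: adm.induct) auto

lemma adm_Nil_or_pos: "adm s m f0 a fl B w \<Longrightarrow> a = 0 \<or> 0 < B"
  by (cases "(s, m, f0, a, fl, B, w)" rule: adm.cases) auto

text \<open>For a nonempty admissible word this is the \<open>r\<close> such that the first letter
  fills the mode \<open>- r\<close> of colour 3; the value 0 on other words is a default.\<close>

fun key :: "int \<Rightarrow> int \<Rightarrow> int \<Rightarrow> gen list \<Rightarrow> int" where
  "key s m a (Ff u # w) = u - (a + s)"
| "key s m a (Hh u # w) = u - (a + m)"
| "key s m a w = 0"

lemma adm_cases:
  assumes "adm s m f0 a fl B w" "w \<noteq> []"
  obtains (F) r w' where "w = Ff (a + s + r) # w'" "key s m a w = r" "1 \<le> a" "0 \<le> r" "r < B" "adm s m f0 (a - 1) True r w'"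
  | (H) r w' where "w = Hh (a + m + r) # w'" "key s m a w = r" "fl" "f0 \<le> a" "0 \<le> r" "r < B" "adm s m f0 a False r w'"
proof (cases w)
  case (Cons g w')
  show thesis
  proof (cases g)
    case (Ff u)
    have "u = a + s + (u - (a + s))" by simp
    then show thesis using assms Cons Ff F[of "u - (a + s)" w'] by auto
  next
    case (Hh u)
    have "u = a + m + (u - (a + m))" by simp
    then show thesis using assms Cons Hh H[of "u - (a + m)" w'] by auto
  qed (use assms Cons in auto)
qed (use assms in auto)

text \<open>If \<open>r\<close> is the smallest key, evaluating at a state whose lowest vacancy of colour 3 is the mode
  \<open>- r\<close> isolates the words whose first letter fills it; leaving the mode \<open>a + m\<close> of colour 1
  empty selects the words starting with \<open>Ff\<close>, occupying it those starting with \<open>Hh\<close>.\<close>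

lemma peeling:
  fixes c :: "gen list \<Rightarrow> complex"
  assumes base: "Fb (St P0 {} s) \<noteq> 0" and P0: "P0 \<subseteq> {..<f0 + m}" and pos: "1 \<le> f0 + m"
    and "finite X" "\<And>w. w \<in> X \<Longrightarrow> adm s m f0 a fl B w"
    and "\<And>P R. P \<subseteq> {f0 + m..a + m - 1 + (if fl then 1 else 0)} \<Longrightarrow> R \<subseteq> {0..<B} \<Longrightarrow>
        (\<Sum>w\<in>X. c w * act w Fb (St (P0 \<union> P) R (a + s))) = 0"
    and "w \<in> X"
  shows "c w = 0"
  using assms(4-7)
\<comment> \<open>Removing an \<open>Ff\<close> lowers \<open>a\<close> but may raise the flag,
  removing an \<open>Hh\<close> keeps \<open>a\<close> and lowers the flag; this weight decreases in
  both cases.\<close>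
proof (induct "2 * nat a + (if fl then 1 else 0)" arbitrary: a fl B X c w rule: less_induct)
  case less
  note IH = less.hyps and fin = less.prems(1) and adm = less.prems(2) and sum0 = less.prems(3)
  let ?act = "\<lambda>w P R. act w Fb (St (P0 \<union> P) R (a + s))"
  have hlem: "gen_op (Hh (a + m + r)) G (St (P0 \<union> P) R (a + s)) =
      (if r \<in> R \<and> a + m \<in> P then sgn_H (P0 \<union> P) R (a + s) r (a + m)
        * G (St (P0 \<union> P - {a + m}) (R - {r}) (a + s)) else 0)"
    if "f0 \<le> a" "0 \<le> r" "R \<subseteq> {0..r}" "P \<subseteq> {..a + m}" for r G P R
  proof -
    have "a + m \<notin> P0" "P0 \<union> P \<subseteq> {..a + m}" using P0 that by auto
    then show ?thesis using H_St[of R r "a + m + r" "a + m" "P0 \<union> P" G "a + s"] that pos by auto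
  qed
  have flem: "gen_op (Ff (a + s + r)) G (St (P0 \<union> P) R (a + s)) =
      (if r \<in> R then sgn_F (P0 \<union> P) R (a + s) r * G (St (P0 \<union> P) (R - {r}) (a + s - 1)) else 0)"
    if "0 \<le> r" "R \<subseteq> {0..r}" for r G P R
    using F_St[of R r "a + s + r" "a + s" G "P0 \<union> P"] that by simp
  \<comment> \<open>Without a vacancy in colour 3 no \<open>Hh\<close> leads to this state, and
    \<open>a = 0\<close> excludes \<open>Ff\<close>; only the empty word contributes.\<close>
  have nil: "c [] = 0" if "[] \<in> X"
  proof -
    have a: "a = 0" using adm[OF that] by simp
    have "?act w {} {} = 0" if "w \<in> X - {[]}" for w
    proof -
      have "adm s m f0 a fl B w" by (rule adm) (rule DiffD1[OF that])
      moreover have "w \<noteq> []" using that by blast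
      ultimately show ?thesis
      proof (cases rule: adm_cases)
        case (F r w')
        then show ?thesis using a by simp
      next
        case (H r w')
        then show ?thesis using hlem[of r "{}" "{}" "act w' Fb"] by simp
      qed
    qed
    then have "(\<Sum>w\<in>X. c w * ?act w {} {}) = (\<Sum>w\<in>{[]}. c w * ?act w {} {})"
      using fin that by (intro sum.mono_neutral_right) auto
    moreover have "(\<Sum>w\<in>X. c w * ?act w {} {}) = 0" by (rule sum0) auto
    ultimately show ?thesis using base a by simp
  qed
  have "c w = 0" if "w \<in> X" "w \<noteq> []" for w
    using that
  proof (induct "nat (key s m a w)" arbitrary: w rule: less_induct)
    case (less v)
    define r where "r = key s m a v"
    have smaller: "c w = 0" if "w \<in> X" "w \<noteq> []" "key s m a w < r" for w
    proof -
      have "0 \<le> key s m a w"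
        using adm[OF that(1)] that(2) by (cases rule: adm_cases) auto
      then show ?thesis using less.hyps[of w] that by (simp add: r_def)
    qed
    have vadm: "adm s m f0 a fl B v" using adm less.prems by blast
    have rB: "0 \<le> r" "r < B" using vadm less.prems(2) unfolding r_def by (cases rule: adm_cases; simp)+
    let ?XF = "{w. Ff (a + s + r) # w \<in> X}" and ?XH = "{w. Hh (a + m + r) # w \<in> X}"
    have finF: "finite ?XF" using finite_vimageI[OF fin, of "Cons (Ff (a + s + r))"] by (simp add: vimage_def)
    have finH: "finite ?XH" using finite_vimageI[OF fin, of "Cons (Hh (a + m + r))"] by (simp add: vimage_def)
    \<comment> \<open>Words with smaller keys have coefficient zero already. Since
      \<open>- r\<close> is the lowest vacancy of colour 3 and the mode \<open>a + m\<close> of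
      colour 1 is empty, only words starting with \<open>Ff (a + s + r)\<close> contribute.\<close>
    have F0: "c (Ff (a + s + r) # w) = 0" if w: "w \<in> ?XF" for w
    proof (rule IH[where c = "\<lambda>w. c (Ff (a + s + r) # w)" and X = ?XF and a = "a - 1" and fl = True and B = r])
      have a1: "1 \<le> a" using adm[of "Ff (a + s + r) # w"] w by simp
      then show "2 * nat (a - 1) + (if True then 1 else 0) < 2 * nat a + (if fl then 1 else 0)" by simp
      show "adm s m f0 (a - 1) True r w" if "w \<in> ?XF" for w
        using adm[of "Ff (a + s + r) # w"] that by simp
      fix P R assume P: "P \<subseteq> {f0 + m..a - 1 + m - 1 + (if True then 1 else 0)}" and R: "R \<subseteq> {0..<r}"
      let ?R = "insert r R"
      let ?s = "sgn_F (P0 \<union> P) ?R (a + s) r"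
      have R': "?R \<subseteq> {0..r}" "?R \<subseteq> {0..<B}" "?R - {r} = R" using R rB by auto
      have P': "P \<subseteq> {f0 + m..a + m - 1 + (if fl then 1 else 0)}" "P \<subseteq> {..a + m - 1}" using P by auto
      have vanish: "c w * ?act w P ?R = 0" if "w \<in> X - Cons (Ff (a + s + r)) ` ?XF" for w
      proof (cases "w = [] \<or> key s m a w < r")
        case True
        then have "c w = 0" using nil smaller[of w] that by blast
        then show ?thesis by simp
      next
        case False
        have "adm s m f0 a fl B w" by (rule adm) (rule DiffD1[OF that])
        moreover have "w \<noteq> []" using False by blast
        ultimately show ?thesis
        proof (cases rule: adm_cases)
          case (F r' w')
          have "r' \<noteq> r" using that F(1) by blast
          then have "r < r'" using False F by simp
          then have "r' \<notin> ?R" "?R \<subseteq> {0..r'}" using R'(1) by auto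
          then show ?thesis using flem[of r' ?R "act w' Fb" P] F by simp
        next
          case (H r' w')
          have "r \<le> r'" using False H(2) by simp
          then have "?R \<subseteq> {0..r'}" using R'(1) by auto
          moreover have "a + m \<notin> P" "P \<subseteq> {..a + m}" using P'(2) by auto
          ultimately show ?thesis using hlem[of r' ?R P "act w' Fb"] H by simp
        qed
      qed
      have "0 = (\<Sum>w\<in>X. c w * ?act w P ?R)" using sum0[OF P'(1) R'(2)] by simp
      also have "\<dots> = (\<Sum>w\<in>Cons (Ff (a + s + r)) ` ?XF. c w * ?act w P ?R)"
        using fin vanish by (intro sum.mono_neutral_right) auto
      also have "\<dots> = (\<Sum>w\<in>?XF. c (Ff (a + s + r) # w) * ?act (Ff (a + s + r) # w) P ?R)"
        by (rule sum.reindex_cong[of "Cons _"]) (simp_all only: inj_on_Cons1)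
      also have "\<dots> = ?s * (\<Sum>w\<in>?XF. c (Ff (a + s + r) # w) * act w Fb (St (P0 \<union> P) R (a - 1 + s)))"
        unfolding sum_distrib_left
      proof (rule sum.cong[OF refl])
        fix w
        have eq: "a + s - 1 = a - 1 + s" by simp
        show "c (Ff (a + s + r) # w) * ?act (Ff (a + s + r) # w) P ?R
            = ?s * (c (Ff (a + s + r) # w) * act w Fb (St (P0 \<union> P) R (a - 1 + s)))"
          using flem[OF rB(1) R'(1), of "act w Fb" P, unfolded eq] R'(3) by simp
      qed
      finally have "?s * (\<Sum>w\<in>?XF. c (Ff (a + s + r) # w) * act w Fb (St (P0 \<union> P) R (a - 1 + s))) = 0" by simp
      moreover have "P0 \<union> P \<subseteq> {..max (f0 + m) (a + m)}" using P0 P'(2) by (auto simp: le_max_iff_disj)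
      then have "?s \<noteq> 0" by (rule sgn_nonzero[where r = r]) (use R'(1) in auto)
      ultimately show "(\<Sum>w\<in>?XF. c (Ff (a + s + r) # w) * act w Fb (St (P0 \<union> P) R (a - 1 + s))) = 0"
        by (simp only: mult_eq_0_iff simp_thms)
    qed (use finF w in auto)
    \<comment> \<open>Occupying the mode \<open>a + m\<close>, which the range of \<open>P\<close>
      includes when the flag is set, lets \<open>Hh\<close> through. Words starting with an
      \<open>Ff\<close> of the same key contribute as well, so \<open>F0\<close> has to come
      beforehand.\<close>
    have H0: "c (Hh (a + m + r) # w) = 0" if w: "w \<in> ?XH" for w
    proof (rule IH[where c = "\<lambda>w. c (Hh (a + m + r) # w)" and X = ?XH and a = a and fl = False and B = r])
      have fl: fl and a0: "f0 \<le> a" using adm[of "Hh (a + m + r) # w"] w by auto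
      then show "2 * nat a + (if False then 1 else 0) < 2 * nat a + (if fl then 1 else 0)" by simp
      show "adm s m f0 a False r w" if "w \<in> ?XH" for w
        using adm[of "Hh (a + m + r) # w"] that by simp
      fix P R assume P: "P \<subseteq> {f0 + m..a + m - 1 + (if False then 1 else 0)}" and R: "R \<subseteq> {0..<r}"
      let ?R = "insert r R" and ?P = "insert (a + m) P"
      let ?s = "sgn_H (P0 \<union> ?P) ?R (a + s) r (a + m)"
      have R': "?R \<subseteq> {0..r}" "?R \<subseteq> {0..<B}" "?R - {r} = R" using R rB by auto
      have P': "?P \<subseteq> {f0 + m..a + m - 1 + (if fl then 1 else 0)}" "?P \<subseteq> {..a + m}" using P fl a0 by auto
      have Pm: "P0 \<union> ?P - {a + m} = P0 \<union> P" using P P0 a0 by auto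
      have vanish: "c w * ?act w ?P ?R = 0" if "w \<in> X - Cons (Hh (a + m + r)) ` ?XH" for w
      proof (cases "w = [] \<or> key s m a w < r")
        case True
        then have "c w = 0" using nil smaller[of w] that by blast
        then show ?thesis by simp
      next
        case False
        have "adm s m f0 a fl B w" by (rule adm) (rule DiffD1[OF that])
        moreover have "w \<noteq> []" using False by blast
        ultimately show ?thesis
        proof (cases rule: adm_cases)
          case (F r' w')
          show ?thesis
          proof (cases "r' = r")
            case True
            then show ?thesis using F0[of w'] F that by simp
          next
            case ne: False
            then have "r < r'" using False F by simp
            then have "r' \<notin> ?R" "?R \<subseteq> {0..r'}" using R'(1) by auto
            then show ?thesis using flem[of r' ?R "act w' Fb" ?P] F by simp
          qed
        next
          case (H r' w')
          have "r' \<noteq> r" using that H(1) by blast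
          then have "r < r'" using False H by simp
          then have "r' \<notin> ?R" "?R \<subseteq> {0..r'}" using R'(1) by auto
          then show ?thesis using hlem[of r' ?R ?P "act w' Fb"] H P' by simp
        qed
      qed
      have "0 = (\<Sum>w\<in>X. c w * ?act w ?P ?R)" using sum0[OF P'(1) R'(2)] by simp
      also have "\<dots> = (\<Sum>w\<in>Cons (Hh (a + m + r)) ` ?XH. c w * ?act w ?P ?R)"
        using fin vanish by (intro sum.mono_neutral_right) auto
      also have "\<dots> = (\<Sum>w\<in>?XH. c (Hh (a + m + r) # w) * ?act (Hh (a + m + r) # w) ?P ?R)"
        by (rule sum.reindex_cong[of "Cons _"]) (simp_all only: inj_on_Cons1)
      also have "\<dots> = ?s * (\<Sum>w\<in>?XH. c (Hh (a + m + r) # w) * act w Fb (St (P0 \<union> P) R (a + s)))"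
        unfolding sum_distrib_left
      proof (rule sum.cong[OF refl])
        fix w
        show "c (Hh (a + m + r) # w) * ?act (Hh (a + m + r) # w) ?P ?R
            = ?s * (c (Hh (a + m + r) # w) * act w Fb (St (P0 \<union> P) R (a + s)))"
          using hlem[OF a0 rB(1) R'(1) P'(2), of "act w Fb"] R'(3) Pm by simp
      qed
      finally have "?s * (\<Sum>w\<in>?XH. c (Hh (a + m + r) # w) * act w Fb (St (P0 \<union> P) R (a + s))) = 0" by simp
      moreover have "P0 \<union> ?P \<subseteq> {..max (f0 + m) (a + m)}" using P0 P'(2) by (auto simp: le_max_iff_disj)
      then have "?s \<noteq> 0" by (rule sgn_nonzero[where r = r]) (use R'(1) in auto)
      ultimately show "(\<Sum>w\<in>?XH. c (Hh (a + m + r) # w) * act w Fb (St (P0 \<union> P) R (a + s))) = 0"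
        by (simp only: mult_eq_0_iff simp_thms)
    qed (use finH w in auto)
    from vadm less.prems(2) show "c v = 0"
    proof (cases rule: adm_cases)
      case (F r' w')
      then show ?thesis using F0[of w'] less.prems(1) by (simp add: r_def)
    next
      case (H r' w')
      then show ?thesis using H0[of w'] less.prems(1) by (simp add: r_def)
    qed
  qed
  then show ?case using nil less.prems(4) by (cases "w = []") auto
qed

section \<open>Words of configurations\<close>

definition blocks :: "(int \<Rightarrow> gen list) \<Rightarrow> nat \<Rightarrow> gen list" where
  "blocks g n = concat (map g (rev [1..int n]))"

lemma blocks_simps [simp]: "blocks g 0 = []" "blocks g (Suc n) = g (int n + 1) @ blocks g n"
proof -
  have "[1..int (Suc n)] = [1..int n] @ [int n + 1]" using upto_rec2[of 1 "int (Suc n)"] by simp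
  then show "blocks g (Suc n) = g (int n + 1) @ blocks g n" by (simp add: blocks_def)
qed (simp add: blocks_def)

lemma blocks_cong: "(\<And>k. 1 \<le> k \<Longrightarrow> k \<le> int n \<Longrightarrow> g k = h k) \<Longrightarrow> blocks g n = blocks h n"
  unfolding blocks_def by (intro arg_cong[of _ _ concat] map_cong) auto

lemma blocks_shift: "blocks g (Suc n) = blocks (\<lambda>k. g (k + 1)) n @ g 1"
  by (induct n) (auto simp: algebra_simps)

text \<open>The common form of all words \<open>tau\<close> apart from a final \<open>Ee 1\<close>:
  in each block the index of \<open>Hh\<close> exceeds that of \<open>Ff\<close> by
  \<open>M\<close>, and \<open>s\<close> is used with the value -1 if an \<open>Ee 1\<close> follows
  and 0 otherwise.\<close>

definition cword :: "int \<Rightarrow> int \<Rightarrow> (int \<Rightarrow> nat) \<Rightarrow> (int \<Rightarrow> nat) \<Rightarrow> nat \<Rightarrow> gen list" where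
  "cword M s \<alpha> \<beta> = blocks (\<lambda>k. replicate (\<beta> k) (Hh (k + (M + s))) @ replicate (\<alpha> k) (Ff (k + s)))"

lemma count_list_replicate: "count_list (replicate n x) y = (if x = y then n else 0)"
  by (induct n) auto

lemma count_cword_F: "count_list (cword M s \<alpha> \<beta> n) (Ff (j + s)) = (if 1 \<le> j \<and> j \<le> int n then \<alpha> j else 0)"
  by (induct n) (auto simp: cword_def count_list_replicate)

lemma count_cword_H: "count_list (cword M s \<alpha> \<beta> n) (Hh (j + (M + s))) = (if 1 \<le> j \<and> j \<le> int n then \<beta> j else 0)"
  by (induct n) (auto simp: cword_def count_list_replicate)

lemma count_cword_E: "count_list (cword M s \<alpha> \<beta> n) (Ee j) = 0"
  by (induct n) (auto simp: cword_def count_list_replicate)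

fun fcount :: "(int \<Rightarrow> nat) \<Rightarrow> nat \<Rightarrow> int" where
  "fcount \<alpha> 0 = 0"
| "fcount \<alpha> (Suc n) = fcount \<alpha> n + int (\<alpha> (int n + 1))"

lemma fcount_pos: "1 \<le> j \<Longrightarrow> j \<le> int n \<Longrightarrow> \<alpha> j \<noteq> 0 \<Longrightarrow> 1 \<le> fcount \<alpha> n"
proof (induct n)
  case (Suc n)
  have nn: "0 \<le> fcount \<alpha> k" for k by (induct k) auto
  show ?case
  proof (cases "j = int n + 1")
    case True
    then show ?thesis using Suc.prems nn[of n] by simp
  next
    case False
    then show ?thesis using Suc by simp
  qed
qed simp

text \<open>With \<open>c\<close> letters \<open>Ff\<close> in the blocks \<open>1..k\<close>, a
  letter in block \<open>k\<close> has key \<open>k - c\<close> if it is \<open>Ff\<close> and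
  \<open>k - 1 - c\<close> if it is \<open>Hh\<close>. The triangle relations make the keys decrease
  strictly along the word, the right neighbour condition forbids two consecutive \<open>Hh\<close>,
  and for \<open>f0 = 1\<close> the condition \<open>low\<close> puts an \<open>Ff\<close> to the
  right of every \<open>Hh\<close>.\<close>

lemma cword_adm:
  assumes tri: "triangle \<alpha> \<beta>" and rn: "rightnb \<alpha> \<beta>"
    and low: "f0 = 0 \<or> f0 = 1 \<and> (\<exists>j\<ge>1. \<alpha> j \<noteq> 0 \<and> (\<forall>i\<le>j. \<beta> i = 0))"
    and fl: "fl \<or> (\<forall>i. 1 \<le> i \<and> i \<le> int n \<and> \<beta> i \<noteq> 0 \<longrightarrow>
        (\<exists>j>i. j \<le> int n \<and> \<alpha> j \<noteq> 0 \<and> (\<forall>t. i + 1 \<le> t \<and> t \<le> j \<longrightarrow> \<beta> t = 0)))"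
    and B: "int n - fcount \<alpha> n + int (\<alpha> (int n)) \<le> B"
  shows "adm s (1 + (M + s)) f0 (fcount \<alpha> n) fl B (cword M s \<alpha> \<beta> n)"
proof -
  have tr: "\<beta> (i + 1) + \<alpha> (i + 1) + \<alpha> i \<le> 1" "\<beta> (i + 1) + \<beta> i + \<alpha> i \<le> 1" for i
    using tri unfolding triangle_def by auto
  have a1: "\<alpha> i \<le> 1" for i using tr(1)[of i] by simp
  have fle: "0 \<le> fcount \<alpha> n \<and> fcount \<alpha> n \<le> int n" for n
  proof (induct n)
    case (Suc n)
    then show ?case using a1[of "int n + 1"] by simp
  qed simp
  show ?thesis using fl B
  proof (induct n arbitrary: fl B)
    case (Suc n)
    let ?N = "int n + 1"
    have cw: "cword M s \<alpha> \<beta> (Suc n) =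
        replicate (\<beta> ?N) (Hh (?N + (M + s))) @ replicate (\<alpha> ?N) (Ff (?N + s)) @ cword M s \<alpha> \<beta> n"
      by (simp add: cword_def)
    have N: "int (Suc n) = ?N" by simp
    note prems = Suc.prems[unfolded N]
    consider "\<beta> ?N = 1" "\<alpha> ?N = 0" "\<alpha> (int n) = 0" | "\<alpha> ?N = 1" "\<beta> ?N = 0" "\<alpha> (int n) = 0" | "\<alpha> ?N = 0" "\<beta> ?N = 0"
      using tr(1)[of "int n"] by linarith
    then show ?case
    proof cases
      case 1
      have fl: fl
      proof (rule ccontr)
        assume "\<not> fl"
        then have "\<exists>j>?N. j \<le> ?N \<and> \<alpha> j \<noteq> 0 \<and> (\<forall>t. ?N + 1 \<le> t \<and> t \<le> j \<longrightarrow> \<beta> t = 0)"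
          using prems(1) 1(1) by (metis add.commute le_add_same_cancel1 of_nat_0_le_iff order_refl zero_neq_one)
        then show False by auto
      qed
      have f0: "f0 \<le> fcount \<alpha> n"
      proof (cases "f0 = 0")
        case False
        then obtain j where j: "f0 = 1" "j \<ge> 1" "\<alpha> j \<noteq> 0" "\<forall>i\<le>j. \<beta> i = 0" using low by blast
        then have "j \<le> int n" using 1(1) by (metis not_le zless_imp_add1_zle zero_neq_one)
        then show ?thesis using fcount_pos[of j n \<alpha>] j by simp
      qed (use fle in simp)
      have "adm s (1 + (M + s)) f0 (fcount \<alpha> n) False (int n - fcount \<alpha> n) (cword M s \<alpha> \<beta> n)"
      proof (rule Suc.hyps)
        show "False \<or> (\<forall>i. 1 \<le> i \<and> i \<le> int n \<and> \<beta> i \<noteq> 0 \<longrightarrow>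
            (\<exists>j>i. j \<le> int n \<and> \<alpha> j \<noteq> 0 \<and> (\<forall>t. i + 1 \<le> t \<and> t \<le> j \<longrightarrow> \<beta> t = 0)))"
        proof (intro disjI2 allI impI)
          fix i assume i: "1 \<le> i \<and> i \<le> int n \<and> \<beta> i \<noteq> 0"
          then obtain j where j: "j > i" "\<alpha> j \<noteq> 0" "\<forall>t. i + 1 \<le> t \<and> t \<le> j \<longrightarrow> \<beta> t = 0"
            using rn unfolding rightnb_def by blast
          have "\<not> ?N \<le> j"
          proof
            assume "?N \<le> j"
            then have "\<beta> ?N = 0" using j(3) i by simp
            then show False using 1(1) by simp
          qed
          then show "\<exists>j>i. j \<le> int n \<and> \<alpha> j \<noteq> 0 \<and> (\<forall>t. i + 1 \<le> t \<and> t \<le> j \<longrightarrow> \<beta> t = 0)"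
            using j by (intro exI[of _ j]) simp
        qed
        \<comment> \<open>The triangle relation gives \<open>\<alpha> n = 0\<close>; an
          \<open>Ff\<close> in block \<open>n\<close> would have the same key as the present
          \<open>Hh\<close>.\<close>
        show "int n - fcount \<alpha> n + int (\<alpha> (int n)) \<le> int n - fcount \<alpha> n" using 1 by simp
      qed
      moreover have "?N + (M + s) - (fcount \<alpha> n + (1 + (M + s))) = int n - fcount \<alpha> n" by simp
      ultimately show ?thesis using fl f0 fle[of n] prems(2) 1 unfolding cw by simp
    next
      case 2
      have "adm s (1 + (M + s)) f0 (fcount \<alpha> n) True (int n - fcount \<alpha> n) (cword M s \<alpha> \<beta> n)"
        by (rule Suc.hyps) (use 2 in auto)
      moreover have "?N + s - (fcount \<alpha> n + 1 + s) = int n - fcount \<alpha> n" by simp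
      ultimately show ?thesis using fle[of n] prems(2) 2 unfolding cw by simp
    next
      case 3
      have "adm s (1 + (M + s)) f0 (fcount \<alpha> n) fl B (cword M s \<alpha> \<beta> n)"
      proof (rule Suc.hyps)
        show "fl \<or> (\<forall>i. 1 \<le> i \<and> i \<le> int n \<and> \<beta> i \<noteq> 0 \<longrightarrow>
            (\<exists>j>i. j \<le> int n \<and> \<alpha> j \<noteq> 0 \<and> (\<forall>t. i + 1 \<le> t \<and> t \<le> j \<longrightarrow> \<beta> t = 0)))"
        proof (rule disjE[OF prems(1)], blast, intro disjI2 allI impI)
          fix i assume *: "\<forall>i. 1 \<le> i \<and> i \<le> ?N \<and> \<beta> i \<noteq> 0 \<longrightarrow>
              (\<exists>j>i. j \<le> ?N \<and> \<alpha> j \<noteq> 0 \<and> (\<forall>t. i + 1 \<le> t \<and> t \<le> j \<longrightarrow> \<beta> t = 0))"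
            and i: "1 \<le> i \<and> i \<le> int n \<and> \<beta> i \<noteq> 0"
          then obtain j where j: "j > i" "j \<le> ?N" "\<alpha> j \<noteq> 0" "\<forall>t. i + 1 \<le> t \<and> t \<le> j \<longrightarrow> \<beta> t = 0" by auto
          then have "j \<noteq> ?N" using 3 by auto
          then show "\<exists>j>i. j \<le> int n \<and> \<alpha> j \<noteq> 0 \<and> (\<forall>t. i + 1 \<le> t \<and> t \<le> j \<longrightarrow> \<beta> t = 0)"
            using j by (intro exI[of _ j]) simp
        qed
        show "int n - fcount \<alpha> n + int (\<alpha> (int n)) \<le> B" using prems(2) 3 a1[of "int n"] by simp
      qed
      then show ?thesis using 3 unfolding cw by simp
    qed
  qed (simp add: cword_def)
qed

lemma triangle_shift: "triangle a b \<Longrightarrow> triangle (\<lambda>k. a (k + c)) (\<lambda>k. b (k + c))"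
  unfolding triangle_def
proof
  fix i assume "\<forall>i. b (i + 1) + a (i + 1) + a i \<le> 1 \<and> b (i + 1) + b i + a i \<le> 1"
  from this[THEN spec[of _ "i + c"]]
  show "b (i + 1 + c) + a (i + 1 + c) + a (i + c) \<le> 1 \<and> b (i + 1 + c) + b (i + c) + a (i + c) \<le> 1"
    by (simp add: algebra_simps)
qed

lemma rightnb_shift: "rightnb a b \<Longrightarrow> rightnb (\<lambda>k. a (k + c)) (\<lambda>k. b (k + c))"
  unfolding rightnb_def
proof (intro allI impI)
  fix i assume *: "\<forall>i. b i \<noteq> 0 \<longrightarrow> (\<exists>j>i. a j \<noteq> 0 \<and> (\<forall>s. i + 1 \<le> s \<and> s \<le> j \<longrightarrow> b s = 0))" and "b (i + c) \<noteq> 0"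
  then obtain j where "j > i + c" "a j \<noteq> 0" "\<forall>s. i + c + 1 \<le> s \<and> s \<le> j \<longrightarrow> b s = 0" by blast
  then show "\<exists>j>i. a (j + c) \<noteq> 0 \<and> (\<forall>s. i + 1 \<le> s \<and> s \<le> j \<longrightarrow> b (s + c) = 0)"
    by (intro exI[of _ "j - c"]) auto
qed

text \<open>Above block \<open>n\<close> there is no \<open>a\<close>, so every \<open>b\<close> has
  its right neighbour inside the word and the flag may start as false. The summand 1 in the bound
  covers an \<open>Ff\<close> in block \<open>n\<close>.\<close>

lemma cword_adm_top:
  assumes "triangle \<alpha> \<beta>" "rightnb \<alpha> \<beta>"
    "f0 = 0 \<or> f0 = 1 \<and> (\<exists>j\<ge>1. \<alpha> j \<noteq> 0 \<and> (\<forall>i\<le>j. \<beta> i = 0))" "\<And>j. int n < j \<Longrightarrow> \<alpha> j = 0"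
    "int n - fcount \<alpha> n + 1 \<le> B"
  shows "adm s (1 + (M + s)) f0 (fcount \<alpha> n) False B (cword M s \<alpha> \<beta> n)"
proof (rule cword_adm[OF assms(1-3)])
  show "False \<or> (\<forall>i. 1 \<le> i \<and> i \<le> int n \<and> \<beta> i \<noteq> 0 \<longrightarrow>
      (\<exists>j>i. j \<le> int n \<and> \<alpha> j \<noteq> 0 \<and> (\<forall>t. i + 1 \<le> t \<and> t \<le> j \<longrightarrow> \<beta> t = 0)))"
    using assms(2,4) unfolding rightnb_def by (meson not_le)
  have "\<alpha> (int n) \<le> 1"
    using assms(1)[unfolded triangle_def, THEN spec[of _ "int n"]] by simp
  then show "int n - fcount \<alpha> n + int (\<alpha> (int n)) \<le> B" using assms(5) by simp
qed

definition tword :: "int \<Rightarrow> int \<Rightarrow> (int \<Rightarrow> nat) \<times> (int \<Rightarrow> nat) \<Rightarrow> gen list" where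
  "tword M N ab = (case ab of (a, b) \<Rightarrow> if M = 0 then tw0 N a b else if M = 1 then tw1 N a b else twm N a b)"

lemma tau_tword: "tau M N ab = bv (tword M N ab)"
  by (simp add: tau_def tword_def)

lemma replicate_swap: "p + q \<le> (1 :: nat) \<Longrightarrow> replicate p x @ replicate q y = replicate q y @ replicate p x"
  by (cases p; cases q) auto

lemma tw0_cword:
  assumes "triangle a b" "N \<ge> 1" shows "tw0 N a b = cword 0 0 a b (nat (N - 1))"
proof -
  have tr: "a k + b k \<le> 1" for k
    using assms(1)[unfolded triangle_def, THEN spec[of _ "k - 1"]] by simp
  have "tw0 N a b = blocks (\<lambda>k. replicate (a k) (Ff k) @ replicate (b k) (Hh k)) (nat (N - 1))"
    using assms(2) by (simp add: tw0_def blocks_def)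
  also have "\<dots> = cword 0 0 a b (nat (N - 1))"
    unfolding cword_def using replicate_swap[OF tr] by (intro blocks_cong) simp
  finally show ?thesis .
qed

lemma tw1_cword_E: "N \<ge> 0 \<Longrightarrow> a 0 = 0 \<Longrightarrow> tw1 N a b = cword 1 (-1) a b (nat N) @ [Ee 1]"
  by (simp add: tw1_def cword_def blocks_def)

text \<open>For \<open>a 0 = 1\<close> the letter \<open>Ee 1\<close> is absent and the triangle
  relation empties block 1; the remaining blocks are renumbered by one.\<close>

lemma tw1_cword:
  assumes "triangle a b" "N \<ge> 0" "a 0 = 1"
  shows "tw1 N a b = cword 1 0 (\<lambda>k. a (k + 1)) (\<lambda>k. b (k + 1)) (nat (N - 1))"
proof (cases "N = 0")
  case False
  have z: "a 1 = 0" "b 1 = 0" using assms(1)[unfolded triangle_def, THEN spec[of _ 0]] assms(3) by auto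
  let ?g = "\<lambda>k. replicate (b k) (Hh k) @ replicate (a k) (Ff (k - 1))"
  have n: "nat N = Suc (nat (N - 1))" using False assms(2) by simp
  have "tw1 N a b = blocks ?g (nat N)" using assms by (simp add: tw1_def blocks_def)
  also have "\<dots> = blocks (\<lambda>k. ?g (k + 1)) (nat (N - 1)) @ ?g 1" unfolding n by (rule blocks_shift)
  finally show ?thesis using z by (simp add: cword_def)
qed (simp add: tw1_def cword_def assms)

text \<open>The letters are regrouped: \<open>Hh k\<close> passes into block \<open>k + 1\<close>
  next to \<open>Ff (k + 1)\<close>, which makes the difference of indices \<open>-1\<close>. In
  every exchange the triangle relations leave at most one of the two letters present.\<close>

lemma twm_cword:
  assumes "triangle a b" "N \<ge> 2" "b 0 = 0" "b (N - 1) = 0"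
  shows "twm N a b = cword (-1) 0 (\<lambda>k. a (k + - 1)) (\<lambda>k. b (k + - 1)) (nat (N - 1))"
proof -
  let ?h = "\<lambda>k. replicate (b k) (Hh k)" and ?f = "\<lambda>k. replicate (a (k - 1)) (Ff k)"
  have tr: "b k + a k \<le> 1" "b k + a (k - 1) \<le> 1" for k
    using assms(1)[unfolded triangle_def, THEN spec[of _ "k - 1"]] by simp_all
  have "blocks (\<lambda>k. ?h k @ ?f k) n = ?h (int n) @ blocks (\<lambda>k. ?f k @ ?h (k - 1)) n" for n
    using assms(3) by (induct n) (simp_all add: add.commute)
  moreover have "twm N a b = blocks (\<lambda>k. ?h k @ ?f k) (nat (N - 1))"
  proof -
    have "twm N a b = blocks (\<lambda>k. ?f k @ ?h k) (nat (N - 1))" using assms(2) by (simp add: twm_def blocks_def)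
    also have "\<dots> = blocks (\<lambda>k. ?h k @ ?f k) (nat (N - 1))"
      by (rule blocks_cong) (use tr in \<open>auto intro!: replicate_swap simp: add.commute\<close>)
    finally show ?thesis .
  qed
  moreover have "blocks (\<lambda>k. ?f k @ ?h (k - 1)) n = cword (-1) 0 (\<lambda>k. a (k + - 1)) (\<lambda>k. b (k + - 1)) n" for n
    unfolding cword_def
    by (rule blocks_cong) (use tr(1) in \<open>auto intro!: replicate_swap simp: add.commute\<close>)
  ultimately show ?thesis using assms(2,4) by simp
qed

text \<open>\<open>N - a\<close> bounds the vacancies that test states of charge \<open>a\<close>
  may have. For \<open>M = -1\<close> the mode \<open>a + 1 + M\<close> of colour 1 used by an
  \<open>Hh\<close> is positive only if \<open>a >= 1\<close>, whence \<open>f0 = 1\<close>.\<close>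

definition plain_word :: "int \<Rightarrow> int \<Rightarrow> int \<Rightarrow> gen list \<Rightarrow> bool" where
  "plain_word M N a w \<longleftrightarrow> adm 0 (1 + M) (if M = -1 then 1 else 0) a False (N - a) w \<and> (M = -1 \<longrightarrow> 1 \<le> a)"

text \<open>The \<open>Ee 1\<close> that follows lowers the charge to \<open>a - 1\<close> and
  occupies mode 1 of colour 1; \<open>f0 = 1\<close> keeps the modes used by \<open>Hh\<close> above
  it.\<close>

definition E_word :: "int \<Rightarrow> int \<Rightarrow> gen list \<Rightarrow> bool" where
  "E_word N a w \<longleftrightarrow> adm (-1) 1 1 a False (N - (a - 1)) w \<and> 1 \<le> a"

lemma tword_kind:
  assumes "M \<in> {-1, 0, 1}" "M + N \<ge> 1" "ab \<in> Cset M N"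
  shows "(\<exists>a. plain_word M N a (tword M N ab)) \<or> M = 1 \<and> (\<exists>w a. tword M N ab = w @ [Ee 1] \<and> E_word N a w)"
proof -
  obtain a b where ab: "ab = (a, b)" by (cases ab)
  from assms(1) consider "M = 0" | "M = 1" | "M = -1" by blast
  then show ?thesis
  proof cases
    case 1
    then have C: "triangle a b" "rightnb a b" "\<And>i. N - 1 < i \<Longrightarrow> a i = 0" and N: "N \<ge> 1"
      using assms by (auto simp: Cset_def C0_def ab)
    have "adm 0 (1 + (0 + 0)) 0 (fcount a (nat (N - 1))) False (N - fcount a (nat (N - 1))) (cword 0 0 a b (nat (N - 1)))"
      using C N by (intro cword_adm_top) auto
    then show ?thesis using 1 tw0_cword[OF C(1) N] by (auto simp: plain_word_def tword_def ab)
  next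
    case 2
    then have C: "triangle a b" "rightnb a b" "\<And>i. N < i \<Longrightarrow> a i = 0" "\<And>i. i < 0 \<Longrightarrow> a i = 0" "a 0 \<le> 1"
      and ex: "\<exists>j. a j \<noteq> 0 \<and> (\<forall>s\<le>j. b s = 0)" and N: "N \<ge> 0"
      using assms by (auto simp: Cset_def C1_def ab)
    show ?thesis
    proof (cases "a 0 = 0")
      case True
      obtain j where j: "a j \<noteq> 0" "\<forall>s\<le>j. b s = 0" using ex by blast
      have "\<not> j < 0" "j \<noteq> 0" "\<not> N < j" using j True C(3,4)[of j] by auto
      then have j1: "1 \<le> j" "j \<le> N" by auto
      let ?c = "fcount a (nat N)"
      have "adm (-1) (1 + (1 + -1)) 1 ?c False (N - (?c - 1)) (cword 1 (-1) a b (nat N))"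
        using C N j j1 by (intro cword_adm_top) auto
      moreover have "1 \<le> ?c" using fcount_pos[of j "nat N" a] j j1 by simp
      ultimately show ?thesis using 2 tw1_cword_E[of N a b, OF N True] by (auto simp: E_word_def tword_def ab)
    next
      case False
      then have a0: "a 0 = 1" using C(5) by simp
      let ?a = "\<lambda>k. a (k + 1)" and ?b = "\<lambda>k. b (k + 1)"
      let ?c = "fcount ?a (nat (N - 1))"
      have "adm 0 (1 + (1 + 0)) 0 ?c False (N - ?c) (cword 1 0 ?a ?b (nat (N - 1)))"
      proof (cases "N = 0")
        case True
        then show ?thesis by (simp add: cword_def)
      next
        case False
        then show ?thesis using C N triangle_shift[OF C(1), of 1] rightnb_shift[OF C(2), of 1]
          by (intro cword_adm_top) auto
      qed
      then show ?thesis using 2 tw1_cword[of a b N, OF C(1) N a0] by (auto simp: plain_word_def tword_def ab)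
    qed
  next
    case 3
    then have C: "triangle a b" "rightnb a b" "\<And>i. N - 2 < i \<Longrightarrow> a i = 0" "\<And>i. i < 0 \<Longrightarrow> a i = 0"
      and b: "b 0 = 0" "b (N - 1) = 0"
      and ex: "\<exists>j. a j \<noteq> 0 \<and> (\<forall>s\<le>j. b s = 0)" and N: "N \<ge> 2"
      using assms by (auto simp: Cset_def C1_def ab)
    obtain j where j: "a j \<noteq> 0" "\<forall>s\<le>j. b s = 0" using ex by blast
    have "\<not> j < 0" "\<not> N - 2 < j" using j C(3,4)[of j] by auto
    then have j1: "0 \<le> j" "j \<le> N - 2" by auto
    let ?a = "\<lambda>k. a (k + - 1)" and ?b = "\<lambda>k. b (k + - 1)"
    let ?c = "fcount ?a (nat (N - 1))"
    have "\<exists>j\<ge>1. ?a j \<noteq> 0 \<and> (\<forall>i\<le>j. ?b i = 0)" using j j1 by (intro exI[of _ "j + 1"]) auto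
    then have "adm 0 (1 + (-1 + 0)) 1 ?c False (N - ?c) (cword (-1) 0 ?a ?b (nat (N - 1)))"
      using C N triangle_shift[OF C(1), of "-1"] rightnb_shift[OF C(2), of "-1"]
      by (intro cword_adm_top) auto
    moreover have "1 \<le> ?c" using fcount_pos[of "j + 1" "nat (N - 1)" ?a] j j1 by simp
    ultimately show ?thesis using 3 twm_cword[OF C(1) N b] by (auto simp: plain_word_def tword_def ab)
  qed
qed

text \<open>Counting the occurrences of each letter recovers the entries of the configuration; for
  \<open>M = 1\<close> the letter \<open>Ee 1\<close> decides beforehand whether \<open>a 0\<close>
  is 0 or 1.\<close>

lemma inj_on_tword:
  assumes "M \<in> {-1, 0, 1}" "M + N \<ge> 1" shows "inj_on (tword M N) (Cset M N)"
proof (rule inj_onI)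
  fix x y assume xy: "x \<in> Cset M N" "y \<in> Cset M N" and eq: "tword M N x = tword M N y"
  obtain a b c d where p: "x = (a, b)" "y = (c, d)" by (cases x, cases y) blast
  have cw: "(\<forall>k. 1 \<le> k \<and> k \<le> int n \<longrightarrow> \<alpha> k = \<gamma> k \<and> \<beta> k = \<delta> k)"
    if "cword M' s \<alpha> \<beta> n = cword M' s \<gamma> \<delta> n" for M' s \<alpha> \<beta> \<gamma> \<delta> n
  proof (intro allI impI)
    fix k assume k: "1 \<le> k \<and> k \<le> int n"
    show "\<alpha> k = \<gamma> k \<and> \<beta> k = \<delta> k"
      using k count_cword_F[of M' s \<alpha> \<beta> n k, unfolded that count_cword_F]
        count_cword_H[of M' s \<alpha> \<beta> n k, unfolded that count_cword_H] by simp
  qed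
  from assms(1) consider "M = 0" | "M = 1" | "M = -1" by blast
  then show "x = y"
  proof cases
    case 1
    have C: "a i = 0 \<and> c i = 0 \<and> b i = 0 \<and> d i = 0" if "i < 1 \<or> N - 1 < i" for i
      using that xy 1 by (cases "i = 0") (auto simp: Cset_def C0_def p)
    have t: "triangle a b" "triangle c d" using 1 xy by (auto simp: Cset_def C0_def p)
    have N: "N \<ge> 1" using 1 assms by simp
    have "\<forall>k. 1 \<le> k \<and> k \<le> int (nat (N - 1)) \<longrightarrow> a k = c k \<and> b k = d k"
      using eq tw0_cword[OF t(1) N] tw0_cword[OF t(2) N] 1 by (intro cw[of 0 0]) (simp add: tword_def p)
    then have "a k = c k \<and> b k = d k" for k
      using C[of k] N by (cases "1 \<le> k \<and> k \<le> N - 1") auto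
    then show ?thesis by (simp add: p fun_eq_iff)
  next
    case 2
    have t: "triangle a b" "triangle c d" and N: "N \<ge> 0" using 2 xy assms by (auto simp: Cset_def C1_def p)
    have C: "a i = 0 \<and> c i = 0" if "i < 0 \<or> N < i" for i using that xy 2 by (auto simp: Cset_def C1_def p)
    have D: "b i = 0 \<and> d i = 0" if "i < 1 \<or> N < i" for i using that xy 2 by (auto simp: Cset_def C1_def p)
    have le: "a 0 \<le> 1" "c 0 \<le> 1" using xy 2 by (auto simp: Cset_def C1_def p)
    have E: "count_list (tw1 N a b) (Ee 1) = (if a 0 = 0 then 1 else 0)"
      if "triangle a b" "a 0 \<le> 1" for a b
    proof (cases "a 0 = 0")
      case True
      then show ?thesis unfolding tw1_cword_E[of N a b, OF N True] by (simp add: count_cword_E)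
    next
      case False
      then have "a 0 = 1" using that(2) by linarith
      then show ?thesis unfolding tw1_cword[OF that(1) N \<open>a 0 = 1\<close>] by (simp add: count_cword_E)
    qed
    have weq: "tw1 N a b = tw1 N c d" using eq 2 by (simp add: tword_def p)
    have "(if a 0 = 0 then 1 else 0 :: nat) = (if c 0 = 0 then 1 else 0)"
      using E[OF t(1) le(1), unfolded weq E[OF t(2) le(2)]] by (rule sym)
    then have "a 0 = 0 \<longleftrightarrow> c 0 = 0" by (simp split: if_splits)
    then have ac: "a 0 = 0 \<and> c 0 = 0 \<or> a 0 = 1 \<and> c 0 = 1" using le by linarith
    have "a k = c k \<and> b k = d k" for k
      using ac
    proof
      assume z: "a 0 = 0 \<and> c 0 = 0"
      have "\<forall>k. 1 \<le> k \<and> k \<le> int (nat N) \<longrightarrow> a k = c k \<and> b k = d k"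
        using weq tw1_cword_E[OF N, of a b] tw1_cword_E[OF N, of c d] z by (intro cw[of 1 "-1"]) simp
      note in_range = this[THEN spec[of _ k]]
      consider "k = 0" | "1 \<le> k \<and> k \<le> N" | "k < 0 \<or> N < k" by linarith
      then show ?thesis
      proof cases
        case 1
        then show ?thesis using z D[of 0] by simp
      next
        case 2
        then show ?thesis using in_range by simp
      next
        case 3
        then have "k < 1 \<or> N < k" by auto
        then show ?thesis using C[OF 3] D by simp
      qed
    next
      assume z: "a 0 = 1 \<and> c 0 = 1"
      have z1: "a 1 = 0" "b 1 = 0" "c 1 = 0" "d 1 = 0"
        using t[unfolded triangle_def, THEN spec[of _ 0]] z by auto
      have "\<forall>k. 1 \<le> k \<and> k \<le> int (nat (N - 1)) \<longrightarrow> a (k + 1) = c (k + 1) \<and> b (k + 1) = d (k + 1)"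
        using weq tw1_cword[OF t(1) N] tw1_cword[OF t(2) N] z by (intro cw[of 1 0]) simp
      note in_range = this[THEN spec[of _ "k - 1"]]
      consider "k = 0" | "k = 1" | "2 \<le> k \<and> k \<le> N" | "k < 0 \<or> N < k" by linarith
      then show ?thesis
      proof cases
        case 1
        then show ?thesis using z D[of 0] by simp
      next
        case 2
        then show ?thesis using z1 by simp
      next
        case 3
        then show ?thesis using in_range by simp
      next
        case 4
        then have "k < 1 \<or> N < k" by auto
        then show ?thesis using C[OF 4] D by simp
      qed
    qed
    then show ?thesis by (simp add: p fun_eq_iff)
  next
    case 3
    have t: "triangle a b" "triangle c d" and N: "N \<ge> 2"
      and b: "b 0 = 0" "b (N - 1) = 0" "d 0 = 0" "d (N - 1) = 0"
      using 3 xy assms by (auto simp: Cset_def C1_def p)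
    have C: "a i = 0 \<and> c i = 0 \<and> b i = 0 \<and> d i = 0" if "i < 0 \<or> N - 2 < i" for i
      using that xy 3 by (auto simp: Cset_def C1_def p)
    have "\<forall>k. 1 \<le> k \<and> k \<le> int (nat (N - 1)) \<longrightarrow> a (k + - 1) = c (k + - 1) \<and> b (k + - 1) = d (k + - 1)"
      using eq twm_cword[OF t(1) N b(1,2)] twm_cword[OF t(2) N b(3,4)] 3
      by (intro cw[of "-1" 0]) (simp add: tword_def p)
    from this[THEN spec[of _ "k + 1" for k]]
    have "a k = c k \<and> b k = d k" for k
      using C[of k] N by (cases "0 \<le> k \<and> k \<le> N - 2") auto
    then show ?thesis by (simp add: p fun_eq_iff)
  qed
qed

section \<open>Independence of the vectors \<open>tau\<close>\<close>

lemma chg_append: "chg (u @ v) = chg u + chg v"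
  by (induct u rule: chg.induct) auto

text \<open>Only words of charge \<open>a\<close> contribute at test states of charge
  \<open>a\<close>. Words ending with \<open>Ee 1\<close> do not contribute: they occur for
  \<open>M = 1\<close>, where \<open>P\<close> starts at \<open>f0 + 1 + M = 2\<close> and leaves
  mode 1 of colour 1 empty.\<close>

lemma plain_words_independent:
  fixes c :: "gen list \<Rightarrow> complex"
  assumes X: "finite X" and M: "M \<in> {-1, 0, 1}" and N: "N \<ge> 0"
    and kind: "\<And>w. w \<in> X \<Longrightarrow> (\<exists>a. plain_word M N a w) \<or> M = 1 \<and> (\<exists>w'. w = w' @ [Ee 1])"
    and zero: "\<And>Q R m. Q \<subseteq> {..m + M} \<Longrightarrow> 0 \<le> m + M \<Longrightarrow> R \<subseteq> {0..<N - m} \<Longrightarrow> m \<le> N \<Longrightarrow>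
        (M = -1 \<Longrightarrow> 1 \<le> m) \<Longrightarrow> (\<Sum>w\<in>X. c w * act w vac (St Q R m)) = 0"
    and w: "w \<in> X" "plain_word M N a w"
  shows "c w = 0"
proof -
  define f0 :: int where "f0 = (if M = -1 then 1 else 0)"
  let ?Xa = "{w \<in> X. plain_word M N a w}"
  have a: "0 \<le> a" "a \<le> N" "M = -1 \<Longrightarrow> 1 \<le> a"
    using w(2) adm_chg adm_Nil_or_pos N unfolding plain_word_def by (meson, fastforce, blast)
  show ?thesis
  proof (rule peeling[where Fb = vac and ?P0.0 = "{}" and s = 0 and ?f0.0 = f0 and m = "1 + M" and X = ?Xa and a = a
        and fl = False and B = "N - a"])
    show "vac (St {} {} 0) \<noteq> 0" by (simp add: vac_St vac_def)
    show "adm 0 (1 + M) f0 a False (N - a) w" if "w \<in> ?Xa" for w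
      using that by (simp add: plain_word_def f0_def)
    show "1 \<le> f0 + (1 + M)" using M by (auto simp: f0_def)
    fix P R assume P: "P \<subseteq> {f0 + (1 + M)..a + (1 + M) - 1 + (if False then 1 else 0)}" and R: "R \<subseteq> {0..<N - a}"
    have "(\<Sum>w\<in>X. c w * act w vac (St P R a)) = 0"
    proof (rule zero)
      show "P \<subseteq> {..a + M}" using P by auto
      show "0 \<le> a + M" using a M by auto
    qed (use R a in auto)
    moreover have "act w vac (St P R a) = 0" if w: "w \<in> X - ?Xa" for w
    proof (cases "\<exists>a. plain_word M N a w")
      case True
      then obtain a' where a': "plain_word M N a' w" by blast
      then have "a' \<noteq> a" using w by blast
      moreover have "chg w = a'" using a' adm_chg unfolding plain_word_def by blast
      ultimately show ?thesis using act_vac_St_charge by blast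
    next
      case False
      then obtain w' where w': "M = 1" "w = w' @ [Ee 1]" using kind w by blast
      have "site 1 1 \<notin> St P R a" using P w'(1) by (auto simp: f0_def)
      then show ?thesis using act_E1_vac_unoccupied[of "St P R a" w'] w'(2) by (simp add: act_append)
    qed
    ultimately show "(\<Sum>w\<in>?Xa. c w * act w vac (St ({} \<union> P) R (a + 0))) = 0"
      using X sum.mono_neutral_left[of X ?Xa "\<lambda>w. c w * act w vac (St P R a)"] by auto
  qed (use X w in auto)
qed

text \<open>With the plain words eliminated, mode 1 of colour 1 may be occupied throughout. The
  final \<open>Ee 1\<close> is absorbed into the base vector \<open>e_1 v\<close>, and peeling
  applies to the letters in front of it.\<close>

lemma E_words_independent:
  fixes c :: "gen list \<Rightarrow> complex"
  assumes X: "finite X" and N: "N \<ge> 0"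
    and kind: "\<And>w. w \<in> X \<Longrightarrow> c w = 0 \<or> (\<exists>w' a. w = w' @ [Ee 1] \<and> E_word N a w')"
    and zero: "\<And>Q R m. Q \<subseteq> {..m + 1} \<Longrightarrow> 0 \<le> m + 1 \<Longrightarrow> R \<subseteq> {0..<N - m} \<Longrightarrow> m \<le> N \<Longrightarrow>
        (\<Sum>w\<in>X. c w * act w vac (St Q R m)) = 0"
    and w: "w @ [Ee 1] \<in> X" "E_word N a w"
  shows "c (w @ [Ee 1]) = 0"
proof -
  let ?Xa = "{w. w @ [Ee 1] \<in> X \<and> E_word N a w}"
  have a: "1 \<le> a" "a - 1 \<le> N"
    using w(2) adm_Nil_or_pos N unfolding E_word_def by (blast, fastforce)
  have inj: "inj_on (\<lambda>w. w @ [Ee 1]) A" for A by (auto simp: inj_on_def)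
  have "finite {w. w @ [Ee 1] \<in> X}"
    using finite_vimageI[OF X inj] by (simp add: vimage_def)
  then have fin: "finite ?Xa" by (rule rev_finite_subset) auto
  show ?thesis
  proof (rule peeling[where Fb = "cur 1 2 1 vac" and ?P0.0 = "{1}" and s = "-1" and ?f0.0 = 1 and m = 1 and X = ?Xa
        and a = a and fl = False and B = "N - (a - 1)" and c = "\<lambda>w. c (w @ [Ee 1])"])
    show "cur 1 2 1 vac (St {1} {} (-1)) \<noteq> 0" by (rule E1_vac_St)
    show "adm (-1) 1 1 a False (N - (a - 1)) w" if "w \<in> ?Xa" for w
      using that by (simp add: E_word_def)
    fix P R assume P: "P \<subseteq> {1 + 1..a + 1 - 1 + (if False then 1 else 0)}" and R: "R \<subseteq> {0..<N - (a - 1)}"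
    let ?S = "St ({1} \<union> P) R (a + - 1)"
    have "(\<Sum>w\<in>X. c w * act w vac ?S) = 0"
      by (rule zero) (use P R a in auto)
    moreover have "c w * act w vac ?S = 0" if w: "w \<in> X - (\<lambda>w. w @ [Ee 1]) ` ?Xa" for w
    proof (cases "c w = 0")
      case False
      then obtain w' a' where w': "w = w' @ [Ee 1]" "E_word N a' w'" using kind w by blast
      then have "a' \<noteq> a" using w by blast
      moreover have "chg w = a' - 1" using w' adm_chg[of "-1" 1 1 a' False "N - (a' - 1)" w']
        by (simp add: E_word_def chg_append)
      ultimately show ?thesis using act_vac_St_charge[of w "{1} \<union> P" R "a + - 1"] by auto
    qed simp
    ultimately have "(\<Sum>w\<in>(\<lambda>w. w @ [Ee 1]) ` ?Xa. c w * act w vac ?S) = 0"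
      using X sum.mono_neutral_left[of X "(\<lambda>w. w @ [Ee 1]) ` ?Xa" "\<lambda>w. c w * act w vac ?S"] by auto
    then show "(\<Sum>w\<in>?Xa. c (w @ [Ee 1]) * act w (cur 1 2 1 vac) ?S) = 0"
      by (simp add: sum.reindex[OF inj] act_append)
  qed (use fin w in auto)
qed

lemma tau_indep:
  assumes M: "M \<in> {-1, 0, 1}" and MN: "M + N \<ge> 1"
  shows "indep_mod (JMN M N) (tau M N) (Cset M N)"
  unfolding indep_mod_def
proof (intro allI impI, elim conjE)
  fix c S assume S: "S \<subseteq> Cset M N" "finite S" and J: "(\<Sum>x\<in>S. sc (c x) (tau M N x)) \<in> JMN M N"
  have N: "N \<ge> 0" using M MN by auto
  have inj: "inj_on (tword M N) S" using inj_on_subset[OF inj_on_tword[OF M MN] S(1)] .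
  let ?X = "tword M N ` S"
  \<comment> \<open>Peeling works on words, so the coefficients are transported along the injective
    map \<open>tword\<close>.\<close>
  let ?c = "\<lambda>w. c (the_inv_into S (tword M N) w)"
  have cw: "?c (tword M N x) = c x" if "x \<in> S" for x
    using the_inv_into_f_f[OF inj that] by simp
  have zero: "(\<Sum>w\<in>?X. ?c w * act w vac (St Q R m)) = 0"
    if st: "Q \<subseteq> {..m + M}" "0 \<le> m + M" "R \<subseteq> {0..<N - m}" "m \<le> N" "M = -1 \<Longrightarrow> 1 \<le> m" for Q R m
  proof -
    have "R \<subseteq> {..N - m}" using st(3) by auto
    then have g: "good (St Q R m)" by (rule good_St[OF st(1)])
    have "St Q R m \<noteq> {..3}" if "M = -1 \<or> N = -1"
    proof -
      \<comment> \<open>For \<open>M = -1\<close> the test states have charge at least 1, which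
        separates them from the vacuum.\<close>
      have "site 2 1 \<in> St Q R m" using st(5) that N by auto
      then show ?thesis by (auto simp: site_def)
    qed
    then have "JMN M N \<subseteq> killed {St Q R m}"
      using gen_in_St_zero[OF st(1-4)] by (intro JMN_killed[OF g])
    then have "Phi (\<Sum>x\<in>S. sc (c x) (tau M N x)) (St Q R m) = 0" using J by (auto simp: killed_def)
    then have "(\<Sum>x\<in>S. c x * act (tword M N x) vac (St Q R m)) = 0"
      by (simp add: Phi_sum Phi_sc tau_tword sum_fun_apply sc_apply)
    then show ?thesis by (simp add: sum.reindex[OF inj] cw)
  qed
  have kind: "(\<exists>a. plain_word M N a w) \<or> M = 1 \<and> (\<exists>w' a. w = w' @ [Ee 1] \<and> E_word N a w')" if "w \<in> ?X" for w
    using that tword_kind[OF M MN] S(1) by blast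
  have plain: "?c w = 0" if "w \<in> ?X" "plain_word M N a w" for w a
    by (rule plain_words_independent[of ?X M N ?c, OF _ M N _ zero that]) (use S(2) kind in blast)+
  have "?c w = 0" if w: "w \<in> ?X" for w
  proof (cases "\<exists>a. plain_word M N a w")
    case False
    then obtain w' a where w': "M = 1" "w = w' @ [Ee 1]" "E_word N a w'" using kind[OF w] by blast
    have "?c (w' @ [Ee 1]) = 0"
    proof (rule E_words_independent[of ?X N ?c])
      show "?c v = 0 \<or> (\<exists>w' a. v = w' @ [Ee 1] \<and> E_word N a w')" if "v \<in> ?X" for v
        using kind[OF that] plain[OF that] by blast
      show "(\<Sum>w\<in>?X. ?c w * act w vac (St Q R m)) = 0"
        if "Q \<subseteq> {..m + 1}" "0 \<le> m + 1" "R \<subseteq> {0..<N - m}" "m \<le> N" for Q R m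
        using zero[of Q m R] that w'(1) by simp
    qed (use S(2) N w w' in auto)
    then show ?thesis using w' by simp
  qed (use plain w in blast)
  then show "\<forall>x\<in>S. c x = 0" using cw by (metis imageI)
qed

theorem theorem5p2p1:
  fixes M N :: int
  assumes "M \<in> {-1, 0, 1}" and "N \<ge> -1" and "M + N \<ge> 1"
  shows "indep_mod (JMN M N) (tau M N) (Cset M N)
       \<and> spans_mod (JMN M N) (tau M N) (Cset M N)
       \<and> qdim (JMN M N) = 2 ^ nat (M + N - 1)"
proof -
  have indep: "indep_mod (JMN M N) (tau M N) (Cset M N)" using assms(1,3) by (rule tau_indep)
  obtain S where S: "S \<subseteq> Cset M N" "finite S" "card S = 2 ^ nat (M + N - 1)"
    using Cset_large[OF assms(1,3)] by blast
  have f: "fins (tau M N x)" for x by (simp add: tau_tword)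
  show ?thesis
    using basis_mod_criterion[OF subspace_JMN codim_le_JMN[OF assms(1,3)] f indep S] indep by blast
qed


end
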